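(* Let $K$ be a finite simplicial complex with a position function $v:K_0\to\mathbb{R}^d$, let $F:\mathcal{D}\to\mathcal{B}$ be a feature map into a separable real Banach space with a labeled decomposition $\hat F:\hat{\mathcal{D}}_K\to\mathcal{B}^{S(K)}$, and let $X:(\Omega,\mathcal{F},P)\to\mathbb{R}^m$ be a Borel random variable on a probability space. Let $V:(\Omega,\mathcal{F},P)\to\mathcal{B}^S$ be any one of the three random variables $\eta_{S(K)}\circ X$ (with $S=S(K)$), $\eta_K\circ X$ (with $S=K$), or $\eta_{\mathcal{C}}\circ X$ (with $S=\mathcal{C}$), where $\eta_{S(K)}=\hat F\circ\hat\alpha$, $\eta_K=\bar F\circ\hat\alpha$, $\eta_{\mathcal{C}}=\tilde F\circ\hat\alpha$ are the maps defined in the context. Let $(V_k)_{k\in\mathbb{N}}$ be a sequence of independent copies of $V$ and for $n\ge1$ let $S_n=\sum_{k=1}^nV_k$. Assume that $\mathcal{B}$ has type 2. If $E[\|V\|]<\infty$ and $E[\|V\|^2]<\infty$, then $\sqrt n\left(\frac1nS_n-E[V]\right)$ converges in distribution, as $n\to\infty$, to a Gaussian random variable in $\mathcal{B}^S$ with the same covariance structure as $V$.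
   Context: Chains. $K$ is a finite abstract simplicial complex: a collection of nonempty subsets of a finite set, closed under taking nonempty subsets and containing all singletons; $K_i$ is the set of simplices of cardinality $i+1$. $S(K)$ is the $\mathbb{Z}/2$-vector space with basis $K$; its elements (chains) are identified with subsets of $K$, and $\|\gamma\|_1$ is the number of simplices in $\gamma$. Persistence. For a total order $\le$ on $K$ extending inclusion $\subseteq$ (a linear extension), the boundary matrix $D$ over $\mathbb{Z}/2$ has rows and columns indexed by $K$ in the order $\le$, with $D_{\sigma\tau}=1$ iff $\sigma\subset\tau$ and $|\sigma|=|\tau|-1$. A matrix $R$ is reduced if distinct nonzero columns have different largest row indices of nonzero entries. A persistence algorithm $\mathcal{A}$ assigns to each boundary matrix $D$ a decomposition $R=DV'$ with $R$ reduced and $V'$ upper triangular with ones on the diagonal. A birth-death pair is a pair $(\sigma,\tau)$ such that $\sigma$ is the largest row index of a nonzero entry in column $\tau$ of $R$. Each birth-death pair has four associated chains: the birth simplex $\sigma$, the death simplex $\tau$, the representative cycle (sum of all $\rho$ with $R_{\rho\tau}\ne0$) and the bounding chain (sum of all $\kappa$ with $V'_{\kappa\tau}\neq0$). Fix one of these four kinds of chain as the label of birth-death pairs. Diagrams. $\mathcal{D}$ is the set of persistence diagrams, i.e. finite formal sums (multisets) $\sum_i(b_i,d_i)$ with $b_i\le d_i$ real. A labeled persistence diagram is a finite formal sum $\sum_i(b_i,d_i,\ell_i)$ with $b_i\le d_i$; $\hat{\mathcal{D}}_K$ is the set of those arising from $K$, including the empty one $0$, with labels in $S(K)$. $\varphi$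 is the map forgetting labels. Weights. A weight on $K$ is a function $w:K\to\mathbb{R}$ with $w(\sigma)\le w(\tau)$ whenever $\sigma\subseteq\tau$; $W\subseteq\mathbb{R}^K$ is the set of weights. Fix a persistence algorithm $\mathcal{A}$ and a linear extension $\trianglelefteq$ of $\subseteq$. For $w\in W$, order $K$ by: $\sigma\le_w\tau$ iff $w(\sigma)<w(\tau)$, or $w(\sigma)=w(\tau)$ and $\sigma\trianglelefteq\tau$. Then $\hat\alpha(w)=\sum(w(\sigma),w(\tau),\gamma)$, summed over birth-death pairs $(\sigma,\tau)$ obtained by applying $\mathcal{A}$ to $(K,\le_w)$, where $\gamma$ is the label of the pair. Fix $A\subseteq\mathbb{R}^m$ and $\psi:A\to W$; define $\hat\alpha:\mathbb{R}^m\to\hat{\mathcal{D}}_K$ by $\hat\alpha(a)=\hat\alpha(\psi(a))$ for $a\in A$ and $\hat\alpha(a)=0$ (empty diagram) for $a\notin A$. Feature maps. $\mathcal{B}$ is a separable real Banach space; for a finite set $S$, $\mathcal{B}^S$ has norm $\|x\|=\sum_{s\in S}\|x_s\|$. A feature map is a function $F:\mathcal{D}\to\mathcal{B}$. A labeled decomposition of $F$ is a map $\hat F=(\hat F_\gamma)_{\gamma\in S(K)}:\hat{\mathcal{D}}_K\to\mathcal{B}^{S(K)}$ with $\sum_{\gamma\in S(K)}\hat F_\gamma(\hat a)=F(\varphi(\hat a))$ for all $\hat a\in\hat{\mathcal{D}}_K$. The simplex distribution is $\bar F:\hat{\mathcal{D}}_K\to\mathcal{B}^K$, $\bar F_\sigma(\hat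 a)=\sum_{\gamma\ni\sigma}\hat F_\gamma(\hat a)/\|\gamma\|_1$ (sum over chains containing $\sigma$). For the position function $v:K_0\to\mathbb{R}^d$ ($d\ge1$), $|\sigma|$ is the convex hull of $v(\sigma)$, $d_\sigma$ is the dimension of $|\sigma|$, and $|K|=\bigcup_\sigma|\sigma|$. Given a partition of $\mathbb{R}^d$ into translates of a half-open cube $[0,s)^d$ ($s>0$), $\mathcal{C}$ is the finite set of translates that meet $|K|$. The pixel/voxel distribution is $\tilde F:\hat{\mathcal{D}}_K\to\mathcal{B}^{\mathcal{C}}$, $\tilde F_c(\hat a)=\sum_{\sigma\in K}\frac{\operatorname{vol}_{d_\sigma}(|\sigma|\cap c)}{\operatorname{vol}_{d_\sigma}(|\sigma|)}\bar F_\sigma(\hat a)$, where $\operatorname{vol}_k$ is $k$-dimensional volume ($\operatorname{vol}_0$ is counting). Standing convention: the maps $\eta_{S(K)},\eta_K,\eta_{\mathcal{C}}$ are Borel measurable. $E[V]$ denotes the Pettis integral. A Banach space has type 2 if there is a constant $C$ with $E\|\sum_i r_ix_i\|^2\le C\sum_i\|x_i\|^2$ for all finite families $(x_i)$, where $(r_i)$ are independent Rademacher signs. "Same covariance structure" means that the limit $G$ is centered and $E[f(G)g(G)]=\operatorname{Cov}(f(V),g(V))$ for all continuous linear functionals $f,g$ on $\mathcal{B}^S$. *)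

theory Defs
  imports "HOL-Probability.Probability" "HOL-Library.Z2"
begin

section \<open>Simplicial complexes and persistence\<close>

definition finite_simplicial_complex :: "'v set set \<Rightarrow> bool" where
  "finite_simplicial_complex K \<longleftrightarrow>
     (\<exists>U. finite U \<and> K \<subseteq> Pow U \<and> {} \<notin> K \<and>
        (\<forall>\<sigma>\<in>K. \<forall>\<tau>. \<tau> \<noteq> {} \<and> \<tau> \<subseteq> \<sigma> \<longrightarrow> \<tau> \<in> K) \<and> (\<forall>x\<in>U. {x} \<in> K))"

text \<open>
  Chains over \<open>\<int>/2\<close> are identified with sets of simplices, so that the l1-norm of a chain
  \<open>\<gamma>\<close> is \<open>card \<gamma>\<close>.
\<close>

type_synonym 'v chain = "'v set set"

definition chain_space :: "'v set set \<Rightarrow> 'v chain set" where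
  "chain_space K = Pow K"

definition linear_extension :: "'v set set \<Rightarrow> 'v set rel \<Rightarrow> bool" where
  "linear_extension K r \<longleftrightarrow>
     linear_order_on K r \<and> (\<forall>\<sigma>\<in>K. \<forall>\<tau>\<in>K. \<sigma> \<subseteq> \<tau> \<longrightarrow> (\<sigma>, \<tau>) \<in> r)"

text \<open>
  Matrices with rows and columns indexed by \<open>K\<close> are functions of which only the values on
  \<open>K \<times> K\<close> matter.  The order of the rows and columns is carried along separately as a relation.
\<close>

type_synonym 'v matrix2 = "'v set \<Rightarrow> 'v set \<Rightarrow> bit"

definition boundary_matrix :: "'v matrix2" where
  "boundary_matrix \<sigma> \<tau> = of_bool (\<sigma> \<subset> \<tau> \<and> card \<tau> = Suc (card \<sigma>))"

definition is_low :: "'v set set \<Rightarrow> 'v set rel \<Rightarrow> 'v matrix2 \<Rightarrow> 'v set \<Rightarrow> 'v set \<Rightarrow> bool" where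
  "is_low K r R \<sigma> \<tau> \<longleftrightarrow> \<sigma> \<in> K \<and> R \<sigma> \<tau> \<noteq> 0 \<and> (\<forall>\<rho>\<in>K. R \<rho> \<tau> \<noteq> 0 \<longrightarrow> (\<rho>, \<sigma>) \<in> r)"

definition reduced :: "'v set set \<Rightarrow> 'v set rel \<Rightarrow> 'v matrix2 \<Rightarrow> bool" where
  "reduced K r R \<longleftrightarrow>
     (\<forall>\<sigma>. \<forall>\<tau>\<in>K. \<forall>\<tau>'\<in>K. is_low K r R \<sigma> \<tau> \<and> is_low K r R \<sigma> \<tau>' \<longrightarrow> \<tau> = \<tau>')"

definition unitriangular :: "'v set set \<Rightarrow> 'v set rel \<Rightarrow> 'v matrix2 \<Rightarrow> bool" where
  "unitriangular K r V \<longleftrightarrow>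
     (\<forall>\<kappa>\<in>K. \<forall>\<tau>\<in>K. V \<kappa> \<tau> \<noteq> 0 \<longrightarrow> (\<kappa>, \<tau>) \<in> r) \<and> (\<forall>\<tau>\<in>K. V \<tau> \<tau> = 1)"

text \<open>
  An algorithm maps a complex with a linear extension (that is, a boundary matrix with its index
  set and the order on it) to a pair \<open>(R, V')\<close>.
\<close>

type_synonym 'v algorithm = "'v set set \<Rightarrow> 'v set rel \<Rightarrow> 'v matrix2 \<times> 'v matrix2"

definition persistence_algorithm :: "'v algorithm \<Rightarrow> bool" where
  "persistence_algorithm Alg \<longleftrightarrow>
     (\<forall>K r. finite_simplicial_complex K \<and> linear_extension K r \<longrightarrow>
        (case Alg K r of (R, V) \<Rightarrow>
           (\<forall>\<sigma>\<in>K. \<forall>\<tau>\<in>K. R \<sigma> \<tau> = (\<Sum>\<kappa>\<in>K. boundary_matrix \<sigma> \<kappa> * V \<kappa> \<tau>)) \<and>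
           reduced K r R \<and> unitriangular K r V))"

definition birth_death_pairs :: "'v set set \<Rightarrow> 'v algorithm \<Rightarrow> 'v set rel \<Rightarrow> ('v set \<times> 'v set) set" where
  "birth_death_pairs K Alg r = {(\<sigma>, \<tau>). \<tau> \<in> K \<and> is_low K r (fst (Alg K r)) \<sigma> \<tau>}"

datatype label_kind = Birth_Simplex | Death_Simplex | Representative_Cycle | Bounding_Chain

fun pair_label ::
  "label_kind \<Rightarrow> 'v set set \<Rightarrow> 'v algorithm \<Rightarrow> 'v set rel \<Rightarrow> 'v set \<Rightarrow> 'v set \<Rightarrow> 'v chain" where
  "pair_label Birth_Simplex K Alg r \<sigma> \<tau> = {\<sigma>}"
| "pair_label Death_Simplex K Alg r \<sigma> \<tau> = {\<tau>}"
| "pair_label Representative_Cycle K Alg r \<sigma> \<tau> = {\<rho>\<in>K. fst (Alg K r) \<rho> \<tau> \<noteq> 0}"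
| "pair_label Bounding_Chain K Alg r \<sigma> \<tau> = {\<kappa>\<in>K. snd (Alg K r) \<kappa> \<tau> \<noteq> 0}"


section \<open>Diagrams\<close>

text \<open>
  The empty diagram is \<open>{#}\<close>.  A feature map is a function on diagrams; its values at
  multisets containing some \<open>(b, d)\<close> with \<open>b > d\<close> are never used.
\<close>

type_synonym diagram = "(real \<times> real) multiset"
type_synonym 'v labeled_diagram = "(real \<times> real \<times> 'v chain) multiset"

definition forget_labels :: "'v labeled_diagram \<Rightarrow> diagram" where
  "forget_labels = image_mset (\<lambda>(b, d, l). (b, d))"

definition weights :: "'v set set \<Rightarrow> ('v set \<Rightarrow> real) set" where
  "weights K = {w. \<forall>\<sigma>\<in>K. \<forall>\<tau>\<in>K. \<sigma> \<subseteq> \<tau> \<longrightarrow> w \<sigma> \<le> w \<tau>}"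

definition weight_order :: "'v set set \<Rightarrow> 'v set rel \<Rightarrow> ('v set \<Rightarrow> real) \<Rightarrow> 'v set rel" where
  "weight_order K ext w =
     {(\<sigma>, \<tau>). \<sigma> \<in> K \<and> \<tau> \<in> K \<and> (w \<sigma> < w \<tau> \<or> w \<sigma> = w \<tau> \<and> (\<sigma>, \<tau>) \<in> ext)}"

definition diagram_of_weight ::
  "'v set set \<Rightarrow> 'v algorithm \<Rightarrow> 'v set rel \<Rightarrow> label_kind \<Rightarrow> ('v set \<Rightarrow> real) \<Rightarrow> 'v labeled_diagram" where
  "diagram_of_weight K Alg ext kind w =
     (let r = weight_order K ext w in
      image_mset (\<lambda>(\<sigma>, \<tau>). (w \<sigma>, w \<tau>, pair_label kind K Alg r \<sigma> \<tau>))
        (mset_set (birth_death_pairs K Alg r)))"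

definition labeled_diagrams ::
  "'v set set \<Rightarrow> 'v algorithm \<Rightarrow> 'v set rel \<Rightarrow> label_kind \<Rightarrow> 'v labeled_diagram set" where
  "labeled_diagrams K Alg ext kind = insert {#} (diagram_of_weight K Alg ext kind ` weights K)"

definition alpha_hat ::
  "'v set set \<Rightarrow> 'v algorithm \<Rightarrow> 'v set rel \<Rightarrow> label_kind \<Rightarrow>
   (real^'m) set \<Rightarrow> (real^'m \<Rightarrow> 'v set \<Rightarrow> real) \<Rightarrow> real^'m \<Rightarrow> 'v labeled_diagram" where
  "alpha_hat K Alg ext kind A \<psi> a =
     (if a \<in> A then diagram_of_weight K Alg ext kind (\<psi> a) else {#})"


section \<open>The Banach space of functions from a finite set to a Banach space\<close>

text \<open>
  Since the finite set \<open>S\<close> is not a type, the space is an explicit carrier consisting of the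
  functions on \<open>S\<close> that are \<^const>\<open>undefined\<close> outside \<open>S\<close>.
\<close>

definition pow_space :: "'s set \<Rightarrow> ('s \<Rightarrow> 'b::banach) set" where
  "pow_space S = S \<rightarrow>\<^sub>E UNIV"

definition pow_norm :: "'s set \<Rightarrow> ('s \<Rightarrow> 'b::banach) \<Rightarrow> real" where
  "pow_norm S x = (\<Sum>s\<in>S. norm (x s))"

definition pow_dist :: "'s set \<Rightarrow> ('s \<Rightarrow> 'b::banach) \<Rightarrow> ('s \<Rightarrow> 'b) \<Rightarrow> real" where
  "pow_dist S x y = pow_norm S (\<lambda>s\<in>S. x s - y s)"

lemma Metric_space_pow:
  assumes "finite S"
  shows "Metric_space (pow_space S) (pow_dist S :: ('s \<Rightarrow> 'b::banach) \<Rightarrow> _)"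
proof
  fix x y :: "'s \<Rightarrow> 'b"
  show "0 \<le> pow_dist S x y"
    by (simp add: pow_dist_def pow_norm_def sum_nonneg)
  show "pow_dist S x y = pow_dist S y x"
    by (simp add: pow_dist_def pow_norm_def norm_minus_commute)
next
  fix x y :: "'s \<Rightarrow> 'b" assume "x \<in> pow_space S" "y \<in> pow_space S"
  then show "pow_dist S x y = 0 \<longleftrightarrow> x = y"
    using assms
    by (auto simp: pow_dist_def pow_norm_def pow_space_def sum_nonneg_eq_0_iff intro: PiE_ext)
next
  fix x y z :: "'s \<Rightarrow> 'b"
  show "pow_dist S x z \<le> pow_dist S x y + pow_dist S y z"
    by (auto simp: pow_dist_def pow_norm_def sum.distrib[symmetric]
        intro!: sum_mono norm_triangle_sub norm_diff_triangle_le)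
qed

definition pow_topology :: "'s set \<Rightarrow> ('s \<Rightarrow> 'b::banach) topology" where
  "pow_topology S = Metric_space.mtopology (pow_space S) (pow_dist S)"

definition pow_borel :: "'s set \<Rightarrow> ('s \<Rightarrow> 'b::banach) measure" where
  "pow_borel S = sigma (pow_space S) {U. openin (pow_topology S) U}"

definition pow_dual :: "'s set \<Rightarrow> (('s \<Rightarrow> 'b::banach) \<Rightarrow> real) set" where
  "pow_dual S =
     {f. (\<forall>x\<in>pow_space S. \<forall>y\<in>pow_space S. f (\<lambda>s\<in>S. x s + y s) = f x + f y) \<and>
         (\<forall>c. \<forall>x\<in>pow_space S. f (\<lambda>s\<in>S. c *\<^sub>R x s) = c * f x) \<and>
         continuous_map (pow_topology S) euclideanreal f}"

definition has_pettis_integral ::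
  "'s set \<Rightarrow> 'w measure \<Rightarrow> ('w \<Rightarrow> 's \<Rightarrow> 'b::banach) \<Rightarrow> ('s \<Rightarrow> 'b) \<Rightarrow> bool" where
  "has_pettis_integral S M V e \<longleftrightarrow>
     e \<in> pow_space S \<and>
     (\<forall>f\<in>pow_dual S. integrable M (\<lambda>\<omega>. f (V \<omega>)) \<and> f e = (\<integral>\<omega>. f (V \<omega>) \<partial>M))"

definition pettis_integral ::
  "'s set \<Rightarrow> 'w measure \<Rightarrow> ('w \<Rightarrow> 's \<Rightarrow> 'b::banach) \<Rightarrow> 's \<Rightarrow> 'b" where
  "pettis_integral S M V = (SOME e. has_pettis_integral S M V e)"


section \<open>Feature maps, decompositions and distributions\<close>

definition labeled_decomposition ::
  "'v set set \<Rightarrow> 'v labeled_diagram set \<Rightarrow> (diagram \<Rightarrow> 'b::banach) \<Rightarrow>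
   ('v labeled_diagram \<Rightarrow> 'v chain \<Rightarrow> 'b) \<Rightarrow> bool" where
  "labeled_decomposition K DK F Fhat \<longleftrightarrow>
     Fhat \<in> DK \<rightarrow> pow_space (chain_space K) \<and>
     (\<forall>a\<in>DK. (\<Sum>\<gamma>\<in>chain_space K. Fhat a \<gamma>) = F (forget_labels a))"

definition simplex_distribution ::
  "'v set set \<Rightarrow> ('v labeled_diagram \<Rightarrow> 'v chain \<Rightarrow> 'b::banach) \<Rightarrow>
   'v labeled_diagram \<Rightarrow> 'v set \<Rightarrow> 'b" where
  "simplex_distribution K Fhat a =
     (\<lambda>\<sigma>\<in>K. \<Sum>\<gamma>\<in>{\<gamma>\<in>chain_space K. \<sigma> \<in> \<gamma>}. (1 / real (card \<gamma>)) *\<^sub>R Fhat a \<gamma>)"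

text \<open>
  \<open>k\<close>-dimensional volume of a set \<open>A\<close> contained in a \<open>k\<close>-dimensional affine subspace: the Lebesgue
  measure of \<open>A\<close> in coordinates with respect to an orthonormal frame \<open>b 0, \<dots>, b (k - 1)\<close> with
  origin \<open>p\<close>.  The value does not depend on the choice of the frame, since Lebesgue measure is
  invariant under isometries.  For \<open>k = 0\<close> the product measure is the unit point mass,
  so \<open>vol 0\<close> counts points.
\<close>

definition flat_frame :: "nat \<Rightarrow> 'e::euclidean_space set \<Rightarrow> 'e \<times> (nat \<Rightarrow> 'e) \<Rightarrow> bool" where
  "flat_frame k A = (\<lambda>(p, b).
     (\<forall>i<k. \<forall>j<k. b i \<bullet> b j = of_bool (i = j)) \<and>
     A \<subseteq> {p + (\<Sum>i<k. x i *\<^sub>R b i) |x. True})"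

definition vol :: "nat \<Rightarrow> 'e::euclidean_space set \<Rightarrow> real" where
  "vol k A =
     (case (SOME pb. flat_frame k A pb) of (p, b) \<Rightarrow>
        measure (\<Pi>\<^sub>M i\<in>{..<k}. lborel)
          {x \<in> {..<k} \<rightarrow>\<^sub>E UNIV. p + (\<Sum>i<k. x i *\<^sub>R b i) \<in> A})"

definition realization :: "('v \<Rightarrow> real^'d) \<Rightarrow> 'v set \<Rightarrow> (real^'d) set" where
  "realization v \<sigma> = convex hull (v ` \<sigma>)"

definition half_open_cube :: "real \<Rightarrow> (real^'d) set" where
  "half_open_cube s = {x. \<forall>i. 0 \<le> x $ i \<and> x $ i < s}"

definition cube_partition :: "real \<Rightarrow> (real^'d) set set \<Rightarrow> bool" where
  "cube_partition s P \<longleftrightarrow>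
     partition_on UNIV P \<and> (\<forall>c\<in>P. \<exists>t. c = (\<lambda>x. t + x) ` half_open_cube s)"

definition voxels :: "'v set set \<Rightarrow> ('v \<Rightarrow> real^'d) \<Rightarrow> (real^'d) set set \<Rightarrow> (real^'d) set set" where
  "voxels K v P = {c\<in>P. c \<inter> (\<Union>\<sigma>\<in>K. realization v \<sigma>) \<noteq> {}}"

definition voxel_distribution ::
  "'v set set \<Rightarrow> ('v \<Rightarrow> real^'d) \<Rightarrow> (real^'d) set set \<Rightarrow>
   ('v labeled_diagram \<Rightarrow> 'v chain \<Rightarrow> 'b::banach) \<Rightarrow> 'v labeled_diagram \<Rightarrow> (real^'d) set \<Rightarrow> 'b" where
  "voxel_distribution K v P Fhat a =
     (\<lambda>c\<in>voxels K v P. \<Sum>\<sigma>\<in>K.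
        (let k = nat (aff_dim (realization v \<sigma>)) in
         (vol k (realization v \<sigma> \<inter> c) / vol k (realization v \<sigma>)) *\<^sub>R simplex_distribution K Fhat a \<sigma>))"


section \<open>Probability in Banach spaces\<close>

definition type_2 :: "'b::banach itself \<Rightarrow> bool" where
  "type_2 _ \<longleftrightarrow>
     (\<exists>C. \<forall>n (x :: nat \<Rightarrow> 'b).
        measure_pmf.expectation (Pi_pmf {..<n} 0 (\<lambda>_. pmf_of_set {-1, 1 :: real}))
          (\<lambda>r. (norm (\<Sum>i<n. r i *\<^sub>R x i))\<^sup>2)
        \<le> C * (\<Sum>i<n. (norm (x i))\<^sup>2))"

definition independent_copies ::
  "'s set \<Rightarrow> 'w measure \<Rightarrow> ('w \<Rightarrow> 's \<Rightarrow> 'b::banach) \<Rightarrow> 'u measure \<Rightarrow> (nat \<Rightarrow> 'u \<Rightarrow> 's \<Rightarrow> 'b) \<Rightarrow> bool" where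
  "independent_copies S M V N Vs \<longleftrightarrow>
     prob_space.indep_vars N (\<lambda>_. pow_borel S) Vs UNIV \<and>
     (\<forall>k. distr N (pow_borel S) (Vs k) = distr M (pow_borel S) V)"

text \<open>A Gaussian distribution on the reals may be degenerate, i.e. a point mass.\<close>

definition gaussian_law :: "real measure \<Rightarrow> bool" where
  "gaussian_law L \<longleftrightarrow>
     (\<exists>\<mu>. L = return borel \<mu> \<or> (\<exists>\<sigma>>0. L = density lborel (normal_density \<mu> \<sigma>)))"

definition gaussian_rv :: "'s set \<Rightarrow> 'q measure \<Rightarrow> ('q \<Rightarrow> 's \<Rightarrow> 'b::banach) \<Rightarrow> bool" where
  "gaussian_rv S Q G \<longleftrightarrow>
     G \<in> measurable Q (pow_borel S) \<and>
     (\<forall>f\<in>pow_dual S. gaussian_law (distr Q borel (\<lambda>\<omega>. f (G \<omega>))))"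

definition real_covariance :: "'w measure \<Rightarrow> ('w \<Rightarrow> real) \<Rightarrow> ('w \<Rightarrow> real) \<Rightarrow> real" where
  "real_covariance M X Y =
     (\<integral>\<omega>. (X \<omega> - (\<integral>\<omega>'. X \<omega>' \<partial>M)) * (Y \<omega> - (\<integral>\<omega>'. Y \<omega>' \<partial>M)) \<partial>M)"

definition same_covariance_structure ::
  "'s set \<Rightarrow> 'w measure \<Rightarrow> ('w \<Rightarrow> 's \<Rightarrow> 'b::banach) \<Rightarrow> 'q measure \<Rightarrow> ('q \<Rightarrow> 's \<Rightarrow> 'b) \<Rightarrow> bool" where
  "same_covariance_structure S M V Q G \<longleftrightarrow>
     has_pettis_integral S Q G (\<lambda>s\<in>S. 0) \<and>
     (\<forall>f\<in>pow_dual S. \<forall>g\<in>pow_dual S.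
        (\<integral>\<omega>. f (G \<omega>) * g (G \<omega>) \<partial>Q) = real_covariance M (\<lambda>\<omega>. f (V \<omega>)) (\<lambda>\<omega>. g (V \<omega>)))"

definition converges_in_distribution ::
  "'s set \<Rightarrow> 'u measure \<Rightarrow> (nat \<Rightarrow> 'u \<Rightarrow> 's \<Rightarrow> 'b::banach) \<Rightarrow> 'q measure \<Rightarrow> ('q \<Rightarrow> 's \<Rightarrow> 'b) \<Rightarrow> bool" where
  "converges_in_distribution S N Z Q G \<longleftrightarrow>
     (\<forall>h. continuous_map (pow_topology S) euclideanreal h \<and> bounded (h ` pow_space S) \<longrightarrow>
        (\<lambda>n. \<integral>\<omega>. h (Z n \<omega>) \<partial>N) \<longlonglongrightarrow> (\<integral>\<omega>. h (G \<omega>) \<partial>Q))"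

definition normalized_sum ::
  "'s set \<Rightarrow> (nat \<Rightarrow> 'u \<Rightarrow> 's \<Rightarrow> 'b::banach) \<Rightarrow> ('s \<Rightarrow> 'b) \<Rightarrow> nat \<Rightarrow> 'u \<Rightarrow> 's \<Rightarrow> 'b" where
  "normalized_sum S Vs e n \<omega> =
     (\<lambda>s\<in>S. sqrt (real n) *\<^sub>R ((1 / real n) *\<^sub>R (\<Sum>k=1..n. Vs k \<omega> s) - e s))"

text \<open>
  The limit is required to exist as a random variable on some probability space, which can be
  taken to be the Banach space itself with the law of the limit.
\<close>

definition clt_gaussian_limit ::
  "'s set \<Rightarrow> 'w measure \<Rightarrow> ('w \<Rightarrow> 's \<Rightarrow> 'b::banach) \<Rightarrow> 'u measure \<Rightarrow> (nat \<Rightarrow> 'u \<Rightarrow> 's \<Rightarrow> 'b) \<Rightarrow> bool" where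
  "clt_gaussian_limit S M V N Vs \<longleftrightarrow>
     (\<exists>(Q :: ('s \<Rightarrow> 'b) measure) G.
        prob_space Q \<and> gaussian_rv S Q G \<and> same_covariance_structure S M V Q G \<and>
        converges_in_distribution S N (normalized_sum S Vs (pettis_integral S M V)) Q G)"

end

theory Submission
  imports Defs
begin

text \<open>
  The three random variables are treated at once: \<open>V\<close> takes values in \<open>B\<^sup>S\<close> with \<open>S\<close> finite, and only
  coordinatewise estimates in \<open>B\<close> are needed.  For a sum \<open>A + B\<close> of independent centered variables,
  Jensen's inequality gives \<open>E \<parallel>A + B\<parallel>\<^sup>2 \<le> 4 E \<parallel>A - B\<parallel>\<^sup>2\<close>.  Splitting independent centered summands by
  signs and averaging over the signs turns type 2 into \<open>E \<parallel>\<Sum> Y\<^sub>k\<parallel>\<^sup>2 \<le> 4 C \<Sum> E \<parallel>Y\<^sub>k\<parallel>\<^sup>2\<close>.  Hence the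
  normalized sum of \<open>V\<close> is uniformly in \<open>n\<close> close to that of an approximation
  \<open>\<Sum> e\<^sub>j(V) c\<^sub>j\<close> of finite rank, where the \<open>e\<^sub>j\<close> are orthogonal real functions.

  For such approximations the limit is \<open>\<Sum> \<sigma>\<^sub>j g\<^sub>j c\<^sub>j\<close> with independent standard normal \<open>g\<^sub>j\<close>, by the
  real central limit theorem applied to linear combinations of the \<open>e\<^sub>j\<close>.  All these limits live on the
  same probability space and inherit the type 2 estimate, so that they converge almost surely along a
  fast approximating sequence; no tightness argument is needed.  The law of a functional of the limit
  is then read off from the real central limit theorem, and covariances follow by polarization.
  The Pettis integral is the coordinatewise Bochner integral because functionals separate points.
\<close>

section \<open>Hahn--Banach\<close>

text \<open>Orthogonality makes the covariance matrix of every finite subfamily of the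
  \<open>e j\<close> diagonal. One sequence of independent standard normals, scaled by
  \<open>sqrt (var j)\<close>, therefore drives the limits of all ranks and all coordinates;
  otherwise Gaussian vectors with prescribed covariance matrices, consistent across ranks, would
  have to be built. As the system is the same for every accuracy, the difference of two
  approximations is again a finite combination of the \<open>e j\<close>, and the type 2 bound
  applies to it directly.

  The comparisons obtained are bounds on mean distances, which control differences of integrals of
  Lipschitz functions. Hence the argument runs with bounded Lipschitz test functions, and continuous
  ones are reached at the end through Lipschitz minorants.

  Dividing the index set by signs, instead of symmetrizing with an independent copy, keeps the sums
  on their own probability space. Hahn-Banach enters to make the Pettis integral unique, since
  \<open>pettis_integral\<close> is a choice among all its possible values.\<close>

definition sublinear :: "('a::real_vector \<Rightarrow> real) \<Rightarrow> bool" where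
  "sublinear p \<longleftrightarrow> (\<forall>x y. p (x + y) \<le> p x + p y) \<and> (\<forall>c\<ge>0. \<forall>x. p (c *\<^sub>R x) \<le> c * p x)"

text \<open>For sublinear \<open>p\<close>, taking \<open>t = 0\<close> shows that this lies below
  \<open>p\<close>, and \<open>t = 1\<close> that its value at \<open>- y\<close> is at most
  \<open>- p y\<close>. It is \<open>p\<close> pushed towards additivity in the direction
  \<open>y\<close>.\<close>

definition directional_inf :: "('a::real_vector \<Rightarrow> real) \<Rightarrow> 'a \<Rightarrow> 'a \<Rightarrow> real" where
  "directional_inf p y x = (INF t\<in>{0..}. p (x + t *\<^sub>R y) - t * p y)"

lemma sublinear_norm: "sublinear (norm :: 'a::real_normed_vector \<Rightarrow> real)"
  by (simp add: sublinear_def norm_triangle_ineq)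

lemma sublinear_zero:
  assumes "sublinear p" shows "p 0 = 0"
proof -
  have "p (0 *\<^sub>R 0) \<le> 0 * p 0" "p (0 + 0) \<le> p 0 + p 0"
    using assms unfolding sublinear_def by blast+
  then show ?thesis by simp
qed

text \<open>The definition asks for one inequality; the other is the same inequality for the factor
  \<open>1 / c\<close>.\<close>

lemma sublinear_scaleR:
  assumes "sublinear p" "c \<ge> 0" shows "p (c *\<^sub>R x) = c * p x"
proof (cases "c = 0")
  case False
  then have c: "c > 0" using assms by simp
  have "p ((1 / c) *\<^sub>R (c *\<^sub>R x)) \<le> (1 / c) * p (c *\<^sub>R x)"
    using assms c unfolding sublinear_def by (metis divide_nonneg_nonneg zero_le_one)
  then have "c * p x \<le> p (c *\<^sub>R x)" using c by (simp add: field_simps)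
  then show ?thesis using assms by (auto simp: sublinear_def intro: antisym)
qed (simp add: sublinear_zero assms)

lemma sublinear_lower:
  assumes "sublinear p" shows "- p (- x) \<le> p x"
proof -
  have "p (x + - x) \<le> p x + p (- x)" using assms unfolding sublinear_def by blast
  then show ?thesis by (simp add: sublinear_zero[OF assms])
qed

lemma directional_inf_le:
  assumes "sublinear p" "t \<ge> 0"
  shows "directional_inf p y x \<le> p (x + t *\<^sub>R y) - t * p y"
  unfolding directional_inf_def
proof (rule cINF_lower)
  \<comment> \<open>A lower bound that does not depend on \<open>t\<close>, so the infimum over the
    reals is a genuine one.\<close>
  have "- p (- x) \<le> p (x + t *\<^sub>R y) - t * p y" if "t \<ge> 0" for t
  proof -
    have "p ((x + t *\<^sub>R y) + - x) \<le> p (x + t *\<^sub>R y) + p (- x)"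
      using assms(1) unfolding sublinear_def by blast
    then show ?thesis using sublinear_scaleR[OF assms(1) that, of y] by simp
  qed
  then show "bdd_below ((\<lambda>t. p (x + t *\<^sub>R y) - t * p y) ` {0..})"
    by (intro bdd_belowI2[where m = "- p (- x)"]) auto
qed (use assms in auto)

lemma le_directional_inf:
  "(\<And>t. t \<ge> 0 \<Longrightarrow> m \<le> p (x + t *\<^sub>R y) - t * p y) \<Longrightarrow> m \<le> directional_inf p y x"
  unfolding directional_inf_def by (rule cINF_greatest) auto

text \<open>Parameters \<open>t\<close> and \<open>t'\<close> chosen for the two summands combine to
  \<open>t + t'\<close> for the sum, and \<open>t\<close> for \<open>x\<close> becomes
  \<open>c * t\<close> for \<open>c *\<^sub>R x\<close>.\<close>

lemma sublinear_directional_inf: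
  assumes "sublinear p" shows "sublinear (directional_inf p y)"
  unfolding sublinear_def
proof safe
  fix x x' :: 'a
  have *: "directional_inf p y (x + x') \<le> (p (x + t *\<^sub>R y) - t * p y) + (p (x' + t' *\<^sub>R y) - t' * p y)"
    if "t \<ge> 0" "t' \<ge> 0" for t t'
  proof -
    have "directional_inf p y (x + x') \<le> p ((x + x') + (t + t') *\<^sub>R y) - (t + t') * p y"
      using that by (intro directional_inf_le assms) auto
    moreover have "p ((x + t *\<^sub>R y) + (x' + t' *\<^sub>R y)) \<le> p (x + t *\<^sub>R y) + p (x' + t' *\<^sub>R y)"
      using assms unfolding sublinear_def by blast
    ultimately show ?thesis by (simp add: algebra_simps)
  qed
  have "directional_inf p y (x + x') - (p (x + t *\<^sub>R y) - t * p y) \<le> directional_inf p y x'"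
    if "t \<ge> 0" for t
    by (intro le_directional_inf) (use *[OF that] in \<open>smt (verit)\<close>)
  then have "directional_inf p y (x + x') - directional_inf p y x' \<le> directional_inf p y x"
    by (intro le_directional_inf) (simp add: algebra_simps)
  then show "directional_inf p y (x + x') \<le> directional_inf p y x + directional_inf p y x'"
    by simp
next
  fix c :: real and x :: 'a assume c: "0 \<le> c"
  show "directional_inf p y (c *\<^sub>R x) \<le> c * directional_inf p y x"
  proof (cases "c = 0")
    case True
    then show ?thesis using directional_inf_le[OF assms, of 0 y 0] by (simp add: sublinear_zero assms)
  next
    case False
    have "directional_inf p y (c *\<^sub>R x) / c \<le> directional_inf p y x"
    proof (rule le_directional_inf)
      fix t :: real assume t: "t \<ge> 0"
      have "directional_inf p y (c *\<^sub>R x) \<le> p (c *\<^sub>R x + (c * t) *\<^sub>R y) - (c * t) * p y"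
        using c t by (intro directional_inf_le assms) auto
      also have "c *\<^sub>R x + (c * t) *\<^sub>R y = c *\<^sub>R (x + t *\<^sub>R y)" by (simp add: algebra_simps)
      also have "p \<dots> = c * p (x + t *\<^sub>R y)" by (rule sublinear_scaleR[OF assms c])
      finally show "directional_inf p y (c *\<^sub>R x) / c \<le> p (x + t *\<^sub>R y) - t * p y"
        using c False by (simp add: field_simps)
    qed
    then show ?thesis using c False by (simp add: field_simps)
  qed
qed

text \<open>Minimality forces \<open>directional_inf p y = p\<close>, and the choice
  \<open>t = 1\<close> in the infimum then reads \<open>p x + p y \<le> p (x + y)\<close>. Negative
  factors are handled by additivity.\<close>

lemma minimal_sublinear_linear:
  assumes p: "sublinear p" and min: "\<And>q. sublinear q \<Longrightarrow> (\<And>x. q x \<le> p x) \<Longrightarrow> q = p"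
  shows "linear p"
proof -
  have fix_p: "directional_inf p y = p" for y
    using directional_inf_le[OF p, of 0 y] by (intro min sublinear_directional_inf p) auto
  have add: "p (x + y) = p x + p y" for x y
  proof (rule antisym)
    show "p (x + y) \<le> p x + p y" using p by (simp add: sublinear_def)
    show "p x + p y \<le> p (x + y)"
      using directional_inf_le[OF p, of 1 y x] by (simp add: fix_p)
  qed
  have neg: "p (- x) = - p x" for x
    using add[of x "- x"] by (simp add: sublinear_zero[OF p])
  show ?thesis
  proof (rule linearI)
    fix c :: real and x
    show "p (c *\<^sub>R x) = c *\<^sub>R p x"
    proof (cases "c \<ge> 0")
      case False
      then have "p ((- c) *\<^sub>R x) = - c * p x" by (intro sublinear_scaleR p) simp
      then show ?thesis using neg[of "c *\<^sub>R x"] by simp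
    qed (simp add: sublinear_scaleR p)
  qed (rule add)
qed

text \<open>Zorn's lemma for the reversed pointwise order: the bound of a chain is its pointwise
  infimum, and a maximal element is a minimal sublinear functional.\<close>

lemma sublinear_dominates_linear:
  assumes q: "sublinear (q :: 'a::real_vector \<Rightarrow> real)"
  shows "\<exists>f. linear f \<and> (\<forall>x. f x \<le> q x)"
proof -
  define A where "A = {p. sublinear p \<and> (\<forall>x. p x \<le> q x)}"
  define below :: "('a \<Rightarrow> real) \<Rightarrow> ('a \<Rightarrow> real) \<Rightarrow> bool" where "below = (\<lambda>p p'. \<forall>x. p' x \<le> p x)"
  have "\<exists>m\<in>A. \<forall>a\<in>A. below m a \<longrightarrow> a = m"
  proof (rule predicate_Zorn)
    show "partial_order_on A (relation_of below A)"
      by (rule partial_order_on_relation_ofI) (auto simp: below_def fun_eq_iff intro: order_trans antisym)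
  next
    fix C assume C: "C \<in> Chains (relation_of below A)"
    show "\<exists>u\<in>A. \<forall>a\<in>C. below a u"
    proof (cases "C = {}")
      case True
      then show ?thesis using q by (auto simp: A_def)
    next
      case False
      have sub: "p \<in> A" if "p \<in> C" for p
        using C that by (auto simp: Chains_def relation_of_def)
      have total: "below p p' \<or> below p' p" if "p \<in> C" "p' \<in> C" for p p'
        using C that by (auto simp: Chains_def relation_of_def)
      define u where "u x = (INF p\<in>C. p x)" for x
      have le: "u x \<le> p x" if "p \<in> C" for p x
        unfolding u_def
      proof (rule cINF_lower[OF _ that])
        \<comment> \<open>Every member of the chain is below \<open>q\<close>, hence above
          \<open>- q (- x)\<close> at \<open>x\<close>, so the pointwise infima are finite.\<close>
        have "- q (- x) \<le> p x" if "p \<in> C" for p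
          using sublinear_lower[of p x] sub[OF that] by (auto simp: A_def dest: spec[of _ "- x"])
        then show "bdd_below ((\<lambda>p. p x) ` C)" by (intro bdd_belowI2) auto
      qed
      have greatest: "m \<le> u x" if "\<And>p. p \<in> C \<Longrightarrow> m \<le> p x" for m x
        unfolding u_def using False that by (intro cINF_greatest) auto
      have "sublinear u"
        unfolding sublinear_def
      proof safe
        fix x y
        have *: "u (x + y) \<le> p x + p' y" if p: "p \<in> C" "p' \<in> C" for p p'
        proof -
          \<comment> \<open>The chain is totally ordered, so the smaller of \<open>p\<close> and
            \<open>p'\<close> serves both arguments at once.\<close>
          obtain r where r: "r \<in> C" "r x \<le> p x" "r y \<le> p' y"
            using total[OF p] p unfolding below_def by (metis order_refl)
          have "u (x + y) \<le> r (x + y)" by (rule le[OF r(1)])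
          also have "\<dots> \<le> r x + r y" using sub[OF r(1)] by (simp add: A_def sublinear_def)
          finally show ?thesis using r by simp
        qed
        have "u (x + y) - p x \<le> u y" if "p \<in> C" for p
          by (intro greatest) (use *[OF that] in \<open>smt (verit)\<close>)
        then have "u (x + y) - u y \<le> u x"
          by (intro greatest) (simp add: algebra_simps)
        then show "u (x + y) \<le> u x + u y" by simp
      next
        fix c :: real and x assume c: "0 \<le> c"
        have eq: "p (c *\<^sub>R x) = c * p x" if "p \<in> C" for p
          using sub[OF that] c by (intro sublinear_scaleR) (auto simp: A_def)
        obtain p where p: "p \<in> C" using False by auto
        show "u (c *\<^sub>R x) \<le> c * u x"
        proof (cases "c = 0")
          case True
          then show ?thesis using le[OF p, of "c *\<^sub>R x"] eq[OF p] by simp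
        next
          case False
          have "u (c *\<^sub>R x) / c \<le> u x"
            using le[of _ "c *\<^sub>R x"] c False by (intro greatest) (simp add: eq field_simps)
          then show ?thesis using c False by (simp add: field_simps)
        qed
      qed
      moreover have "u x \<le> q x" for x
        using False le sub by (fastforce simp: A_def intro: order_trans)
      ultimately show ?thesis using le by (auto simp: A_def below_def)
    qed
  qed
  then obtain m where m: "m \<in> A" "\<And>a. a \<in> A \<Longrightarrow> below m a \<Longrightarrow> a = m" by blast
  have "linear m"
  proof (rule minimal_sublinear_linear)
    fix p assume p: "sublinear p" "\<And>x. p x \<le> m x"
    then have "p \<in> A" using m(1) by (auto simp: A_def intro: order_trans)
    then show "p = m" using p by (intro m(2)) (auto simp: below_def)
  qed (use m in \<open>auto simp: A_def\<close>)
  then show ?thesis using m by (auto simp: A_def)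
qed

text \<open>Domination by \<open>directional_inf norm x0\<close> instead of \<open>norm\<close>
  builds the value at \<open>x0\<close> into the bound: \<open>t = 0\<close> gives the norm bound,
  \<open>t = 1\<close> gives \<open>f (- x0) \<le> - norm x0\<close>.\<close>

lemma bounded_linear_separates:
  fixes x0 :: "'a::real_normed_vector"
  assumes "x0 \<noteq> 0"
  shows "\<exists>f::'a \<Rightarrow> real. bounded_linear f \<and> f x0 \<noteq> 0"
proof -
  obtain f where f: "linear f" "\<And>x. f x \<le> directional_inf norm x0 x"
    using sublinear_dominates_linear[OF sublinear_directional_inf[OF sublinear_norm]] by blast
  have "f x \<le> norm x" for x
    using f(2)[of x] directional_inf_le[OF sublinear_norm, of 0 x0 x] by simp
  then have "\<bar>f x\<bar> \<le> norm x" for x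
    by (metis abs_le_iff f(1) linear_neg norm_minus_cancel)
  then have "bounded_linear f"
    using f(1) by (intro bounded_linear_intro[where K = 1]) (auto simp: linear_add linear_scale)
  moreover have "f (- x0) \<le> - norm x0"
    using f(2)[of "- x0"] directional_inf_le[OF sublinear_norm, of 1 x0 "- x0"] by simp
  ultimately show ?thesis using assms f(1) by (auto simp: linear_neg)
qed

section \<open>Finite powers of a Banach space\<close>

lemma pow_space_apply: "x \<in> pow_space S \<Longrightarrow> (\<lambda>s\<in>S. x s) = x"
  by (auto simp: pow_space_def PiE_def extensional_restrict)

lemma restrict_in_pow_space [simp]: "restrict f S \<in> pow_space S"
  by (simp add: pow_space_def)

lemma pow_space_nonempty: "pow_space S \<noteq> {}"
  by (auto simp: pow_space_def PiE_eq_empty_iff)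

lemma pow_norm_nonneg [simp]: "0 \<le> pow_norm S x"
  by (simp add: pow_norm_def sum_nonneg)

lemma pow_dist_alt: "pow_dist S x y = (\<Sum>s\<in>S. norm (x s - y s))"
  by (simp add: pow_dist_def pow_norm_def)

lemma norm_le_pow_norm: "finite S \<Longrightarrow> s \<in> S \<Longrightarrow> norm (x s) \<le> pow_norm S x"
  unfolding pow_norm_def by (intro member_le_sum) auto

lemma topspace_pow [simp]: "finite S \<Longrightarrow> topspace (pow_topology S) = pow_space S"
  by (simp add: pow_topology_def Metric_space.topspace_mtopology Metric_space_pow)

lemma openin_pow_iff:
  assumes "finite S"
  shows "openin (pow_topology S) U \<longleftrightarrow>
    U \<subseteq> pow_space S \<and> (\<forall>x\<in>U. \<exists>r>0. \<forall>y\<in>pow_space S. pow_dist S x y < r \<longrightarrow> y \<in> U)"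
proof -
  interpret Metric_space "pow_space S" "pow_dist S :: ('a \<Rightarrow> 'b) \<Rightarrow> _" by (rule Metric_space_pow[OF assms])
  show ?thesis
    unfolding pow_topology_def openin_mtopology by (fastforce simp: mball_def subset_iff)
qed

lemma continuous_map_pow_iff:
  fixes h :: "('s \<Rightarrow> 'b::banach) \<Rightarrow> real"
  assumes "finite S"
  shows "continuous_map (pow_topology S) euclideanreal h \<longleftrightarrow>
    (\<forall>x\<in>pow_space S. \<forall>e>0. \<exists>d>0. \<forall>y\<in>pow_space S. pow_dist S x y < d \<longrightarrow> \<bar>h y - h x\<bar> < e)"
proof -
  interpret Metric_space "pow_space S" "pow_dist S :: ('s \<Rightarrow> 'b) \<Rightarrow> _" by (rule Metric_space_pow[OF assms])
  have "euclideanreal = Met_TC.mtopology" by simp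
  show ?thesis
    unfolding pow_topology_def mtopology_is_euclidean[symmetric]
    by (subst metric_continuous_map[OF Met_TC.Metric_space_axioms])
       (simp add: dist_real_def abs_minus_commute imp_conjL Ball_def)
qed

section \<open>Borel sets and measurability on a finite power\<close>

lemma space_pow_borel [simp]: "finite S \<Longrightarrow> space (pow_borel S) = pow_space S"
  unfolding pow_borel_def by (rule space_measure_of) (use openin_subset[of "pow_topology S"] in auto)

lemma openin_sets_pow_borel: "finite S \<Longrightarrow> openin (pow_topology S) U \<Longrightarrow> U \<in> sets (pow_borel S)"
  unfolding pow_borel_def by (subst sets_measure_of) (use openin_subset[of "pow_topology S"] in auto)

lemma continuous_map_measurable_pow_borel:
  fixes h :: "('s \<Rightarrow> 'b::banach) \<Rightarrow> real"
  assumes "finite S" "continuous_map (pow_topology S) euclideanreal h"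
  shows "h \<in> borel_measurable (pow_borel S)"
proof (rule borel_measurableI)
  fix U :: "real set" assume "open U"
  then have "openin (pow_topology S) {x \<in> pow_space S. h x \<in> U}"
    using assms by (auto simp: continuous_map)
  also have "{x \<in> pow_space S. h x \<in> U} = h -` U \<inter> space (pow_borel S)" using assms by auto
  finally show "h -` U \<inter> space (pow_borel S) \<in> sets (pow_borel S)"
    using assms by (intro openin_sets_pow_borel)
qed

text \<open>With a countable basis of \<open>'b\<close>, each open set is a countable union of
  boxes. The equality turns measurability of maps into the power into measurability of their
  coordinates.\<close>

lemma sets_pow_borel:
  assumes fin: "finite (S :: 's set)"
  shows "sets (pow_borel S :: ('s \<Rightarrow> 'b::{banach,second_countable_topology}) measure)
    = sets (PiM S (\<lambda>_. borel))"
proof (rule antisym)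
  obtain B :: "'b set set" where B: "countable B" "topological_basis B"
    using ex_countable_basis by blast
  have "U \<in> sets (PiM S (\<lambda>_. borel))" if U: "openin (pow_topology S) U" for U :: "('s \<Rightarrow> 'b) set"
  proof -
    define \<C> where "\<C> = {b \<in> PiE S (\<lambda>_. B). PiE S b \<subseteq> U}"
    have "countable \<C>"
      unfolding \<C>_def using countable_PiE[of S "\<lambda>_. B"] fin B
      by (auto intro!: countable_Collect)
    have "\<exists>b\<in>\<C>. x \<in> PiE S b" if x: "x \<in> U" for x
    proof -
      obtain r where r: "r > 0" "\<And>y. y \<in> pow_space S \<Longrightarrow> pow_dist S x y < r \<Longrightarrow> y \<in> U"
        using U x by (auto simp: openin_pow_iff[OF fin])
      \<comment> \<open>Errors below \<open>\<delta>\<close> in each coordinate sum to less than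
        \<open>r\<close>; the \<open>+ 1\<close> gives strictness and covers empty
        \<open>S\<close>.\<close>
      define \<delta> where "\<delta> = r / (card S + 1)"
      have \<delta>: "\<delta> > 0" using r by (simp add: \<delta>_def)
      have "\<exists>b\<in>B. x s \<in> b \<and> b \<subseteq> ball (x s) \<delta>" for s
        using topological_basisE[OF B(2), of "ball (x s) \<delta>" "x s"] \<delta>
        by (metis centre_in_ball open_ball)
      then obtain b where b: "\<And>s. b s \<in> B" "\<And>s. x s \<in> b s" "\<And>s. b s \<subseteq> ball (x s) \<delta>" by metis
      have "y \<in> U" if y: "y \<in> PiE S (restrict b S)" for y
      proof (rule r(2))
        show "y \<in> pow_space S" using y by (auto simp: pow_space_def PiE_def)
        have "pow_dist S x y \<le> (\<Sum>s\<in>S. \<delta>)"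
          unfolding pow_dist_alt using y b(3)
          by (intro sum_mono) (force simp: dist_norm PiE_def Pi_def)
        also have "\<dots> < r" using r by (simp add: \<delta>_def field_simps)
        finally show "pow_dist S x y < r" .
      qed
      moreover have "x \<in> pow_space S" using U x by (auto simp: openin_pow_iff[OF fin])
      ultimately show ?thesis
        using b by (intro bexI[of _ "restrict b S"]) (auto simp: \<C>_def pow_space_def PiE_def)
    qed
    then have "U = (\<Union>b\<in>\<C>. PiE S b)" by (auto simp: \<C>_def)
    also have "\<dots> \<in> sets (PiM S (\<lambda>_. borel))"
    proof (rule sets.countable_UN'[OF \<open>countable \<C>\<close>])
      have "PiE S b \<in> sets (PiM S (\<lambda>_. borel))" if "b \<in> \<C>" for b
      proof (rule sets_PiM_I_finite[OF fin])
        fix s assume "s \<in> S"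
        then have "b s \<in> B" using that by (auto simp: \<C>_def)
        then show "b s \<in> sets borel" by (intro borel_open topological_basis_open[OF B(2)])
      qed
      then show "PiE S ` \<C> \<subseteq> sets (PiM S (\<lambda>_. borel))" by auto
    qed
    finally show ?thesis .
  qed
  then have "sigma_sets (space (PiM S (\<lambda>_. borel))) {U :: ('s \<Rightarrow> 'b) set. openin (pow_topology S) U}
      \<subseteq> sets (PiM S (\<lambda>_. borel))"
    by (intro sets.sigma_sets_subset) auto
  then show "sets (pow_borel S) \<subseteq> sets (PiM S (\<lambda>_. borel :: 'b measure))"
    using openin_subset[of "pow_topology S"] fin unfolding pow_borel_def
    by (subst sets_measure_of) (auto simp: space_PiM pow_space_def)
next
  have "(\<lambda>x. x s) \<in> measurable (pow_borel S) (borel :: 'b measure)" if s: "s \<in> S" for s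
  proof (rule borel_measurableI)
    fix V :: "'b set" assume V: "open V"
    have "openin (pow_topology S) {x \<in> pow_space S. x s \<in> V}"
      unfolding openin_pow_iff[OF fin]
    proof (safe)
      fix x assume x: "x \<in> pow_space S" "x s \<in> V"
      obtain r where r: "r > 0" "ball (x s) r \<subseteq> V" using V x openE by blast
      have "y s \<in> V" if "pow_dist S x y < r" for y
      proof -
        have "norm (x s - y s) \<le> pow_dist S x y"
          unfolding pow_dist_alt using fin s by (intro member_le_sum) auto
        then show ?thesis using r that by (auto simp: dist_norm subset_iff)
      qed
      then show "\<exists>r>0. \<forall>y\<in>pow_space S. pow_dist S x y < r \<longrightarrow> y \<in> {x \<in> pow_space S. x s \<in> V}"
        using r by auto
    qed
    from openin_sets_pow_borel[OF fin this]
    show "(\<lambda>x. x s) -` V \<inter> space (pow_borel S) \<in> sets (pow_borel S)"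
      by (simp add: fin vimage_def Int_def conj_commute)
  qed
  then have "(\<lambda>x. \<lambda>s\<in>S. x s) \<in> measurable (pow_borel S) (PiM S (\<lambda>_. borel :: 'b measure))"
    by (intro measurable_restrict)
  then have "(\<lambda>x. x) \<in> measurable (pow_borel S) (PiM S (\<lambda>_. borel :: 'b measure))"
    by (subst measurable_cong[of _ _ "\<lambda>x. \<lambda>s\<in>S. x s"]) (auto simp: fin pow_space_apply)
  from measurable_sets[OF this]
  show "sets (PiM S (\<lambda>_. borel)) \<subseteq> sets (pow_borel S :: ('s \<Rightarrow> 'b) measure)"
    using sets.sets_into_space[of _ "PiM S (\<lambda>_. borel :: 'b measure)"]
    by (auto simp: fin space_PiM pow_space_def Int_absorb2)
qed

lemma measurable_pow_borel_iff:
  assumes "finite S"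
  shows "V \<in> measurable M (pow_borel S :: ('s \<Rightarrow> 'b::{banach,second_countable_topology}) measure) \<longleftrightarrow>
    V \<in> measurable M (PiM S (\<lambda>_. borel))"
  by (simp cong: measurable_cong_sets add: sets_pow_borel assms)

lemma measurable_pow_borel_restrict:
  fixes f :: "'w \<Rightarrow> 's \<Rightarrow> 'b::{banach,second_countable_topology}"
  assumes "finite S" "\<And>s. s \<in> S \<Longrightarrow> (\<lambda>\<omega>. f \<omega> s) \<in> borel_measurable M"
  shows "(\<lambda>\<omega>. \<lambda>s\<in>S. f \<omega> s) \<in> measurable M (pow_borel S)"
  unfolding measurable_pow_borel_iff[OF assms(1)] using assms(2) by (intro measurable_restrict)

lemma measurable_pow_borel_component:
  fixes V :: "'w \<Rightarrow> 's \<Rightarrow> 'b::{banach,second_countable_topology}"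
  assumes "finite S" "V \<in> measurable M (pow_borel S)" "s \<in> S"
  shows "(\<lambda>\<omega>. V \<omega> s) \<in> borel_measurable M"
  using assms(2) measurable_component_singleton[OF assms(3)]
  unfolding measurable_pow_borel_iff[OF assms(1)] by (rule measurable_compose)

section \<open>Lipschitz functions and continuous functionals on a finite power\<close>

definition lipschitz_pow :: "'s set \<Rightarrow> real \<Rightarrow> (('s \<Rightarrow> 'b::banach) \<Rightarrow> real) \<Rightarrow> bool" where
  "lipschitz_pow S L h \<longleftrightarrow> (\<forall>x\<in>pow_space S. \<forall>y\<in>pow_space S. \<bar>h x - h y\<bar> \<le> L * pow_dist S x y)"

lemma lipschitz_pow_continuous:
  assumes "finite S" "lipschitz_pow S L h"
  shows "continuous_map (pow_topology S) euclideanreal h"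
  unfolding continuous_map_pow_iff[OF assms(1)]
proof safe
  fix x :: "'a \<Rightarrow> 'b" and e :: real assume x: "x \<in> pow_space S" and e: "0 < e"
  \<comment> \<open>The definition puts no sign on \<open>L\<close>;
    \<open>\<bar>L\<bar> + 1\<close> is a positive constant that dominates it.\<close>
  have "\<bar>h y - h x\<bar> < e" if y: "y \<in> pow_space S" "pow_dist S x y < e / (\<bar>L\<bar> + 1)" for y
  proof -
    have d: "pow_dist S x y \<ge> 0" by (simp add: pow_dist_def)
    have "\<bar>h y - h x\<bar> \<le> L * pow_dist S x y"
      using assms(2) x y unfolding lipschitz_pow_def by (metis abs_minus_commute)
    also have "\<dots> \<le> (\<bar>L\<bar> + 1) * pow_dist S x y" using d by (intro mult_right_mono) auto
    also have "\<dots> < e" using y(2) by (simp add: field_simps)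
    finally show ?thesis .
  qed
  then show "\<exists>d>0. \<forall>y\<in>pow_space S. pow_dist S x y < d \<longrightarrow> \<bar>h y - h x\<bar> < e"
    using e by (intro exI[of _ "e / (\<bar>L\<bar> + 1)"]) auto
qed

text \<open>The dual of a finite direct sum is the sum of the duals: \<open>g s\<close> is
  \<open>f\<close> on the vectors supported at \<open>s\<close>. Statements about functionals
  thereby reduce to bounded linear maps on \<open>'b\<close>.\<close>

lemma pow_dual_coordinates:
  fixes f :: "('s \<Rightarrow> 'b::banach) \<Rightarrow> real"
  assumes fin: "finite S" and f: "f \<in> pow_dual S"
  obtains g where "\<And>s. s \<in> S \<Longrightarrow> bounded_linear (g s)"
    "\<And>x. x \<in> pow_space S \<Longrightarrow> f x = (\<Sum>s\<in>S. g s (x s))"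
proof
  have add: "f (\<lambda>s\<in>S. x s + y s) = f x + f y" if "x \<in> pow_space S" "y \<in> pow_space S" for x y
    using f that by (auto simp: pow_dual_def)
  have scale: "f (\<lambda>s\<in>S. c *\<^sub>R x s) = c * f x" if "x \<in> pow_space S" for x c
    using f that by (auto simp: pow_dual_def)
  define inc where "inc s b = (\<lambda>i\<in>S. if i = s then b else (0::'b))" for s b
  define g where "g s b = f (inc s b)" for s b
  have inc: "inc s b \<in> pow_space S" for s b by (simp add: inc_def)
  have zero: "f (\<lambda>s\<in>S. 0) = 0" using scale[of "\<lambda>s\<in>S. 0" 0] by (simp cong: restrict_cong)
  show "bounded_linear (g s)" if s: "s \<in> S" for s
  proof -
    have lin: "linear (g s)"
    proof (rule linearI)
      fix b b' show "g s (b + b') = g s b + g s b'"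
      proof -
        have "(\<lambda>i\<in>S. inc s b i + inc s b' i) = inc s (b + b')"
          by (auto simp: inc_def restrict_def)
        then show ?thesis unfolding g_def using add[OF inc inc, of s b s b'] by simp
      qed
    next
      fix c b show "g s (c *\<^sub>R b) = c *\<^sub>R g s b"
      proof -
        have "(\<lambda>i\<in>S. c *\<^sub>R inc s b i) = inc s (c *\<^sub>R b)"
          by (auto simp: inc_def restrict_def)
        then show ?thesis unfolding g_def using scale[OF inc, of c s b] by simp
      qed
    qed
    have "continuous_map (pow_topology S) euclideanreal f" using f by (simp add: pow_dual_def)
    then obtain d where d: "d > 0" "\<And>y. y \<in> pow_space S \<Longrightarrow> pow_dist S (\<lambda>s\<in>S. 0) y < d \<Longrightarrow> \<bar>f y\<bar> < 1"
      unfolding continuous_map_pow_iff[OF fin]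
      using zero by (metis (no_types, lifting) diff_zero restrict_in_pow_space zero_less_one)
    have "\<bar>g s b\<bar> \<le> norm b * (2 / d)" for b
    proof (cases "b = 0")
      case False
      \<comment> \<open>Scaled to norm \<open>d / 2\<close>, the vector lies in the ball on which
        \<open>\<bar>f\<bar> < 1\<close>; this is the origin of the bound
        \<open>2 / d\<close>.\<close>
      define b' where "b' = (d / (2 * norm b)) *\<^sub>R b"
      have "pow_dist S (\<lambda>s\<in>S. 0) (inc s b') = (\<Sum>i\<in>S. if i = s then norm b' else 0)"
        unfolding pow_dist_alt by (intro sum.cong) (auto simp: inc_def)
      also have "\<dots> < d" using fin s d(1) False by (simp add: b'_def)
      finally have "\<bar>g s b'\<bar> < 1" unfolding g_def by (intro d inc)
      then have "(d / (2 * norm b)) * \<bar>g s b\<bar> < 1"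
        using d(1) by (simp add: b'_def linear_scale[OF lin] abs_mult)
      then show ?thesis using d(1) False by (simp add: field_simps)
    qed (use lin in \<open>simp add: linear_0\<close>)
    then show ?thesis
      using lin by (intro bounded_linear_intro[where K = "2 / d"]) (auto simp: linear_add linear_scale)
  qed
  show "f x = (\<Sum>s\<in>S. g s (x s))" if x: "x \<in> pow_space S" for x
  proof -
    \<comment> \<open>Coordinates are switched on one at a time, so that additivity of
      \<open>f\<close> can be used for two vectors in each step.\<close>
    have "f (\<lambda>i\<in>S. if i \<in> T then x i else 0) = (\<Sum>s\<in>T. g s (x s))" if "T \<subseteq> S" for T
      using finite_subset[OF that fin] that
    proof (induction T rule: finite_induct)
      case (insert s T)
      have "(\<lambda>i\<in>S. if i \<in> insert s T then x i else 0)
        = (\<lambda>i\<in>S. inc s (x s) i + (\<lambda>i\<in>S. if i \<in> T then x i else 0) i)"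
        using insert by (intro restrict_ext) (auto simp: inc_def)
      then have "f (\<lambda>i\<in>S. if i \<in> insert s T then x i else 0)
        = f (inc s (x s)) + f (\<lambda>i\<in>S. if i \<in> T then x i else 0)"
        using add[OF inc restrict_in_pow_space[of "\<lambda>i. if i \<in> T then x i else 0" S], of s "x s"]
        by (simp only:)
      also have "f (\<lambda>i\<in>S. if i \<in> T then x i else 0) = (\<Sum>s\<in>T. g s (x s))"
        using insert.prems by (intro insert.IH) simp
      finally show ?case using insert.hyps by (simp add: g_def)
    qed (simp add: zero)
    from this[of S] x show ?thesis by (simp add: pow_space_apply cong: restrict_cong)
  qed
qed

lemma pow_dual_component:
  fixes g :: "'b::banach \<Rightarrow> real"
  assumes fin: "finite S" and s: "s \<in> S" and g: "bounded_linear g"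
  shows "(\<lambda>x. g (x s)) \<in> pow_dual S"
proof -
  interpret bounded_linear g by fact
  obtain C where C: "\<And>x. norm (g x) \<le> norm x * C" using bounded by blast
  have "\<bar>g (x s) - g (y s)\<bar> \<le> \<bar>C\<bar> * pow_dist S x y" for x y :: "'a \<Rightarrow> 'b"
  proof -
    have "\<bar>g (x s) - g (y s)\<bar> \<le> norm (x s - y s) * C" using C[of "x s - y s"] by (simp add: diff)
    also have "\<dots> \<le> norm (x s - y s) * \<bar>C\<bar>" by (intro mult_left_mono) auto
    also have "norm (x s - y s) \<le> pow_dist S x y"
      unfolding pow_dist_alt using fin s by (intro member_le_sum) auto
    finally show ?thesis by (simp add: mult.commute mult_right_mono)
  qed
  then have "continuous_map (pow_topology S) euclideanreal (\<lambda>x. g (x s))"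
    by (intro lipschitz_pow_continuous[where L = "\<bar>C\<bar>"] fin) (auto simp: lipschitz_pow_def)
  then show ?thesis using s by (auto simp: pow_dual_def add scaleR)
qed

lemma pow_dual_add:
  assumes "finite S" "f \<in> pow_dual S" "g \<in> pow_dual S"
  shows "(\<lambda>x. f x + g x) \<in> pow_dual S"
  using assms unfolding pow_dual_def by (auto simp: algebra_simps intro!: continuous_map_add)

section \<open>The Pettis integral as a coordinatewise Bochner integral\<close>

lemma pow_dual_integral:
  fixes V :: "'w \<Rightarrow> 's \<Rightarrow> 'b::{banach,second_countable_topology}"
  assumes fin: "finite S" and V: "V \<in> measurable M (pow_borel S)"
    and int: "\<And>s. s \<in> S \<Longrightarrow> integrable M (\<lambda>\<omega>. V \<omega> s)"
    and f: "f \<in> pow_dual S"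
  shows "integrable M (\<lambda>\<omega>. f (V \<omega>))" "(\<integral>\<omega>. f (V \<omega>) \<partial>M) = f (\<lambda>s\<in>S. \<integral>\<omega>. V \<omega> s \<partial>M)"
proof -
  obtain g where g: "\<And>s. s \<in> S \<Longrightarrow> bounded_linear (g s)"
    "\<And>x. x \<in> pow_space S \<Longrightarrow> f x = (\<Sum>s\<in>S. g s (x s))"
    using pow_dual_coordinates[OF fin f] by metis
  have eq: "f (V \<omega>) = (\<Sum>s\<in>S. g s (V \<omega> s))" if "\<omega> \<in> space M" for \<omega>
    using measurable_space[OF V that] fin by (intro g(2)) simp
  have i: "integrable M (\<lambda>\<omega>. g s (V \<omega> s))" if "s \<in> S" for s
    using g(1)[OF that] int[OF that] by (rule integrable_bounded_linear)
  show "integrable M (\<lambda>\<omega>. f (V \<omega>))"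
    using i by (subst Bochner_Integration.integrable_cong[OF refl eq]) auto
  have "(\<integral>\<omega>. f (V \<omega>) \<partial>M) = (\<integral>\<omega>. (\<Sum>s\<in>S. g s (V \<omega> s)) \<partial>M)"
    by (intro Bochner_Integration.integral_cong eq refl)
  also have "\<dots> = (\<Sum>s\<in>S. g s (\<integral>\<omega>. V \<omega> s \<partial>M))"
    using i by (simp add: integral_bounded_linear[OF g(1) int])
  also have "\<dots> = f (\<lambda>s\<in>S. \<integral>\<omega>. V \<omega> s \<partial>M)" by (subst g(2)) auto
  finally show "(\<integral>\<omega>. f (V \<omega>) \<partial>M) = f (\<lambda>s\<in>S. \<integral>\<omega>. V \<omega> s \<partial>M)" .
qed

lemma has_pettis_integral_Bochner:
  fixes V :: "'w \<Rightarrow> 's \<Rightarrow> 'b::{banach,second_countable_topology}"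
  assumes fin: "finite S" and V: "V \<in> measurable M (pow_borel S)"
    and int: "\<And>s. s \<in> S \<Longrightarrow> integrable M (\<lambda>\<omega>. V \<omega> s)"
  shows "has_pettis_integral S M V (\<lambda>s\<in>S. \<integral>\<omega>. V \<omega> s \<partial>M)"
  using pow_dual_integral[OF assms] by (simp add: has_pettis_integral_def)

text \<open>Functionals of a single coordinate separate points by Hahn-Banach. Uniqueness is what
  determines the \<open>SOME\<close> in \<open>pettis_integral\<close>.\<close>

lemma has_pettis_integral_unique:
  fixes e e' :: "'s \<Rightarrow> 'b::banach"
  assumes fin: "finite S" and "has_pettis_integral S M V e" "has_pettis_integral S M V e'"
  shows "e = e'"
proof -
  have sp: "e \<in> pow_space S" "e' \<in> pow_space S"
    and eq: "\<And>f. f \<in> pow_dual S \<Longrightarrow> f e = f e'"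
    using assms by (auto simp: has_pettis_integral_def)
  have "e s = e' s" if s: "s \<in> S" for s
  proof (rule ccontr)
    assume "e s \<noteq> e' s"
    then obtain g :: "'b \<Rightarrow> real" where g: "bounded_linear g" "g (e s - e' s) \<noteq> 0"
      using bounded_linear_separates[of "e s - e' s"] by auto
    then show False
      using eq[OF pow_dual_component[OF fin s g(1)]]
      by (simp add: linear_diff bounded_linear.linear)
  qed
  then show ?thesis using sp by (auto simp: pow_space_def intro: PiE_ext)
qed

lemma pettis_integral_Bochner:
  fixes V :: "'w \<Rightarrow> 's \<Rightarrow> 'b::{banach,second_countable_topology}"
  assumes "finite S" "V \<in> measurable M (pow_borel S)"
    "\<And>s. s \<in> S \<Longrightarrow> integrable M (\<lambda>\<omega>. V \<omega> s)"
  shows "pettis_integral S M V = (\<lambda>s\<in>S. \<integral>\<omega>. V \<omega> s \<partial>M)"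
proof -
  have "has_pettis_integral S M V (\<lambda>s\<in>S. \<integral>\<omega>. V \<omega> s \<partial>M)"
    using assms by (rule has_pettis_integral_Bochner)
  then show ?thesis
    unfolding pettis_integral_def
    by (intro some_equality) (auto intro: has_pettis_integral_unique[OF assms(1)])
qed

section \<open>Type 2 and independent sums\<close>

text \<open>\<open>type_2\<close> leaves the sign of its constant open; a nonnegative one makes
  multiplication by \<open>C\<close> monotone and allows square roots to be taken.\<close>

definition type_2_const :: "real \<Rightarrow> 'b::banach itself \<Rightarrow> bool" where
  "type_2_const C _ \<longleftrightarrow> 0 \<le> C \<and>
     (\<forall>n (x :: nat \<Rightarrow> 'b).
        measure_pmf.expectation (Pi_pmf {..<n} 0 (\<lambda>_. pmf_of_set {-1, 1 :: real}))
          (\<lambda>r. (norm (\<Sum>i<n. r i *\<^sub>R x i))\<^sup>2)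
        \<le> C * (\<Sum>i<n. (norm (x i))\<^sup>2))"

lemma type_2_imp_const:
  assumes "type_2 TYPE('b::banach)"
  obtains C where "type_2_const C TYPE('b)"
proof -
  obtain C where C: "\<And>n (x :: nat \<Rightarrow> 'b).
        measure_pmf.expectation (Pi_pmf {..<n} 0 (\<lambda>_. pmf_of_set {-1, 1 :: real}))
          (\<lambda>r. (norm (\<Sum>i<n. r i *\<^sub>R x i))\<^sup>2)
        \<le> C * (\<Sum>i<n. (norm (x i))\<^sup>2)"
    using assms unfolding type_2_def by blast
  have "type_2_const \<bar>C\<bar> TYPE('b)"
    unfolding type_2_const_def
  proof safe
    fix n and x :: "nat \<Rightarrow> 'b"
    have "C * (\<Sum>i<n. (norm (x i))\<^sup>2) \<le> \<bar>C\<bar> * (\<Sum>i<n. (norm (x i))\<^sup>2)"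
      by (intro mult_right_mono sum_nonneg) auto
    then show "measure_pmf.expectation (Pi_pmf {..<n} 0 (\<lambda>_. pmf_of_set {-1, 1 :: real}))
          (\<lambda>r. (norm (\<Sum>i<n. r i *\<^sub>R x i))\<^sup>2)
        \<le> \<bar>C\<bar> * (\<Sum>i<n. (norm (x i))\<^sup>2)"
      using C[of n x] by linarith
  qed simp
  then show ?thesis by (rule that)
qed

lemma norm_add_power2_le: "(norm (x + y))\<^sup>2 \<le> 2 * (norm x)\<^sup>2 + 2 * (norm y)\<^sup>2"
proof -
  have "(norm (x + y))\<^sup>2 \<le> (norm x + norm y)\<^sup>2" by (intro power_mono norm_triangle_ineq) auto
  also have "\<dots> \<le> 2 * (norm x)\<^sup>2 + 2 * (norm y)\<^sup>2"
    using sum_squares_bound[of "norm x" "norm y"] by (simp add: power2_sum)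
  finally show ?thesis .
qed

lemma norm_diff_power2_le: "(norm (x - y))\<^sup>2 \<le> 2 * (norm x)\<^sup>2 + 2 * (norm y)\<^sup>2"
  using norm_add_power2_le[of x "- y"] by simp

lemma integrable_norm_add_power2:
  fixes f g :: "'a \<Rightarrow> 'b::{banach,second_countable_topology}"
  assumes [measurable]: "f \<in> borel_measurable M" "g \<in> borel_measurable M"
    and "integrable M (\<lambda>x. (norm (f x))\<^sup>2)" "integrable M (\<lambda>x. (norm (g x))\<^sup>2)"
  shows "integrable M (\<lambda>x. (norm (f x + g x))\<^sup>2)"
proof (rule Bochner_Integration.integrable_bound)
  show "integrable M (\<lambda>x. 2 * (norm (f x))\<^sup>2 + 2 * (norm (g x))\<^sup>2)" using assms by auto
qed (auto intro!: AE_I2 norm_add_power2_le)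

lemma integrable_norm_sum_power2:
  fixes f :: "'i \<Rightarrow> 'a \<Rightarrow> 'b::{banach,second_countable_topology}"
  assumes "\<And>i. i \<in> I \<Longrightarrow> f i \<in> borel_measurable M" "\<And>i. i \<in> I \<Longrightarrow> integrable M (\<lambda>x. (norm (f i x))\<^sup>2)"
  shows "integrable M (\<lambda>x. (norm (\<Sum>i\<in>I. f i x))\<^sup>2)"
  using assms
  by (induction I rule: infinite_finite_induct) (auto intro!: integrable_norm_add_power2)

context prob_space begin

lemma square_integrable_norm_imp_integrable:
  fixes f :: "'a \<Rightarrow> 'b::{banach,second_countable_topology}"
  assumes [measurable]: "f \<in> borel_measurable M" and f: "integrable M (\<lambda>x. (norm (f x))\<^sup>2)"
  shows "integrable M f"
proof -
  have "integrable M (\<lambda>x. norm (f x))"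
    by (rule square_integrable_imp_integrable) (use f in auto)
  then show ?thesis by (simp add: integrable_norm_iff)
qed

lemma expectation_norm_power2_le:
  fixes f :: "'a \<Rightarrow> 'b::{banach,second_countable_topology}"
  assumes [measurable]: "f \<in> borel_measurable M" and f: "integrable M (\<lambda>x. (norm (f x))\<^sup>2)"
  shows "(expectation (\<lambda>x. norm (f x)))\<^sup>2 \<le> expectation (\<lambda>x. (norm (f x))\<^sup>2)"
proof -
  have "integrable M (\<lambda>x. norm (f x))"
    using square_integrable_norm_imp_integrable[OF assms] by simp
  then have "variance (\<lambda>x. norm (f x))
    = expectation (\<lambda>x. (norm (f x))\<^sup>2) - (expectation (\<lambda>x. norm (f x)))\<^sup>2"
    using f by (rule variance_eq)
  then show ?thesis using variance_positive[of "\<lambda>x. norm (f x)"] by simp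
qed

text \<open>Jensen's inequality applied to \<open>a = E (a - B)\<close> for each value \<open>a\<close> of \<open>A\<close>.\<close>

lemma expectation_norm_power2_le_diff:
  fixes A B :: "'a \<Rightarrow> 'b::{banach,second_countable_topology}"
  assumes ind: "indep_var borel A borel B"
    and A: "integrable M (\<lambda>x. (norm (A x))\<^sup>2)" and B: "integrable M (\<lambda>x. (norm (B x))\<^sup>2)"
    and mean: "expectation B = 0"
  shows "expectation (\<lambda>x. (norm (A x))\<^sup>2) \<le> expectation (\<lambda>x. (norm (A x - B x))\<^sup>2)"
proof -
  have [measurable]: "A \<in> borel_measurable M" "B \<in> borel_measurable M"
    using ind by (auto dest: indep_var_rv1 indep_var_rv2)
  define \<alpha> \<beta> where "\<alpha> = distr M borel A" and "\<beta> = distr M borel B"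
  have prod: "\<alpha> \<Otimes>\<^sub>M \<beta> = distr M (borel \<Otimes>\<^sub>M borel) (\<lambda>x. (A x, B x))"
    using iffD1[OF indep_var_distribution_eq ind] unfolding \<alpha>_def \<beta>_def by blast
  interpret \<alpha>: prob_space \<alpha> unfolding \<alpha>_def by (rule prob_space_distr) simp
  interpret \<beta>: prob_space \<beta> unfolding \<beta>_def by (rule prob_space_distr) simp
  interpret pair_prob_space \<alpha> \<beta> ..
  have sets [measurable_cong]: "sets \<alpha> = sets borel" "sets \<beta> = sets borel" by (simp_all add: \<alpha>_def \<beta>_def)
  have diff: "integrable M (\<lambda>x. (norm (A x - B x))\<^sup>2)"
    using integrable_norm_add_power2[of A M "\<lambda>x. - B x"] A B by simp
  have int: "integrable (\<alpha> \<Otimes>\<^sub>M \<beta>) (\<lambda>(a, b). (norm (a - b))\<^sup>2)"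
    unfolding prod using diff by (subst integrable_distr_eq) auto
  have B': "integrable \<beta> (\<lambda>b. (norm b)\<^sup>2)" "integrable \<alpha> (\<lambda>a. (norm a)\<^sup>2)"
    unfolding \<alpha>_def \<beta>_def using A B by (auto simp: integrable_distr_eq)
  have "integral\<^sup>L M (\<lambda>x. (norm (A x))\<^sup>2) = (\<integral>a. (norm a)\<^sup>2 \<partial>\<alpha>)"
    unfolding \<alpha>_def by (subst integral_distr) auto
  also have "\<dots> \<le> (\<integral>a. (\<integral>b. (norm (a - b))\<^sup>2 \<partial>\<beta>) \<partial>\<alpha>)"
  proof (rule integral_mono)
    fix a :: 'b
    have ib: "integrable \<beta> (\<lambda>b. b)"
      using B'(1) by (intro \<beta>.square_integrable_norm_imp_integrable[of "\<lambda>b. b"]) auto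
    have "integrable \<beta> (\<lambda>b. (norm (a + (- b)))\<^sup>2)"
      using B' by (intro integrable_norm_add_power2) auto
    then have int2: "integrable \<beta> (\<lambda>b. (norm (a - b))\<^sup>2)" by simp
    have "(\<integral>b. b \<partial>\<beta>) = 0" unfolding \<beta>_def by (subst integral_distr) (auto simp: mean)
    then have "a = (\<integral>b. a - b \<partial>\<beta>)" using ib by (simp add: \<beta>.prob_space)
    then have "norm a = norm (\<integral>b. a - b \<partial>\<beta>)" by simp
    also have "\<dots> \<le> (\<integral>b. norm (a - b) \<partial>\<beta>)" by (rule integral_norm_bound)
    finally have "(norm a)\<^sup>2 \<le> (\<integral>b. norm (a - b) \<partial>\<beta>)\<^sup>2" by (rule power_mono) simp
    also have "\<dots> \<le> (\<integral>b. (norm (a - b))\<^sup>2 \<partial>\<beta>)"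
      using int2 by (intro \<beta>.expectation_norm_power2_le) auto
    finally show "(norm a)\<^sup>2 \<le> (\<integral>b. (norm (a - b))\<^sup>2 \<partial>\<beta>)" .
  next
    show "integrable \<alpha> (\<lambda>a. \<integral>b. (norm (a - b))\<^sup>2 \<partial>\<beta>)" using integrable_fst'[OF int] by simp
  qed (rule B')
  also have "\<dots> = (\<integral>(a, b). (norm (a - b))\<^sup>2 \<partial>(\<alpha> \<Otimes>\<^sub>M \<beta>))"
    using integral_fst'[OF int] by simp
  also have "\<dots> = integral\<^sup>L M (\<lambda>x. (norm (A x - B x))\<^sup>2)"
    unfolding prod by (subst integral_distr) auto
  finally show ?thesis .
qed

text \<open>\<open>A\<close> collects the summands with sign \<open>1\<close> and \<open>B\<close>
  those with sign \<open>-1\<close>, so the two sums are \<open>A + B\<close> and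
  \<open>A - B\<close>. The squared norm of \<open>A + B\<close> is at most twice the sum of the
  squared norms, and the Jensen inequality, used for both orders of \<open>A\<close> and
  \<open>B\<close>, bounds each of these in mean; hence the factor \<open>4\<close>.\<close>

lemma expectation_norm_sum_power2_le_signs:
  fixes Y :: "nat \<Rightarrow> 'a \<Rightarrow> 'b::{banach,second_countable_topology}"
  assumes ind: "indep_vars (\<lambda>_. borel) Y {..<n}"
    and sq: "\<And>k. k < n \<Longrightarrow> integrable M (\<lambda>x. (norm (Y k x))\<^sup>2)"
    and mean: "\<And>k. k < n \<Longrightarrow> expectation (Y k) = 0"
    and r: "\<And>k. k < n \<Longrightarrow> r k = -1 \<or> r k = (1::real)"
  shows "expectation (\<lambda>x. (norm (\<Sum>k<n. Y k x))\<^sup>2) \<le> 4 * expectation (\<lambda>x. (norm (\<Sum>k<n. r k *\<^sub>R Y k x))\<^sup>2)"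
proof -
  define P Q where "P = {k. k < n \<and> r k = 1}" and "Q = {k. k < n \<and> r k = -1}"
  have PQ: "{..<n} = P \<union> Q" "P \<inter> Q = {}" "P \<subseteq> {..<n}" "Q \<subseteq> {..<n}"
    using r by (auto simp: P_def Q_def)
  then have fin: "finite P" "finite Q" by (auto intro: finite_subset[OF _ finite_lessThan])
  have rv: "Y k \<in> borel_measurable M" if "k < n" for k
    using ind that by (auto simp: indep_vars_def2)
  have intY: "integrable M (Y k)" if "k < n" for k
    by (rule square_integrable_norm_imp_integrable[OF rv[OF that] sq[OF that]])
  define A B where "A = (\<lambda>x. \<Sum>k\<in>P. Y k x)" and "B = (\<lambda>x. \<Sum>k\<in>Q. Y k x)"
  have indep: "indep_var borel (\<lambda>x. \<Sum>k\<in>I. Y k x) borel (\<lambda>x. \<Sum>k\<in>J. Y k x)"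
    if "I \<inter> J = {}" "I \<subseteq> {..<n}" "J \<subseteq> {..<n}" for I J
  proof -
    have "indep_var borel ((\<lambda>f. \<Sum>k\<in>I. f k) \<circ> (\<lambda>\<omega>. restrict (\<lambda>i. Y i \<omega>) I))
        borel ((\<lambda>f. \<Sum>k\<in>J. f k) \<circ> (\<lambda>\<omega>. restrict (\<lambda>i. Y i \<omega>) J))"
      by (rule indep_var_compose[OF indep_var_restrict[OF ind that]]) measurable
    then show ?thesis by (simp add: comp_def)
  qed
  have AB: "indep_var borel A borel B" and BA: "indep_var borel B borel A"
    unfolding A_def B_def by (rule indep; use PQ in auto)+
  have sqA: "integrable M (\<lambda>x. (norm (A x))\<^sup>2)"
    unfolding A_def using PQ sq rv by (intro integrable_norm_sum_power2) auto
  have sqB: "integrable M (\<lambda>x. (norm (B x))\<^sup>2)"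
    unfolding B_def using PQ sq rv by (intro integrable_norm_sum_power2) auto
  have [measurable]: "A \<in> borel_measurable M" "B \<in> borel_measurable M"
    using AB by (auto dest: indep_var_rv1 indep_var_rv2)
  have "expectation A = (\<Sum>k\<in>P. expectation (Y k))"
    unfolding A_def using PQ intY by (intro Bochner_Integration.integral_sum) auto
  also have "\<dots> = 0" using PQ mean by (intro sum.neutral) auto
  finally have mA: "expectation A = 0" .
  have "expectation B = (\<Sum>k\<in>Q. expectation (Y k))"
    unfolding B_def using PQ intY by (intro Bochner_Integration.integral_sum) auto
  also have "\<dots> = 0" using PQ mean by (intro sum.neutral) auto
  finally have mB: "expectation B = 0" .
  have "(\<Sum>k<n. Y k x) = A x + B x" for x
    unfolding A_def B_def PQ(1) using fin PQ(2) by (rule sum.union_disjoint)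
  then have "expectation (\<lambda>x. (norm (\<Sum>k<n. Y k x))\<^sup>2) = expectation (\<lambda>x. (norm (A x + B x))\<^sup>2)" by simp
  also have "\<dots> \<le> expectation (\<lambda>x. 2 * (norm (A x))\<^sup>2 + 2 * (norm (B x))\<^sup>2)"
    using sqA sqB by (intro integral_mono integrable_norm_add_power2 norm_add_power2_le) auto
  also have "\<dots> = 2 * expectation (\<lambda>x. (norm (A x))\<^sup>2) + 2 * expectation (\<lambda>x. (norm (B x))\<^sup>2)"
    using sqA sqB by simp
  also have "\<dots> \<le> 4 * expectation (\<lambda>x. (norm ((\<lambda>x. A x - B x) x))\<^sup>2)"
    using expectation_norm_power2_le_diff[OF AB sqA sqB mB] expectation_norm_power2_le_diff[OF BA sqB sqA mA]
    by (simp add: norm_minus_commute)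
  also have "(\<lambda>x. A x - B x) = (\<lambda>x. \<Sum>k<n. r k *\<^sub>R Y k x)"
  proof
    fix x
    have "(\<Sum>k\<in>P. r k *\<^sub>R Y k x) = A x" unfolding A_def by (intro sum.cong) (auto simp: P_def)
    moreover have "(\<Sum>k\<in>Q. r k *\<^sub>R Y k x) = - B x"
      unfolding B_def sum_negf[symmetric] by (intro sum.cong) (auto simp: Q_def)
    ultimately show "A x - B x = (\<Sum>k<n. r k *\<^sub>R Y k x)"
      unfolding PQ(1) sum.union_disjoint[OF fin PQ(2)] by simp
  qed
  finally show ?thesis .
qed

lemma type_2_expectation_norm_sum_power2_le:
  fixes Y :: "nat \<Rightarrow> 'a \<Rightarrow> 'b::{banach,second_countable_topology}"
  assumes C: "type_2_const C TYPE('b)"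
    and ind: "indep_vars (\<lambda>_. borel) Y {..<n}"
    and sq: "\<And>k. k < n \<Longrightarrow> integrable M (\<lambda>x. (norm (Y k x))\<^sup>2)"
    and mean: "\<And>k. k < n \<Longrightarrow> expectation (Y k) = 0"
  shows "expectation (\<lambda>x. (norm (\<Sum>k<n. Y k x))\<^sup>2) \<le> 4 * C * (\<Sum>k<n. expectation (\<lambda>x. (norm (Y k x))\<^sup>2))"
proof -
  define p where "p = Pi_pmf {..<n} 0 (\<lambda>_. pmf_of_set {-1, 1 :: real})"
  have set_p: "set_pmf p = PiE_dflt {..<n} 0 (\<lambda>_. {-1, 1 :: real})"
    unfolding p_def by (subst set_Pi_pmf) (auto simp: PiE_dflt_def)
  then have fin: "finite (set_pmf p)" by (simp add: finite_PiE_dflt)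
  have rv: "Y k \<in> borel_measurable M" if "k < n" for k
    using ind that by (auto simp: indep_vars_def2)
  \<comment> \<open>There are finitely many sign vectors, so the average over signs is a finite sum
    and exchanges with \<open>expectation\<close> by linearity.\<close>
  have pm: "measure_pmf.expectation p g = (\<Sum>r\<in>set_pmf p. g r * pmf p r)" for g :: "_ \<Rightarrow> real"
    using fin by (intro integral_measure_pmf_real) auto
  have type_2: "(\<Sum>r\<in>set_pmf p. (norm (\<Sum>k<n. r k *\<^sub>R y k))\<^sup>2 * pmf p r)
      \<le> C * (\<Sum>k<n. (norm (y k))\<^sup>2)" for y :: "nat \<Rightarrow> 'b"
  proof -
    have "measure_pmf.expectation p (\<lambda>r. (norm (\<Sum>k<n. r k *\<^sub>R y k))\<^sup>2) \<le> C * (\<Sum>k<n. (norm (y k))\<^sup>2)"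
      using C unfolding p_def type_2_const_def by blast
    then show ?thesis unfolding pm .
  qed
  let ?E = "expectation (\<lambda>x. (norm (\<Sum>k<n. Y k x))\<^sup>2)"
  have int: "integrable M (\<lambda>x. (norm (\<Sum>k<n. r k *\<^sub>R Y k x))\<^sup>2)" for r
    using sq rv by (intro integrable_norm_sum_power2) (auto simp: power_mult_distrib)
  \<comment> \<open>The sign inequality holds for every fixed sign vector. Averaging it with the
    weights \<open>pmf p r\<close> brings in type 2, which is then used pointwise in
    \<open>x\<close>.\<close>
  have "?E = (\<Sum>r\<in>set_pmf p. ?E * pmf p r)"
    using fin by (simp flip: sum_distrib_left add: sum_pmf_eq_1)
  also have "\<dots> \<le> (\<Sum>r\<in>set_pmf p. 4 * expectation (\<lambda>x. (norm (\<Sum>k<n. r k *\<^sub>R Y k x))\<^sup>2) * pmf p r)"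
    by (intro sum_mono mult_right_mono expectation_norm_sum_power2_le_signs ind sq mean)
       (auto simp: set_p PiE_dflt_def)
  also have "\<dots> = 4 * expectation (\<lambda>x. \<Sum>r\<in>set_pmf p. (norm (\<Sum>k<n. r k *\<^sub>R Y k x))\<^sup>2 * pmf p r)"
    using int by (simp add: sum_distrib_left mult.assoc)
  also have "\<dots> \<le> 4 * expectation (\<lambda>x. C * (\<Sum>k<n. (norm (Y k x))\<^sup>2))"
    using int sq by (intro mult_left_mono integral_mono type_2) auto
  also have "\<dots> = 4 * C * (\<Sum>k<n. expectation (\<lambda>x. (norm (Y k x))\<^sup>2))"
    using sq by simp
  finally show ?thesis .
qed

end

section \<open>Weak convergence of random vectors from characteristic functions\<close>

text \<open>Finite sums of characters with complex coefficients, closed under products because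
  frequencies add. Convergence of characteristic functions amounts to convergence of the
  expectations of these functions.\<close>

inductive trig_poly :: "nat \<Rightarrow> ((nat \<Rightarrow> real) \<Rightarrow> complex) \<Rightarrow> bool" for J where
  trig_poly_iexp: "trig_poly J (\<lambda>x. c * iexp (\<Sum>j<J. t j * x j))"
| trig_poly_add: "trig_poly J f \<Longrightarrow> trig_poly J g \<Longrightarrow> trig_poly J (\<lambda>x. f x + g x)"

lemma trig_poly_mult:
  assumes "trig_poly J f" "trig_poly J g"
  shows "trig_poly J (\<lambda>x. f x * g x)"
  using assms(1)
proof induction
  case (trig_poly_iexp c t)
  from assms(2) show ?case
  proof induction
    case (trig_poly_iexp c' t')
    have "trig_poly J (\<lambda>x. (c * c') * iexp (\<Sum>j<J. (t j + t' j) * x j))"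
      by (rule trig_poly.trig_poly_iexp)
    then show ?case
      by (simp add: algebra_simps sum.distrib exp_add)
  qed (auto simp: algebra_simps intro: trig_poly_add)
qed (auto simp: algebra_simps intro: trig_poly_add)

lemma trig_poly_const: "trig_poly J (\<lambda>_. c)"
  using trig_poly_iexp[of J c "\<lambda>_. 0"] by simp

lemma trig_poly_sin:
  assumes "j < J"
  shows "trig_poly J (\<lambda>x. complex_of_real (R * sin (x j / R)))"
proof -
  have *: "(\<Sum>i<J. (if i = j then a else 0) * x i) = a * x j" for a and x :: "nat \<Rightarrow> real"
  proof -
    have "(\<Sum>i<J. (if i = j then a else 0) * x i) = (\<Sum>i<J. if i = j then a * x j else 0)"
      by (intro sum.cong) auto
    then show ?thesis using assms by simp
  qed
  have "trig_poly J (\<lambda>x. (complex_of_real R / (2 * \<i>)) * iexp (\<Sum>i<J. (if i = j then 1 / R else 0) * x i)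
      + (- (complex_of_real R / (2 * \<i>))) * iexp (\<Sum>i<J. (if i = j then - 1 / R else 0) * x i))"
    by (intro trig_poly_add trig_poly_iexp)
  moreover have "complex_of_real (R * sin (x j / R)) = (complex_of_real R / (2 * \<i>)) * iexp (1 / R * x j)
      + (- (complex_of_real R / (2 * \<i>))) * iexp (- 1 / R * x j)" for x :: "nat \<Rightarrow> real"
    by (simp add: sin_exp_eq field_simps flip: sin_of_real)
  ultimately show ?thesis by (simp only: *)
qed

text \<open>A substitute for clipping the coordinates to \<open>[-R, R]\<close>: bounded, close to
  the identity where \<open>x j\<close> is small against \<open>R\<close>, and, unlike clipping, a
  trigonometric polynomial. Setting the remaining coordinates to \<open>0\<close> puts the range
  into a compact set.\<close>

definition sin_map :: "nat \<Rightarrow> real \<Rightarrow> (nat \<Rightarrow> real) \<Rightarrow> nat \<Rightarrow> real" where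
  "sin_map J R x = (\<lambda>j. if j < J then R * sin (x j / R) else 0)"

text \<open>Only the first \<open>J\<close> coordinates enter the bound, so such an \<open>H\<close>
  is a function of these alone.\<close>

definition lipschitz_coords :: "nat \<Rightarrow> real \<Rightarrow> ((nat \<Rightarrow> real) \<Rightarrow> real) \<Rightarrow> bool" where
  "lipschitz_coords J L H \<longleftrightarrow> (\<forall>x y. \<bar>H x - H y\<bar> \<le> L * (\<Sum>j<J. \<bar>x j - y j\<bar>))"

lemma lipschitz_coords_continuous:
  assumes "lipschitz_coords J L H"
  shows "continuous_on A H"
  unfolding continuous_on_def
proof
  fix x
  have "((\<lambda>y. y j) \<longlongrightarrow> x j) (at x within A)" for j
    using continuous_on_product_coordinates[of j]
    by (metis UNIV_I continuous_on_def tendsto_within_subset subset_UNIV)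
  then have "((\<lambda>y. L * (\<Sum>j<J. \<bar>y j - x j\<bar>)) \<longlongrightarrow> L * (\<Sum>j<J. \<bar>x j - x j\<bar>)) (at x within A)"
    by (intro tendsto_intros)
  then have "((\<lambda>y. L * (\<Sum>j<J. \<bar>y j - x j\<bar>)) \<longlongrightarrow> 0) (at x within A)" by simp
  then have "((\<lambda>y. H y - H x) \<longlongrightarrow> 0) (at x within A)"
    by (rule Lim_null_comparison[rotated]) (use assms in \<open>auto simp: lipschitz_coords_def\<close>)
  then show "(H \<longlongrightarrow> H x) (at x within A)" by (simp add: LIM_zero_iff)
qed

text \<open>
  On the cube \<open>[-R, R]^J\<close>, which contains the range of the sine map, \<open>H\<close> is close to a polynomial,
  and a polynomial in the sines is a trigonometric polynomial.
\<close>

lemma trig_poly_approx_sin_map: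
  assumes H: "lipschitz_coords J L H" and R: "R > 0" and \<epsilon>: "\<epsilon> > 0"
  obtains f where "trig_poly J f" "\<And>x. \<bar>H (sin_map J R x) - Re (f x)\<bar> < \<epsilon>"
proof -
  define K where "K = PiE UNIV (\<lambda>j. if j < J then {-R..R} else {0::real})"
  \<comment> \<open>The algebra for Stone-Weierstrass: after composition with the sine map its
    members are trigonometric polynomials.\<close>
  define \<R> where "\<R> = {g. continuous_on K g \<and> trig_poly J (\<lambda>x. complex_of_real (g (sin_map J R x)))}"
  have "function_ring_on \<R> K"
  proof
    have "compactin (product_topology (\<lambda>_. euclidean) UNIV) K"
      unfolding K_def compactin_PiE by (auto simp: compactin_euclidean_iff)
    then show "compact K" by (simp add: euclidean_product_topology)
  next
    fix x y assume xy: "x \<in> K" "y \<in> K" "x \<noteq> y"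
    then obtain j where j: "x j \<noteq> y j" by auto
    moreover have "x j = 0" "y j = 0" if "\<not> j < J" using xy that by (auto simp: K_def PiE_iff dest!: spec[of _ j])
    ultimately have "j < J" by force
    then have "(\<lambda>x. x j) \<in> \<R>"
      using trig_poly_sin[of j J R] continuous_on_subset[OF continuous_on_product_coordinates[of j]]
      by (auto simp: \<R>_def sin_map_def)
    then show "\<exists>f\<in>\<R>. f x \<noteq> f y" by (rule rev_bexI) (rule j)
  next
    fix f g assume "f \<in> \<R>" "g \<in> \<R>"
    then show "(\<lambda>x. f x + g x) \<in> \<R>" "(\<lambda>x. f x * g x) \<in> \<R>"
      by (simp_all add: \<R>_def continuous_on_add continuous_on_mult trig_poly_add trig_poly_mult)
  qed (simp_all add: \<R>_def trig_poly_const)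
  then interpret function_ring_on \<R> K .
  obtain g where g: "g \<in> \<R>" "\<And>x. x \<in> K \<Longrightarrow> \<bar>H x - g x\<bar> < \<epsilon>"
    using Stone_Weierstrass_basic[OF lipschitz_coords_continuous[OF H] \<epsilon>] by blast
  have "sin_map J R x \<in> K" for x
    using R abs_sin_le_one[of "x _ / R"]
    by (auto simp: K_def sin_map_def PiE_iff abs_le_iff mult_left_le minus_le_iff
        intro: order_trans[OF _ mult_left_mono[of "-1" _ R]] split: if_splits)
  with g show ?thesis
    by (intro that[of "\<lambda>x. complex_of_real (g (sin_map J R x))"]) (auto simp: \<R>_def)
qed

text \<open>Taylor bound of order two for the sine. A quadratic error is wanted because second
  moments are what stays bounded uniformly in \<open>n\<close>.\<close>

lemma abs_diff_sin_scaled_le: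
  fixes x R :: real
  assumes "R > 0"
  shows "\<bar>x - R * sin (x / R)\<bar> \<le> x\<^sup>2 / R"
proof -
  have "\<bar>sin u - u\<bar> \<le> u\<^sup>2" for u :: real
    using Maclaurin_sin_bound[of u 2]
    by (simp add: sin_coeff_def numeral_2_eq_2) (smt (verit) divide_nonneg_nonneg field_sum_of_halves mult_2 zero_le_square)
  from mult_left_mono[OF this[of "x / R"], of R] assms
  have "\<bar>R * (sin (x / R) - x / R)\<bar> \<le> R * (x / R)\<^sup>2" by (simp add: abs_mult)
  also have "R * (x / R)\<^sup>2 = x\<^sup>2 / R" using assms by (simp add: power2_eq_square)
  also have "R * (sin (x / R) - x / R) = R * sin (x / R) - x" using assms by (simp add: field_simps)
  finally show ?thesis by (simp add: abs_minus_commute)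
qed

lemma lipschitz_coords_measurable:
  assumes H: "lipschitz_coords J L H" and Y: "\<And>j. (\<lambda>\<omega>. Y \<omega> j) \<in> borel_measurable M"
  shows "(\<lambda>\<omega>. H (Y \<omega>)) \<in> borel_measurable M"
proof -
  have "Y \<in> borel_measurable M" using Y by (rule measurable_coordinatewise_then_product)
  then show ?thesis
    using borel_measurable_continuous_onI[OF lipschitz_coords_continuous[OF H]]
    by (rule measurable_compose)
qed

lemma (in prob_space) integrable_trig_poly:
  assumes "trig_poly J f" and Y: "\<And>j. (\<lambda>\<omega>. Y \<omega> j) \<in> borel_measurable M"
  shows "integrable M (\<lambda>\<omega>. f (Y \<omega>))"
  using assms(1)
proof induction
  case (trig_poly_iexp c t)
  note [measurable] = Y
  show ?case
    by (intro integrable_const_bound[where B = "norm c"]) (auto simp: norm_mult)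
qed auto

lemma trig_poly_tendsto:
  assumes "trig_poly J f" "prob_space N" "prob_space Q"
    and Y: "\<And>n j. (\<lambda>\<omega>. Y n \<omega> j) \<in> borel_measurable N" and G: "\<And>j. (\<lambda>\<omega>. G \<omega> j) \<in> borel_measurable Q"
    and char: "\<And>t. (\<lambda>n. \<integral>\<omega>. iexp (\<Sum>j<J. t j * Y n \<omega> j) \<partial>N) \<longlonglongrightarrow> (\<integral>\<omega>. iexp (\<Sum>j<J. t j * G \<omega> j) \<partial>Q)"
  shows "(\<lambda>n. \<integral>\<omega>. f (Y n \<omega>) \<partial>N) \<longlonglongrightarrow> (\<integral>\<omega>. f (G \<omega>) \<partial>Q)"
  using assms(1)
proof induction
  case (trig_poly_iexp c t)
  show ?case using tendsto_mult_left[OF char] by simp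
next
  case (trig_poly_add f g)
  interpret N: prob_space N by fact
  interpret Q: prob_space Q by fact
  note int = trig_poly_add(1,2)[THEN N.integrable_trig_poly, OF Y]
    trig_poly_add(1,2)[THEN Q.integrable_trig_poly, OF G]
  show ?case
    unfolding Bochner_Integration.integral_add[OF int(1,2)] Bochner_Integration.integral_add[OF int(3,4)]
    by (intro tendsto_add trig_poly_add)
qed

text \<open>The error is of order \<open>1 / R\<close>, with a constant that depends on
  \<open>Y\<close> only through a bound on its second moments; this uniformity does the work of
  tightness.\<close>

lemma (in prob_space) sin_map_expectation_diff:
  assumes H: "lipschitz_coords J L H" "L \<ge> 0" "\<And>x. \<bar>H x\<bar> \<le> B" and R: "R > 0"
    and Y: "\<And>j. (\<lambda>\<omega>. Y \<omega> j) \<in> borel_measurable M"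
    and sq: "\<And>j. j < J \<Longrightarrow> integrable M (\<lambda>\<omega>. (Y \<omega> j)\<^sup>2)" "\<And>j. j < J \<Longrightarrow> expectation (\<lambda>\<omega>. (Y \<omega> j)\<^sup>2) \<le> b"
  shows "\<bar>expectation (\<lambda>\<omega>. H (Y \<omega>)) - expectation (\<lambda>\<omega>. H (sin_map J R (Y \<omega>)))\<bar> \<le> L * J * b / R"
proof -
  note [measurable] = Y
  have [measurable]: "(\<lambda>\<omega>. H (Y \<omega>)) \<in> borel_measurable M"
    by (rule lipschitz_coords_measurable[OF H(1)]) measurable
  have [measurable]: "(\<lambda>\<omega>. H (sin_map J R (Y \<omega>))) \<in> borel_measurable M"
    by (rule lipschitz_coords_measurable[OF H(1)]) (simp add: sin_map_def)
  have int: "integrable M (\<lambda>\<omega>. H (Y \<omega>))" "integrable M (\<lambda>\<omega>. H (sin_map J R (Y \<omega>)))"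
    using H(3) by (auto intro!: integrable_const_bound[where B = B])
  have "\<bar>expectation (\<lambda>\<omega>. H (Y \<omega>)) - expectation (\<lambda>\<omega>. H (sin_map J R (Y \<omega>)))\<bar>
    = \<bar>expectation (\<lambda>\<omega>. H (Y \<omega>) - H (sin_map J R (Y \<omega>)))\<bar>"
    using int by simp
  also have "\<dots> \<le> expectation (\<lambda>\<omega>. \<bar>H (Y \<omega>) - H (sin_map J R (Y \<omega>))\<bar>)"
    using integral_norm_bound[of M "\<lambda>\<omega>. H (Y \<omega>) - H (sin_map J R (Y \<omega>))"] by simp
  also have "\<dots> \<le> expectation (\<lambda>\<omega>. L * (\<Sum>j<J. (Y \<omega> j)\<^sup>2 / R))"
  proof (rule integral_mono)
    fix \<omega>
    have "\<bar>H (Y \<omega>) - H (sin_map J R (Y \<omega>))\<bar> \<le> L * (\<Sum>j<J. \<bar>Y \<omega> j - sin_map J R (Y \<omega>) j\<bar>)"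
      using H(1) by (auto simp: lipschitz_coords_def)
    also have "\<dots> \<le> L * (\<Sum>j<J. (Y \<omega> j)\<^sup>2 / R)"
      using abs_diff_sin_scaled_le[OF R] H(2) by (intro mult_left_mono sum_mono) (auto simp: sin_map_def)
    finally show "\<bar>H (Y \<omega>) - H (sin_map J R (Y \<omega>))\<bar> \<le> L * (\<Sum>j<J. (Y \<omega> j)\<^sup>2 / R)" .
  qed (use int sq in auto)
  also have "\<dots> = L * (\<Sum>j<J. expectation (\<lambda>\<omega>. (Y \<omega> j)\<^sup>2) / R)" using sq by simp
  also have "\<dots> \<le> L * (\<Sum>j<J. b / R)"
    using sq H(2) R by (intro mult_left_mono sum_mono divide_right_mono) auto
  finally show ?thesis by simp
qed

text \<open>A multivariate Levy continuity theorem for bounded Lipschitz functions: \<open>H\<close>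
  is replaced by its composition with the sine map, then by a trigonometric polynomial, for which
  \<open>char\<close> gives the limit.\<close>

lemma lipschitz_coords_tendsto:
  assumes "prob_space N" "prob_space Q" and H: "lipschitz_coords J L H" "L \<ge> 0" "\<And>x. \<bar>H x\<bar> \<le> B"
    and Y: "\<And>n j. (\<lambda>\<omega>. Y n \<omega> j) \<in> borel_measurable N" and G: "\<And>j. (\<lambda>\<omega>. G \<omega> j) \<in> borel_measurable Q"
    and sqY: "\<And>n j. j < J \<Longrightarrow> integrable N (\<lambda>\<omega>. (Y n \<omega> j)\<^sup>2)" "\<And>n j. j < J \<Longrightarrow> (\<integral>\<omega>. (Y n \<omega> j)\<^sup>2 \<partial>N) \<le> b"
    and sqG: "\<And>j. j < J \<Longrightarrow> integrable Q (\<lambda>\<omega>. (G \<omega> j)\<^sup>2)" "\<And>j. j < J \<Longrightarrow> (\<integral>\<omega>. (G \<omega> j)\<^sup>2 \<partial>Q) \<le> b"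
    and char: "\<And>t. (\<lambda>n. \<integral>\<omega>. iexp (\<Sum>j<J. t j * Y n \<omega> j) \<partial>N) \<longlonglongrightarrow> (\<integral>\<omega>. iexp (\<Sum>j<J. t j * G \<omega> j) \<partial>Q)"
  shows "(\<lambda>n. \<integral>\<omega>. H (Y n \<omega>) \<partial>N) \<longlonglongrightarrow> (\<integral>\<omega>. H (G \<omega>) \<partial>Q)"
proof (rule LIMSEQ_I)
  fix r :: real assume r: "r > 0"
  interpret N: prob_space N by fact
  interpret Q: prob_space Q by fact
  \<comment> \<open>Five errors: the sine map and the trigonometric polynomial on both sides, and
    the convergence itself.\<close>
  define \<epsilon> where "\<epsilon> = r / 5"
  have \<epsilon>: "\<epsilon> > 0" using r by (simp add: \<epsilon>_def)
  \<comment> \<open>Large enough that the sine map costs at most \<open>\<epsilon>\<close>; the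
    \<open>+ 1\<close> keeps \<open>R\<close> positive when the moment bound vanishes.\<close>
  define R where "R = (\<bar>L * J * b\<bar> + 1) / \<epsilon>"
  have R: "R > 0" using \<epsilon> by (simp add: R_def)
  have "L * J * b \<le> R * \<epsilon>" using \<epsilon> by (simp add: R_def)
  then have small: "L * J * b / R \<le> \<epsilon>" using R by (simp add: field_simps)
  obtain f where f: "trig_poly J f" "\<And>x. \<bar>H (sin_map J R x) - Re (f x)\<bar> < \<epsilon>"
    using trig_poly_approx_sin_map[OF H(1) R \<epsilon>] by blast
  have "(\<lambda>n. Re (\<integral>\<omega>. f (Y n \<omega>) \<partial>N)) \<longlonglongrightarrow> Re (\<integral>\<omega>. f (G \<omega>) \<partial>Q)"
    by (intro tendsto_Re trig_poly_tendsto[OF f(1)] assms)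
  from LIMSEQ_D[OF this \<epsilon>] obtain n0
    where n0: "\<And>n. n \<ge> n0 \<Longrightarrow> \<bar>Re (\<integral>\<omega>. f (Y n \<omega>) \<partial>N) - Re (\<integral>\<omega>. f (G \<omega>) \<partial>Q)\<bar> < \<epsilon>"
    unfolding real_norm_def by blast
  have close: "\<bar>(\<integral>\<omega>. H (sin_map J R (Z \<omega>)) \<partial>M) - Re (\<integral>\<omega>. f (Z \<omega>) \<partial>M)\<bar> \<le> \<epsilon>"
    if M: "prob_space M" and Z: "\<And>j. (\<lambda>\<omega>. Z \<omega> j) \<in> borel_measurable M" for M :: "'z measure" and Z
  proof -
    interpret prob_space M by fact
    note [measurable] = Z
    have [measurable]: "(\<lambda>\<omega>. H (sin_map J R (Z \<omega>))) \<in> borel_measurable M"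
      by (rule lipschitz_coords_measurable[OF H(1)]) (simp add: sin_map_def)
    have int: "integrable M (\<lambda>\<omega>. H (sin_map J R (Z \<omega>)))" "integrable M (\<lambda>\<omega>. f (Z \<omega>))"
      using H(3) by (auto intro!: integrable_const_bound[where B = B] integrable_trig_poly[OF f(1)])
    then have int3: "integrable M (\<lambda>\<omega>. Re (f (Z \<omega>)))" by simp
    have "(\<integral>\<omega>. H (sin_map J R (Z \<omega>)) \<partial>M) - Re (\<integral>\<omega>. f (Z \<omega>) \<partial>M)
      = (\<integral>\<omega>. H (sin_map J R (Z \<omega>)) - Re (f (Z \<omega>)) \<partial>M)"
      using int int3 by simp
    also have "norm \<dots> \<le> (\<integral>\<omega>. norm (H (sin_map J R (Z \<omega>)) - Re (f (Z \<omega>))) \<partial>M)"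
      by (rule integral_norm_bound)
    also have "\<dots> \<le> (\<integral>\<omega>. \<epsilon> \<partial>M)"
      using int int3 f(2) by (intro integral_mono) (auto intro: less_imp_le)
    finally show ?thesis by (simp add: prob_space)
  qed
  have "\<bar>(\<integral>\<omega>. H (Y n \<omega>) \<partial>N) - (\<integral>\<omega>. H (G \<omega>) \<partial>Q)\<bar> < r" if "n \<ge> n0" for n
  proof -
    have "\<bar>(\<integral>\<omega>. H (Y n \<omega>) \<partial>N) - (\<integral>\<omega>. H (sin_map J R (Y n \<omega>)) \<partial>N)\<bar> \<le> \<epsilon>"
      by (rule order_trans[OF N.sin_map_expectation_diff[OF H R Y[of n] sqY(1)[of _ n] sqY(2)[of _ n]] small])
    moreover have "\<bar>(\<integral>\<omega>. H (G \<omega>) \<partial>Q) - (\<integral>\<omega>. H (sin_map J R (G \<omega>)) \<partial>Q)\<bar> \<le> \<epsilon>"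
      by (rule order_trans[OF Q.sin_map_expectation_diff[OF H R G sqG] small])
    moreover note close[OF assms(1), of "Y n", OF Y] close[OF assms(2), of G, OF assms(7)] n0[OF that]
    ultimately show ?thesis unfolding \<epsilon>_def by linarith
  qed
  then show "\<exists>n0. \<forall>n\<ge>n0. norm ((\<integral>\<omega>. H (Y n \<omega>) \<partial>N) - (\<integral>\<omega>. H (G \<omega>) \<partial>Q)) < r"
    by (auto simp: real_norm_def)
qed

section \<open>Gaussian sequences and orthogonalization\<close>

text \<open>The case \<open>v = 0\<close>, in which the summands vanish almost surely, is included
  because functionals of the vector may be degenerate. For \<open>v > 0\<close> the frequency
  \<open>t * \<sigma>\<close> undoes the normalization to unit variance.\<close>

lemma (in prob_space) central_limit_char:
  fixes \<xi> :: "nat \<Rightarrow> 'a \<Rightarrow> real"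
  assumes ind: "indep_vars (\<lambda>_. borel) \<xi> UNIV"
    and dist: "\<And>k. distr M borel (\<xi> k) = \<mu>"
    and mean: "\<And>k. expectation (\<xi> k) = 0"
    and sq: "\<And>k. integrable M (\<lambda>x. (\<xi> k x)\<^sup>2)"
    and var: "\<And>k. expectation (\<lambda>x. (\<xi> k x)\<^sup>2) = v"
  shows "(\<lambda>n. expectation (\<lambda>x. iexp (t * ((\<Sum>k<n. \<xi> k x) / sqrt n))))
    \<longlonglongrightarrow> complex_of_real (exp (- (t\<^sup>2 * v) / 2))"
proof -
  have rv [measurable]: "\<xi> k \<in> borel_measurable M" for k
    using ind by (simp add: indep_vars_def2)
  have "v \<ge> 0" using var[of 0] by (metis integral_nonneg_AE AE_I2 zero_le_power2)
  then consider "v = 0" | "v > 0" by linarith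
  then show ?thesis
  proof cases
    case 1
    have "AE x in M. \<xi> k x = 0" for k
      using integral_nonneg_eq_0_iff_AE[OF sq[of k]] var[of k] 1 by simp
    then have "AE x in M. \<forall>k. \<xi> k x = 0" by (simp add: AE_all_countable)
    then have "expectation (\<lambda>x. iexp (t * ((\<Sum>k<n. \<xi> k x) / sqrt n))) = expectation (\<lambda>x. 1)" for n
      by (intro integral_cong_AE) auto
    then show ?thesis by (simp add: 1 prob_space)
  next
    case 2
    define \<sigma> where "\<sigma> = sqrt v"
    have \<sigma>: "\<sigma> > 0" "\<sigma>\<^sup>2 = v" using 2 by (auto simp: \<sigma>_def)
    have "weak_conv_m (\<lambda>n. distr M borel (\<lambda>x. (\<Sum>k<n. \<xi> k x) / sqrt (n * \<sigma>\<^sup>2))) std_normal_distribution"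
      using \<sigma> by (intro central_limit_theorem_zero_mean[OF ind mean \<sigma>(1) sq _ dist]) (simp add: mean var)
    then have "(\<lambda>n. char (distr M borel (\<lambda>x. (\<Sum>k<n. \<xi> k x) / sqrt (n * \<sigma>\<^sup>2))) (t * \<sigma>))
      \<longlonglongrightarrow> char std_normal_distribution (t * \<sigma>)"
      by (intro levy_continuity1 real_dist_normal_dist real_distribution_distr) auto
    also have "char std_normal_distribution (t * \<sigma>) = complex_of_real (exp (- (t\<^sup>2 * v) / 2))"
      by (simp add: char_std_normal_distribution power_mult_distrib \<sigma>)
    also have "(\<lambda>n. char (distr M borel (\<lambda>x. (\<Sum>k<n. \<xi> k x) / sqrt (n * \<sigma>\<^sup>2))) (t * \<sigma>))
      = (\<lambda>n. expectation (\<lambda>x. iexp (t * ((\<Sum>k<n. \<xi> k x) / sqrt n))))"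
      using \<sigma>(1) by (simp add: char_def integral_distr real_sqrt_mult)
    finally show ?thesis .
  qed
qed

section \<open>A sequence of independent standard normal variables\<close>

definition gauss_seq :: "(nat \<Rightarrow> real) measure" where
  "gauss_seq = PiM UNIV (\<lambda>_. std_normal_distribution)"

interpretation gauss_prod: product_prob_space "\<lambda>_::nat. std_normal_distribution" UNIV
  by (intro product_prob_spaceI prob_space_normal_density) simp

interpretation gauss: prob_space gauss_seq
  unfolding gauss_seq_def by (rule gauss_prod.prob_space_axioms)

lemma space_gauss_seq [simp]: "space gauss_seq = UNIV"
  by (simp add: gauss_seq_def space_PiM)

lemma measurable_gauss_seq [measurable]: "(\<lambda>\<omega>. \<omega> j) \<in> borel_measurable gauss_seq"
proof -
  have "(\<lambda>\<omega>. \<omega> j) \<in> measurable gauss_seq std_normal_distribution"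
    unfolding gauss_seq_def by (rule measurable_component_singleton) simp
  then show ?thesis by (simp cong: measurable_cong_sets)
qed

lemma distr_gauss_seq: "distr gauss_seq borel (\<lambda>\<omega>. \<omega> j) = std_normal_distribution"
proof -
  have "distr gauss_seq borel (\<lambda>\<omega>. \<omega> j) = distr gauss_seq std_normal_distribution (\<lambda>\<omega>. \<omega> j)"
    by (intro distr_cong) auto
  also have "\<dots> = std_normal_distribution"
    unfolding gauss_seq_def by (rule gauss_prod.PiM_component) simp
  finally show ?thesis .
qed

lemma indep_gauss_seq: "gauss.indep_vars (\<lambda>_. borel) (\<lambda>j \<omega>. \<omega> j) UNIV"
proof (subst gauss.indep_vars_iff_distr_eq_PiM)
  have "sets gauss_seq = sets (PiM UNIV (\<lambda>_::nat. borel :: real measure))"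
    unfolding gauss_seq_def by (intro sets_PiM_cong) auto
  then have "distr gauss_seq (PiM UNIV (\<lambda>_::nat. borel)) (\<lambda>\<omega>. \<lambda>j\<in>UNIV. \<omega> j) = gauss_seq"
    by (simp add: distr_id2 restrict_UNIV)
  also have "gauss_seq = PiM UNIV (\<lambda>j. distr gauss_seq borel (\<lambda>\<omega>. \<omega> j))"
    by (simp only: distr_gauss_seq) (simp add: gauss_seq_def)
  finally show "distr gauss_seq (PiM UNIV (\<lambda>_::nat. borel)) (\<lambda>\<omega>. \<lambda>j\<in>UNIV. \<omega> j)
    = PiM UNIV (\<lambda>j. distr gauss_seq borel (\<lambda>\<omega>. \<omega> j))" .
qed auto

lemma gauss_seq_char:
  "(\<integral>\<omega>. iexp (\<Sum>j<J. c j * \<omega> j) \<partial>gauss_seq) = complex_of_real (exp (- (\<Sum>j<J. (c j)\<^sup>2) / 2))"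
proof -
  have single: "(\<integral>\<omega>. iexp (c j * \<omega> j) \<partial>gauss_seq) = complex_of_real (exp (- (c j)\<^sup>2 / 2))" for j
  proof -
    have "(\<integral>\<omega>. iexp (c j * \<omega> j) \<partial>gauss_seq) = char (distr gauss_seq borel (\<lambda>\<omega>. \<omega> j)) (c j)"
      by (simp add: char_def integral_distr)
    then show ?thesis by (simp add: distr_gauss_seq char_std_normal_distribution)
  qed
  have "gauss.indep_vars (\<lambda>_. borel) (\<lambda>j \<omega>. c j * \<omega> j) {..<J}"
    by (rule gauss.indep_vars_compose2[OF gauss.indep_vars_subset[OF indep_gauss_seq]]) auto
  from gauss.char_distr_sum[OF this, of 1]
  have "(\<integral>\<omega>. iexp (\<Sum>j<J. c j * \<omega> j) \<partial>gauss_seq) = (\<Prod>j<J. (\<integral>\<omega>. iexp (c j * \<omega> j) \<partial>gauss_seq))"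
    by (simp add: char_def integral_distr)
  also have "\<dots> = (\<Prod>j<J. complex_of_real (exp (- (c j)\<^sup>2 / 2)))" unfolding single ..
  also have "\<dots> = complex_of_real (exp (\<Sum>j<J. - (c j)\<^sup>2 / 2))"
    by (simp add: exp_sum)
  finally show ?thesis by (simp add: sum_negf sum_divide_distrib)
qed

lemma gauss_seq_moment2:
  "integrable gauss_seq (\<lambda>\<omega>. (\<omega> j)\<^sup>2)" "(\<integral>\<omega>. (\<omega> j)\<^sup>2 \<partial>gauss_seq) = 1"
proof -
  have "integrable (distr gauss_seq borel (\<lambda>\<omega>. \<omega> j)) (\<lambda>x. x\<^sup>2)"
    unfolding distr_gauss_seq by (rule integrable_std_normal_distribution_moment)
  then show "integrable gauss_seq (\<lambda>\<omega>. (\<omega> j)\<^sup>2)" by (simp add: integrable_distr_eq)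
  have "(\<integral>x. x\<^sup>2 \<partial>distr gauss_seq borel (\<lambda>\<omega>. \<omega> j)) = 1"
    unfolding distr_gauss_seq using std_normal_distribution_even_moments[of 1] by (auto simp: fact_numeral)
  then show "(\<integral>\<omega>. (\<omega> j)\<^sup>2 \<partial>gauss_seq) = 1" by (simp add: integral_distr)
qed

text \<open>
  Gram--Schmidt without normalization. If the \<open>i\<close>-th function has square integral \<open>0\<close>, its coefficient
  is \<open>0\<close> by division by zero, which is correct because it is then a null function.
\<close>

function orthogonalize :: "'a measure \<Rightarrow> (nat \<Rightarrow> 'a \<Rightarrow> real) \<Rightarrow> nat \<Rightarrow> 'a \<Rightarrow> real" where
  "orthogonalize M \<xi> n = (\<lambda>x. \<xi> n x - (\<Sum>i<n.
     ((\<integral>y. \<xi> n y * orthogonalize M \<xi> i y \<partial>M) / (\<integral>y. (orthogonalize M \<xi> i y)\<^sup>2 \<partial>M)) * orthogonalize M \<xi> i x))"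
  by pat_completeness auto
termination by (relation "inv_image less_than (\<lambda>(M, \<xi>, n). n)") auto

declare orthogonalize.simps [simp del]

lemma orthogonalize_properties:
  assumes "prob_space M"
    and meas: "\<And>n. \<xi> n \<in> borel_measurable M" and bdd: "\<And>n. \<exists>B. \<forall>x. \<bar>\<xi> n x\<bar> \<le> B"
    and mean: "\<And>n. (\<integral>x. \<xi> n x \<partial>M) = (0::real)"
  shows "orthogonalize M \<xi> n \<in> borel_measurable M"
    and "\<exists>B. \<forall>x. \<bar>orthogonalize M \<xi> n x\<bar> \<le> B"
    and "(\<integral>x. orthogonalize M \<xi> n x \<partial>M) = 0"
    and "i < n \<Longrightarrow> (\<integral>x. orthogonalize M \<xi> i x * orthogonalize M \<xi> n x \<partial>M) = 0"
proof -
  interpret prob_space M by fact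
  define e where "e = orthogonalize M \<xi>"
  have e: "e n = (\<lambda>x. \<xi> n x - (\<Sum>i<n. ((\<integral>y. \<xi> n y * e i y \<partial>M) / (\<integral>y. (e i y)\<^sup>2 \<partial>M)) * e i x))" for n
    unfolding e_def by (rule orthogonalize.simps)
  \<comment> \<open>Bounded measurable functions form an algebra of integrable functions, so every
    product in the recursion can be integrated termwise.\<close>
  define P where "P f \<longleftrightarrow> f \<in> borel_measurable M \<and> (\<exists>B. \<forall>x. \<bar>f x\<bar> \<le> B)" for f :: "'a \<Rightarrow> real"
  have P_int: "integrable M f" if Pf: "P f" for f
  proof -
    obtain B where B: "\<forall>x. \<bar>f x\<bar> \<le> B" using Pf by (auto simp: P_def)
    then show ?thesis using Pf by (intro integrable_const_bound[of f B]) (auto simp: P_def)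
  qed
  have P_mult: "P (\<lambda>x. f x * g x)" if "P f" "P g" for f g
  proof -
    obtain B B' where "\<forall>x. \<bar>f x\<bar> \<le> B" "\<forall>x. \<bar>g x\<bar> \<le> B'" using \<open>P f\<close> \<open>P g\<close> by (auto simp: P_def)
    then have "\<bar>f x * g x\<bar> \<le> B * B'" for x
      unfolding abs_mult by (intro mult_mono) (auto intro: order_trans[OF abs_ge_zero])
    then show ?thesis using that by (auto simp: P_def)
  qed
  have P_diff: "P (\<lambda>x. f x - g x)" if "P f" "P g" for f g
  proof -
    obtain B B' where "\<forall>x. \<bar>f x\<bar> \<le> B" "\<forall>x. \<bar>g x\<bar> \<le> B'" using \<open>P f\<close> \<open>P g\<close> by (auto simp: P_def)
    then have "\<bar>f x - g x\<bar> \<le> B + B'" for x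
      using abs_triangle_ineq4[of "f x" "g x"] by (meson add_mono order_trans)
    then show ?thesis using that by (auto simp: P_def)
  qed
  have P_const: "P (\<lambda>x. c)" for c by (auto simp: P_def)
  have P_add: "P (\<lambda>x. f x + g x)" if "P f" "P g" for f g
    using P_diff[OF that(1) P_diff[OF P_const[of 0] that(2)]] by simp
  have P_sum: "P (\<lambda>x. \<Sum>i\<in>I. f i x)" if "\<And>i. i \<in> I \<Longrightarrow> P (f i)" for f and I :: "nat set"
    using that by (induction I rule: infinite_finite_induct) (auto intro: P_const P_add)
  have P\<xi>: "P (\<xi> n)" for n using meas bdd by (auto simp: P_def)
  have Pe: "P (e n)" for n
  proof (induction n rule: less_induct)
    case (less n)
    then show ?case by (subst e) (intro P_diff P\<xi> P_sum P_mult P_const, auto)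
  qed
  have ortho: "i < n \<Longrightarrow> (\<integral>x. e i x * e n x \<partial>M) = 0" for i n
  proof (induction n arbitrary: i rule: less_induct)
    case (less n)
    define a where "a k = (\<integral>y. \<xi> n y * e k y \<partial>M) / (\<integral>y. (e k y)\<^sup>2 \<partial>M)" for k
    have int: "integrable M (\<lambda>x. e i x * e k x)" "integrable M (\<lambda>x. \<xi> n x * e k x)" for k
      by (intro P_int P_mult Pe P\<xi>)+
    have off: "(\<integral>x. e i x * e k x \<partial>M) = 0" if "k < n" "k \<noteq> i" for k
      using less.IH[of k i] less.IH[of i k] that less.prems
      by (cases "i < k") (auto simp: mult.commute)
    have "(\<integral>x. e i x * e n x \<partial>M) = (\<integral>x. \<xi> n x * e i x - (\<Sum>k<n. a k * (e i x * e k x)) \<partial>M)"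
      by (intro Bochner_Integration.integral_cong refl, subst e[of n])
         (simp add: a_def[symmetric] algebra_simps sum_distrib_left)
    also have "\<dots> = (\<integral>x. \<xi> n x * e i x \<partial>M) - (\<Sum>k<n. a k * (\<integral>x. e i x * e k x \<partial>M))"
      using int by simp
    also have "(\<Sum>k<n. a k * (\<integral>x. e i x * e k x \<partial>M)) = (\<Sum>k<n. if k = i then a i * (\<integral>x. (e i x)\<^sup>2 \<partial>M) else 0)"
      by (intro sum.cong refl) (auto simp: off power2_eq_square)
    also have "\<dots> = a i * (\<integral>x. (e i x)\<^sup>2 \<partial>M)" using less.prems by simp
    also have "\<dots> = (\<integral>x. \<xi> n x * e i x \<partial>M)"
    proof (cases "(\<integral>x. (e i x)\<^sup>2 \<partial>M) = 0")
      case True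
      have "integrable M (\<lambda>x. (e i x)\<^sup>2)" using P_int[OF P_mult[OF Pe Pe]] by (simp add: power2_eq_square)
      from integral_nonneg_eq_0_iff_AE[OF this] True have "AE x in M. e i x = 0" by simp
      then have "(\<integral>x. \<xi> n x * e i x \<partial>M) = (\<integral>x. 0 \<partial>M)"
        using P_mult[OF P\<xi>[of n] Pe[of i]] P_const[of 0] by (intro integral_cong_AE) (auto simp: P_def)
      then show ?thesis using True by simp
    qed (simp add: a_def)
    finally show ?case by simp
  qed
  have mean_e: "(\<integral>x. e n x \<partial>M) = 0" for n
  proof (induction n rule: less_induct)
    case (less n)
    then show ?case
      by (subst e) (simp add: P_int[OF Pe] P_int[OF P\<xi>] mean)
  qed
  show "orthogonalize M \<xi> n \<in> borel_measurable M" "\<exists>B. \<forall>x. \<bar>orthogonalize M \<xi> n x\<bar> \<le> B"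
    using Pe[of n] by (auto simp: P_def e_def)
  show "(\<integral>x. orthogonalize M \<xi> n x \<partial>M) = 0" using mean_e[of n] by (simp add: e_def)
  show "i < n \<Longrightarrow> (\<integral>x. orthogonalize M \<xi> i x * orthogonalize M \<xi> n x \<partial>M) = 0"
    using ortho[of i n] by (simp add: e_def)
qed

lemma orthogonalize_span:
  obtains a where "\<And>x. \<xi> n x = (\<Sum>i<Suc n. a i * orthogonalize M \<xi> i x)"
proof
  show "\<xi> n x = (\<Sum>i<Suc n. (if i = n then 1 else
    (\<integral>y. \<xi> n y * orthogonalize M \<xi> i y \<partial>M) / (\<integral>y. (orthogonalize M \<xi> i y)\<^sup>2 \<partial>M)) * orthogonalize M \<xi> i x)" for x
    using orthogonalize.simps[of M \<xi> n] by simp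
qed

section \<open>Finite-rank approximation\<close>

lemma (in prob_space) expectation_power2_sum_indep:
  fixes \<xi> :: "nat \<Rightarrow> 'a \<Rightarrow> real"
  assumes ind: "indep_vars (\<lambda>_. borel) \<xi> UNIV"
    and mean: "\<And>k. expectation (\<xi> k) = 0" and sq: "\<And>k. integrable M (\<lambda>x. (\<xi> k x)\<^sup>2)"
  shows "expectation (\<lambda>x. (\<Sum>k<n. \<xi> k x)\<^sup>2) = (\<Sum>k<n. expectation (\<lambda>x. (\<xi> k x)\<^sup>2))"
proof (induction n)
  case (Suc n)
  have rv: "\<xi> k \<in> borel_measurable M" for k using ind by (simp add: indep_vars_def2)
  have int: "integrable M (\<xi> k)" for k by (rule square_integrable_imp_integrable[OF rv sq])
  have iv: "indep_var borel (\<xi> n) borel (\<lambda>\<omega>. \<Sum>k\<in>{..<n}. \<xi> k \<omega>)"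
    by (intro indep_vars_sum indep_vars_subset[OF ind]) auto
  have "expectation (\<lambda>x. \<xi> n x * (\<Sum>k<n. \<xi> k x)) = 0" "integrable M (\<lambda>x. \<xi> n x * (\<Sum>k<n. \<xi> k x))"
    using indep_var_lebesgue_integral[OF iv] indep_var_integrable[OF iv] int by (simp_all add: mean)
  moreover have "integrable M (\<lambda>x. (\<Sum>k<n. \<xi> k x)\<^sup>2)"
    using integrable_norm_sum_power2[of "{..<n}" \<xi> M] rv sq by simp
  moreover have "(\<Sum>k<Suc n. \<xi> k x)\<^sup>2 = (\<Sum>k<n. \<xi> k x)\<^sup>2 + (\<xi> n x)\<^sup>2 + 2 * (\<xi> n x * (\<Sum>k<n. \<xi> k x))" for x
    by (simp add: power2_sum algebra_simps)
  ultimately show ?case using sq by (simp add: Suc.IH)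
qed simp

text \<open>\<open>\<mu>\<close> is the law of the vector, on the power itself. Approximation and
  moments are computed under \<open>\<mu>\<close>, sums under \<open>N\<close>, and the transfer
  lemmas connect the two.\<close>

locale pow_clt = \<mu>: prob_space \<mu> + N: prob_space N
  for \<mu> :: "('s \<Rightarrow> 'b::{banach,second_countable_topology}) measure" and N :: "'u measure" +
  fixes S :: "'s set" and Vs :: "nat \<Rightarrow> 'u \<Rightarrow> 's \<Rightarrow> 'b" and C :: real
  assumes fin: "finite S" and sets_\<mu>: "sets \<mu> = sets (pow_borel S)"
    and sq: "\<And>s. s \<in> S \<Longrightarrow> integrable \<mu> (\<lambda>x. (norm (x s))\<^sup>2)"
    and indep: "N.indep_vars (\<lambda>_. pow_borel S) Vs UNIV"
    and dist: "\<And>k. distr N (pow_borel S) (Vs k) = \<mu>"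
    and C: "type_2_const C TYPE('b)"
begin

lemma space_\<mu> [simp]: "space \<mu> = pow_space S"
  using sets_eq_imp_space_eq[OF sets_\<mu>] fin by simp

lemma measure_pow_space [simp]: "measure \<mu> (pow_space S) = 1"
  using \<mu>.prob_space by simp

lemma C_nonneg: "C \<ge> 0" using C by (simp add: type_2_const_def)

lemma measurable_\<mu>_iff: "f \<in> borel_measurable \<mu> \<longleftrightarrow> f \<in> borel_measurable (pow_borel S)"
  by (simp cong: measurable_cong_sets add: sets_\<mu>)

lemma measurable_coord [measurable]: "s \<in> S \<Longrightarrow> (\<lambda>x. x s) \<in> borel_measurable \<mu>"
  unfolding measurable_\<mu>_iff by (rule measurable_pow_borel_component[OF fin _]) simp_all

lemma integrable_coord: "s \<in> S \<Longrightarrow> integrable \<mu> (\<lambda>x. x s)"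
  by (rule \<mu>.square_integrable_norm_imp_integrable[OF measurable_coord sq])

lemma measurable_Vs: "Vs k \<in> measurable N (pow_borel S)"
  using indep by (simp add: N.indep_vars_def2)

lemma measurable_transfer:
  assumes "\<phi> \<in> borel_measurable \<mu>" shows "(\<lambda>\<omega>. \<phi> (Vs k \<omega>)) \<in> borel_measurable N"
  using measurable_compose[OF measurable_Vs] assms by (simp add: measurable_\<mu>_iff)

lemma distr_transfer:
  assumes "\<phi> \<in> borel_measurable \<mu>" shows "distr N borel (\<lambda>\<omega>. \<phi> (Vs k \<omega>)) = distr \<mu> borel \<phi>"
  using assms distr_distr[of \<phi> "pow_borel S" borel "Vs k" N] measurable_Vs[of k]
  by (simp add: dist comp_def measurable_\<mu>_iff)

lemma integral_transfer:
  fixes \<phi> :: "('s \<Rightarrow> 'b) \<Rightarrow> 'c::{banach,second_countable_topology}"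
  assumes "\<phi> \<in> borel_measurable \<mu>"
  shows "(\<integral>\<omega>. \<phi> (Vs k \<omega>) \<partial>N) = (\<integral>x. \<phi> x \<partial>\<mu>)"
    "integrable N (\<lambda>\<omega>. \<phi> (Vs k \<omega>)) \<longleftrightarrow> integrable \<mu> \<phi>"
  using integral_distr[OF measurable_Vs[of k], of \<phi>] integrable_distr_eq[OF measurable_Vs[of k], of \<phi>] assms
  by (auto simp: dist measurable_\<mu>_iff)

lemma indep_transfer:
  assumes "\<phi> \<in> borel_measurable \<mu>"
  shows "N.indep_vars (\<lambda>_. borel) (\<lambda>k \<omega>. \<phi> (Vs (Suc k) \<omega>)) UNIV"
proof -
  \<comment> \<open>Grouping by the singletons \<open>{Suc k}\<close> shifts the indices, since
    \<open>normalized_sum\<close> starts at \<open>1\<close>.\<close>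
  have "N.indep_vars (\<lambda>k. PiM {Suc k} (\<lambda>_. pow_borel S)) (\<lambda>k \<omega>. restrict (\<lambda>i. Vs i \<omega>) {Suc k}) UNIV"
    by (rule N.indep_vars_restrict[OF indep]) (auto simp: disjoint_family_on_def)
  then have "N.indep_vars (\<lambda>_. borel) (\<lambda>k \<omega>. \<phi> (restrict (\<lambda>i. Vs i \<omega>) {Suc k} (Suc k))) UNIV"
  proof (rule N.indep_vars_compose2)
    fix k
    have "(\<lambda>f. f (Suc k)) \<in> measurable (PiM {Suc k} (\<lambda>_. pow_borel S)) (pow_borel S)"
      by (rule measurable_component_singleton) simp
    then show "(\<lambda>f. \<phi> (f (Suc k))) \<in> borel_measurable (PiM {Suc k} (\<lambda>_. pow_borel S))"
      using assms unfolding measurable_\<mu>_iff by (rule measurable_compose)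
  qed
  then show ?thesis by simp
qed

text \<open>Uniform in \<open>n\<close>: the \<open>n\<close> equal terms on the right of the type 2
  inequality cancel the square of \<open>1 / sqrt n\<close>. The bound is passed on to the first
  moment, which is what comparing integrals of Lipschitz functions takes.\<close>

lemma type_2_bound:
  fixes \<phi> :: "('s \<Rightarrow> 'b) \<Rightarrow> 'b"
  assumes [measurable]: "\<phi> \<in> borel_measurable \<mu>" and \<phi>: "integrable \<mu> (\<lambda>x. (norm (\<phi> x))\<^sup>2)"
    and mean: "(\<integral>x. \<phi> x \<partial>\<mu>) = 0"
  shows "(\<integral>\<omega>. norm ((1 / sqrt n) *\<^sub>R (\<Sum>k<n. \<phi> (Vs (Suc k) \<omega>))) \<partial>N) \<le> sqrt (4 * C * (\<integral>x. (norm (\<phi> x))\<^sup>2 \<partial>\<mu>))"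
    and "integrable N (\<lambda>\<omega>. norm ((1 / sqrt n) *\<^sub>R (\<Sum>k<n. \<phi> (Vs (Suc k) \<omega>))))"
proof -
  let ?T = "\<lambda>\<omega>. (1 / sqrt n) *\<^sub>R (\<Sum>k<n. \<phi> (Vs (Suc k) \<omega>))"
  have [measurable]: "(\<lambda>\<omega>. \<phi> (Vs (Suc k) \<omega>)) \<in> borel_measurable N" for k
    by (rule measurable_transfer) simp
  have sq': "integrable N (\<lambda>\<omega>. (norm (\<phi> (Vs (Suc k) \<omega>)))\<^sup>2)" for k
    using \<phi> by (subst integral_transfer) auto
  have int: "integrable N (\<lambda>\<omega>. (norm (?T \<omega>))\<^sup>2)"
    using integrable_norm_sum_power2[of "{..<n}" "\<lambda>k \<omega>. \<phi> (Vs (Suc k) \<omega>)" N] sq'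
    by (simp add: power_mult_distrib power_divide)
  show "integrable N (\<lambda>\<omega>. norm (?T \<omega>))"
    by (intro integrable_norm N.square_integrable_norm_imp_integrable[OF _ int]) simp
  have "(\<integral>\<omega>. (norm (\<Sum>k<n. \<phi> (Vs (Suc k) \<omega>)))\<^sup>2 \<partial>N) \<le> 4 * C * (\<Sum>k<n. \<integral>\<omega>. (norm (\<phi> (Vs (Suc k) \<omega>)))\<^sup>2 \<partial>N)"
    by (intro N.type_2_expectation_norm_sum_power2_le C N.indep_vars_subset[OF indep_transfer] sq')
       (auto simp: integral_transfer mean)
  also have "\<dots> = 4 * C * (\<integral>x. (norm (\<phi> x))\<^sup>2 \<partial>\<mu>) * n"
    by (subst integral_transfer) auto
  \<comment> \<open>For \<open>n = 0\<close> the factor \<open>1 / sqrt n\<close> is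
    \<open>0\<close> by convention, and the claim follows from \<open>C \<ge> 0\<close>.\<close>
  finally have "(\<integral>\<omega>. (norm (?T \<omega>))\<^sup>2 \<partial>N) \<le> 4 * C * (\<integral>x. (norm (\<phi> x))\<^sup>2 \<partial>\<mu>)"
    using C_nonneg by (cases "n = 0") (auto simp: power_mult_distrib power_divide field_simps)
  then have "(\<integral>\<omega>. norm (?T \<omega>) \<partial>N)\<^sup>2 \<le> 4 * C * (\<integral>x. (norm (\<phi> x))\<^sup>2 \<partial>\<mu>)"
    using N.expectation_norm_power2_le[of ?T, OF _ int] by simp
  then show "(\<integral>\<omega>. norm (?T \<omega>) \<partial>N) \<le> sqrt (4 * C * (\<integral>x. (norm (\<phi> x))\<^sup>2 \<partial>\<mu>))"
    by (rule real_le_rsqrt)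
qed

section \<open>Maps of finite rank and the orthogonal system\<close>

definition mean_vec :: "'s \<Rightarrow> 'b" where
  "mean_vec s = (\<integral>x. x s \<partial>\<mu>)"

text \<open>Every length \<open>J \<ge> J0\<close> represents the same map because the coefficients
  vanish from \<open>J0\<close> on, so two such maps can be written with a common length.\<close>

definition finite_rank :: "(nat \<Rightarrow> ('s \<Rightarrow> 'b) \<Rightarrow> real) \<Rightarrow> (('s \<Rightarrow> 'b) \<Rightarrow> 'b) \<Rightarrow> bool" where
  "finite_rank e \<phi> \<longleftrightarrow> (\<exists>J0 c. (\<forall>j\<ge>J0. c j = 0) \<and> (\<forall>x\<in>pow_space S. \<forall>J\<ge>J0. \<phi> x = (\<Sum>j<J. e j x *\<^sub>R c j)))"

lemma finite_rank_add:
  assumes "finite_rank e \<phi>" "finite_rank e \<phi>'"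
  shows "finite_rank e (\<lambda>x. \<phi> x + \<phi>' x)"
proof -
  obtain J0 c where c: "\<forall>j\<ge>J0. c j = 0" "\<forall>x\<in>pow_space S. \<forall>J\<ge>J0. \<phi> x = (\<Sum>j<J. e j x *\<^sub>R c j)"
    using assms(1) unfolding finite_rank_def by (elim exE conjE)
  obtain J0' c' where c': "\<forall>j\<ge>J0'. c' j = 0" "\<forall>x\<in>pow_space S. \<forall>J\<ge>J0'. \<phi>' x = (\<Sum>j<J. e j x *\<^sub>R c' j)"
    using assms(2) unfolding finite_rank_def by (elim exE conjE)
  show ?thesis unfolding finite_rank_def
  proof (intro exI[of _ "max J0 J0'"] exI[of _ "\<lambda>j. c j + c' j"] conjI ballI allI impI)
    fix x :: "'s \<Rightarrow> 'b" and J assume "x \<in> pow_space S" "max J0 J0' \<le> J"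
    then show "\<phi> x + \<phi>' x = (\<Sum>j<J. e j x *\<^sub>R (c j + c' j))"
      using c(2)[rule_format, of x J] c'(2)[rule_format, of x J] by (simp add: scaleR_add_right sum.distrib)
  qed (use c(1) c'(1) in auto)
qed

lemma finite_rank_zero: "finite_rank e (\<lambda>x. 0)"
  unfolding finite_rank_def by (intro exI[of _ 0] exI[of _ "\<lambda>_. 0"]) simp

lemma finite_rank_sum:
  "(\<And>i. i \<in> I \<Longrightarrow> finite_rank e (\<phi> i)) \<Longrightarrow> finite_rank e (\<lambda>x. \<Sum>i\<in>I. \<phi> i x)"
  by (induction I rule: infinite_finite_induct) (auto intro: finite_rank_add finite_rank_zero)

lemma finite_rank_single: "finite_rank e (\<lambda>x. e j x *\<^sub>R b)"
  unfolding finite_rank_def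
proof (intro exI[of _ "Suc j"] exI[of _ "\<lambda>i. if i = j then b else 0"] conjI ballI allI impI)
  fix x :: "'s \<Rightarrow> 'b" and J assume "Suc j \<le> J"
  have "(\<Sum>i<J. e i x *\<^sub>R (if i = j then b else 0)) = (\<Sum>i<J. if i = j then e j x *\<^sub>R b else 0)"
    by (intro sum.cong) auto
  then show "e j x *\<^sub>R b = (\<Sum>i<J. e i x *\<^sub>R (if i = j then b else 0))"
    using \<open>Suc j \<le> J\<close> by simp
qed auto

lemma finite_rank_cong: "(\<And>x. x \<in> pow_space S \<Longrightarrow> \<phi> x = \<phi>' x) \<Longrightarrow> finite_rank e \<phi> \<Longrightarrow> finite_rank e \<phi>'"
  unfolding finite_rank_def by metis

text \<open>
  The level sets of the simple functions that approximate the coordinates form a countable family;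
  the \<open>e j\<close> arise by orthogonalizing its centered indicators.
\<close>

lemma orthogonal_system:
  obtains e where
    "\<And>j. e j \<in> borel_measurable \<mu>" "\<And>j. \<exists>B. \<forall>x. \<bar>e j x\<bar> \<le> B" "\<And>j. (\<integral>x. e j x \<partial>\<mu>) = 0"
    "\<And>i j. i \<noteq> j \<Longrightarrow> (\<integral>x. e i x * e j x \<partial>\<mu>) = 0"
    "\<And>s \<epsilon>. s \<in> S \<Longrightarrow> \<epsilon> > 0 \<Longrightarrow> \<exists>\<phi>. finite_rank e \<phi> \<and> (\<integral>x. (norm (x s - mean_vec s - \<phi> x))\<^sup>2 \<partial>\<mu>) \<le> \<epsilon>"
proof -
  have "\<exists>F. (\<forall>i. simple_function \<mu> (F i)) \<and> (\<forall>x\<in>space \<mu>. (\<lambda>i. F i x) \<longlonglongrightarrow> x s) \<and>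
    (\<forall>i. \<forall>x\<in>space \<mu>. dist (F i x) 0 \<le> 2 * dist (x s) 0)" if "s \<in> S" for s
    using borel_measurable_implies_sequence_metric[OF measurable_coord[OF that]] .
  then obtain F where F: "\<And>s i. s \<in> S \<Longrightarrow> simple_function \<mu> (F s i)"
    "\<And>s x. s \<in> S \<Longrightarrow> x \<in> pow_space S \<Longrightarrow> (\<lambda>i. F s i x) \<longlonglongrightarrow> x s"
    "\<And>s i x. s \<in> S \<Longrightarrow> x \<in> pow_space S \<Longrightarrow> norm (F s i x) \<le> 2 * norm (x s)"
    unfolding dist_0_norm dist_norm diff_zero by (simp; metis)
  define level where "level s i y = F s i -` {y} \<inter> space \<mu>" for s i y
  \<comment> \<open>Inserting \<open>{}\<close> makes the family nonempty even for empty
    \<open>S\<close>, so that \<open>from_nat_into\<close> enumerates exactly this family.\<close>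
  define \<C> where "\<C> = insert {} (\<Union>s\<in>S. \<Union>i. level s i ` (F s i ` space \<mu>))"
  have fin_range: "finite (F s i ` space \<mu>)" if "s \<in> S" for s i
    using F(1)[OF that] by (simp add: simple_function_def)
  have "countable \<C>"
    unfolding \<C>_def
    by (intro countable_insert countable_UN[OF countable_finite[OF fin]] countable_UN[OF countableI_type]
        countable_finite finite_imageI fin_range)
  then have range_A: "range (from_nat_into \<C>) = \<C>" by (simp add: \<C>_def)
  define A where "A = from_nat_into \<C>"
  have \<C>_sets: "\<C> \<subseteq> sets \<mu>"
    using simple_functionD(2)[OF F(1)] by (auto simp: \<C>_def level_def)
  have A_sets [measurable]: "A n \<in> sets \<mu>" for n
    using \<C>_sets range_A unfolding A_def by blast
  define \<xi> where "\<xi> n x = indicat_real (A n) x - measure \<mu> (A n)" for n x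
  define e where "e = orthogonalize \<mu> \<xi>"
  have \<xi>_meas: "\<xi> n \<in> borel_measurable \<mu>" for n unfolding \<xi>_def by measurable
  have \<xi>_bdd: "\<exists>B. \<forall>x. \<bar>\<xi> n x\<bar> \<le> B" for n
  proof (intro exI allI)
    show "\<bar>\<xi> n x\<bar> \<le> 1 + measure \<mu> (A n)" for x
      by (auto simp: \<xi>_def indicator_def abs_if)
  qed
  have \<xi>_mean: "(\<integral>x. \<xi> n x \<partial>\<mu>) = 0" for n
  proof -
    have "integrable \<mu> (indicat_real (A n))"
      by (rule integrable_real_indicator[OF A_sets]) (simp add: \<mu>.emeasure_eq_measure)
    then show ?thesis
      unfolding \<xi>_def using sets.Int_space_eq2[OF A_sets[of n]] \<mu>.prob_space by simp
  qed
  note ortho = orthogonalize_properties[of \<mu> \<xi>, OF \<mu>.prob_space_axioms \<xi>_meas \<xi>_bdd \<xi>_mean]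
  have fr_\<xi>: "finite_rank e (\<lambda>x. \<xi> n x *\<^sub>R b)" for n b
  proof -
    obtain a where "\<And>x. \<xi> n x = (\<Sum>i<Suc n. a i * e i x)" using orthogonalize_span[of \<xi> n \<mu>] unfolding e_def by metis
    then have "(\<lambda>x. \<xi> n x *\<^sub>R b) = (\<lambda>x. \<Sum>i<Suc n. e i x *\<^sub>R (a i *\<^sub>R b))"
      by (simp add: scaleR_sum_left mult.commute del: sum.lessThan_Suc)
    then show ?thesis by (simp only:) (intro finite_rank_sum finite_rank_single)
  qed
  show ?thesis
  proof (rule that[of e])
    fix i j :: nat assume "i \<noteq> j"
    then show "(\<integral>x. e i x * e j x \<partial>\<mu>) = 0"
      using ortho(4)[of i j] ortho(4)[of j i] by (cases "i < j") (auto simp: e_def mult.commute)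
  next
    fix s \<epsilon> assume s: "s \<in> S" and \<epsilon>: "(\<epsilon>::real) > 0"
    have [measurable]: "F s i \<in> borel_measurable \<mu>" for i
      using F(1)[OF s] by (rule borel_measurable_simple_function)
    note [measurable] = measurable_coord[OF s]
    have dom: "(norm (F s i x - x s))\<^sup>2 \<le> 9 * (norm (x s))\<^sup>2" if "x \<in> pow_space S" for x i
    proof -
      have "norm (F s i x - x s) \<le> 3 * norm (x s)"
        using F(3)[OF s that, of i] norm_triangle_ineq4[of "F s i x" "x s"] by linarith
      then have "(norm (F s i x - x s))\<^sup>2 \<le> (3 * norm (x s))\<^sup>2" by (intro power_mono) auto
      then show ?thesis by (simp add: power_mult_distrib)
    qed
    have "(\<lambda>i. \<integral>x. (norm (F s i x - x s))\<^sup>2 \<partial>\<mu>) \<longlonglongrightarrow> (\<integral>x. 0 \<partial>\<mu>)"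
    proof (rule integral_dominated_convergence)
      show "integrable \<mu> (\<lambda>x. 9 * (norm (x s))\<^sup>2)" using sq[OF s] by simp
      show "AE x in \<mu>. (\<lambda>i. (norm (F s i x - x s))\<^sup>2) \<longlonglongrightarrow> 0"
      proof (rule AE_I2)
        fix x assume "x \<in> space \<mu>"
        then have "(\<lambda>i. (norm (F s i x - x s))\<^sup>2) \<longlonglongrightarrow> (norm (x s - x s))\<^sup>2"
          using F(2)[OF s] by (intro tendsto_intros) auto
        then show "(\<lambda>i. (norm (F s i x - x s))\<^sup>2) \<longlonglongrightarrow> 0" by simp
      qed
    qed (use dom in auto)
    \<comment> \<open>Centering costs a factor \<open>4\<close>: the square of a difference is at
      most twice the sum of both squares, and the squared norm of the mean is at most the mean
      square.\<close>
    then have "\<forall>\<^sub>F i in sequentially. (\<integral>x. (norm (F s i x - x s))\<^sup>2 \<partial>\<mu>) < \<epsilon> / 4"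
      using \<epsilon> by (intro order_tendstoD(2)) auto
    then obtain i where i: "(\<integral>x. (norm (F s i x - x s))\<^sup>2 \<partial>\<mu>) < \<epsilon> / 4"
      using eventually_happens by force
    define f where "f x = F s i x - x s" for x
    have [measurable]: "f \<in> borel_measurable \<mu>" unfolding f_def by measurable
    have sqf: "integrable \<mu> (\<lambda>x. (norm (f x))\<^sup>2)"
      unfolding f_def
      by (rule Bochner_Integration.integrable_bound[OF integrable_mult_right[OF sq[OF s], of 9]])
         (use dom in auto)
    have intf: "integrable \<mu> f" by (rule \<mu>.square_integrable_norm_imp_integrable[OF _ sqf]) simp
    have "integrable \<mu> (\<lambda>x. f x + x s)" using intf integrable_coord[OF s] by simp
    then have intF: "integrable \<mu> (F s i)" by (simp add: f_def)
    \<comment> \<open>Subtracting the integral replaces each indicator in the simple function by its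
      centered version \<open>\<xi>\<close>, which lies in the span of the
      \<open>e j\<close>.\<close>
    define \<phi> where "\<phi> x = F s i x - (\<integral>x. F s i x \<partial>\<mu>)" for x
    have rep: "F s i x = (\<Sum>y\<in>F s i ` space \<mu>. indicat_real (level s i y) x *\<^sub>R y)" if "x \<in> pow_space S" for x
      unfolding level_def
      by (rule simple_function_indicator_representation_banach[OF F(1)[OF s]]) (simp add: that)
    have level_\<C>: "level s i y \<in> \<C>" if "y \<in> F s i ` space \<mu>" for y
      unfolding \<C>_def using s that by blast
    then have level_sets: "level s i y \<in> sets \<mu>" if "y \<in> F s i ` space \<mu>" for y
      using \<C>_sets that by blast
    have "(\<integral>x. F s i x \<partial>\<mu>) = (\<integral>x. (\<Sum>y\<in>F s i ` space \<mu>. indicat_real (level s i y) x *\<^sub>R y) \<partial>\<mu>)"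
      by (intro Bochner_Integration.integral_cong refl rep) simp
    also have "\<dots> = (\<Sum>y\<in>F s i ` space \<mu>. measure \<mu> (level s i y) *\<^sub>R y)"
    proof -
      have "has_bochner_integral \<mu> (\<lambda>x. indicat_real (level s i y) x *\<^sub>R y) (measure \<mu> (level s i y) *\<^sub>R y)"
        if "y \<in> F s i ` space \<mu>" for y
        using level_sets[OF that]
        by (intro has_bochner_integral_scaleR_left has_bochner_integral_real_indicator)
           (simp_all add: \<mu>.emeasure_eq_measure)
      from has_bochner_integral_sum[OF this] show ?thesis by (rule has_bochner_integral_integral_eq)
    qed
    finally have mF: "(\<integral>x. F s i x \<partial>\<mu>) = (\<Sum>y\<in>F s i ` space \<mu>. measure \<mu> (level s i y) *\<^sub>R y)" .
    have "\<exists>n. level s i y = A n" if "y \<in> F s i ` space \<mu>" for y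
    proof -
      have "level s i y \<in> range A" unfolding A_def range_A by (rule level_\<C>[OF that])
      then show ?thesis by auto
    qed
    then obtain n where n: "\<And>y. y \<in> F s i ` space \<mu> \<Longrightarrow> level s i y = A (n y)" by metis
    have "finite_rank e (\<lambda>x. \<Sum>y\<in>F s i ` space \<mu>. \<xi> (n y) x *\<^sub>R y)"
      by (intro finite_rank_sum fr_\<xi>)
    then have "finite_rank e \<phi>"
    proof (rule finite_rank_cong[rotated])
      fix x :: "'s \<Rightarrow> 'b" assume x: "x \<in> pow_space S"
      have "(\<Sum>y\<in>F s i ` space \<mu>. \<xi> (n y) x *\<^sub>R y)
        = (\<Sum>y\<in>F s i ` space \<mu>. indicat_real (level s i y) x *\<^sub>R y - measure \<mu> (level s i y) *\<^sub>R y)"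
        by (intro sum.cong refl) (simp only: \<xi>_def n scaleR_diff_left)
      also have "\<dots> = \<phi> x" unfolding sum_subtractf mF[symmetric] rep[OF x, symmetric] \<phi>_def ..
      finally show "(\<Sum>y\<in>F s i ` space \<mu>. \<xi> (n y) x *\<^sub>R y) = \<phi> x" .
    qed
    moreover have "(\<integral>x. (norm (x s - mean_vec s - \<phi> x))\<^sup>2 \<partial>\<mu>) \<le> \<epsilon>"
    proof -
      have mf: "(\<integral>x. f x \<partial>\<mu>) = (\<integral>x. F s i x \<partial>\<mu>) - mean_vec s"
        unfolding f_def mean_vec_def using intF integrable_coord[OF s] by simp
      have "(\<integral>x. (norm (x s - mean_vec s - \<phi> x))\<^sup>2 \<partial>\<mu>) = (\<integral>x. (norm ((\<integral>x. f x \<partial>\<mu>) - f x))\<^sup>2 \<partial>\<mu>)"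
        unfolding mf by (simp add: \<phi>_def f_def algebra_simps)
      also have "\<dots> \<le> (\<integral>x. 2 * (norm (\<integral>x. f x \<partial>\<mu>))\<^sup>2 + 2 * (norm (f x))\<^sup>2 \<partial>\<mu>)"
      proof (rule integral_mono)
        have "integrable \<mu> (\<lambda>x. (norm ((\<integral>x. f x \<partial>\<mu>) + (- f x)))\<^sup>2)"
          by (rule integrable_norm_add_power2) (use sqf in auto)
        then show "integrable \<mu> (\<lambda>x. (norm ((\<integral>x. f x \<partial>\<mu>) - f x))\<^sup>2)" by simp
      qed (use sqf in \<open>auto intro: norm_diff_power2_le\<close>)
      also have "\<dots> = 2 * (norm (\<integral>x. f x \<partial>\<mu>))\<^sup>2 + 2 * (\<integral>x. (norm (f x))\<^sup>2 \<partial>\<mu>)"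
        using sqf by (simp add: \<mu>.prob_space)
      also have "(norm (\<integral>x. f x \<partial>\<mu>))\<^sup>2 \<le> (\<integral>x. norm (f x) \<partial>\<mu>)\<^sup>2"
        by (intro power_mono integral_norm_bound) simp
      also have "\<dots> \<le> (\<integral>x. (norm (f x))\<^sup>2 \<partial>\<mu>)"
        by (rule \<mu>.expectation_norm_power2_le[OF _ sqf]) simp
      finally show ?thesis using i by (simp add: f_def)
    qed
    ultimately show "\<exists>\<phi>. finite_rank e \<phi> \<and> (\<integral>x. (norm (x s - mean_vec s - \<phi> x))\<^sup>2 \<partial>\<mu>) \<le> \<epsilon>" by blast
  qed (use ortho in \<open>auto simp: e_def\<close>)
qed

end

text \<open>The expected increments are summable, so the sum of their norms has finite expectation
  and is almost surely finite; completeness does the rest.\<close>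

lemma AE_convergent_of_summable_increments:
  fixes u :: "nat \<Rightarrow> 'a \<Rightarrow> 'b::{banach,second_countable_topology}"
  assumes [measurable]: "\<And>k. u k \<in> borel_measurable M"
    and int: "\<And>k. integrable M (\<lambda>x. norm (u (Suc k) x - u k x))"
    and le: "\<And>k. (\<integral>x. norm (u (Suc k) x - u k x) \<partial>M) \<le> a k" and a: "summable a"
  shows "AE x in M. convergent (\<lambda>k. u k x)"
proof -
  have a_nonneg: "a k \<ge> 0" for k
    using order_trans[OF integral_nonneg_AE le[of k]] by simp
  have "(\<integral>\<^sup>+x. (\<Sum>k. ennreal (norm (u (Suc k) x - u k x))) \<partial>M)
    = (\<Sum>k. \<integral>\<^sup>+x. ennreal (norm (u (Suc k) x - u k x)) \<partial>M)"
    by (rule nn_integral_suminf) measurable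
  also have "\<dots> = (\<Sum>k. ennreal (\<integral>x. norm (u (Suc k) x - u k x) \<partial>M))"
    using int by (simp add: nn_integral_eq_integral)
  also have "\<dots> \<le> (\<Sum>k. ennreal (a k))"
    by (intro suminf_le ennreal_leI le) auto
  also have "\<dots> < \<infinity>"
    using a a_nonneg by (simp add: suminf_ennreal_eq[OF _ summable_sums])
  finally have "AE x in M. (\<Sum>k. ennreal (norm (u (Suc k) x - u k x))) \<noteq> \<infinity>"
    by (intro nn_integral_noteq_infinite) auto
  then show ?thesis
  proof eventually_elim
    case (elim x)
    then have "summable (\<lambda>k. norm (u (Suc k) x - u k x))"
      by (intro summable_suminf_not_top) auto
    then have "summable (\<lambda>k. u (Suc k) x - u k x)" by (rule summable_norm_cancel)
    then have "convergent (\<lambda>n. (\<Sum>k<n. u (Suc k) x - u k x) + u 0 x)"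
      by (intro convergent_add convergent_const) (simp add: summable_iff_convergent)
    then show ?case by (simp add: sum_lessThan_telescope[of "\<lambda>k. u k x"])
  qed
qed

text \<open>The coefficients \<open>c\<close> stay fixed while \<open>y\<close> is replaced by the
  functions \<open>e j\<close>, by their normalized sums, or by the Gaussian coordinates.\<close>

definition lincomb :: "nat \<Rightarrow> (nat \<Rightarrow> 'b) \<Rightarrow> (nat \<Rightarrow> real) \<Rightarrow> 'b::real_normed_vector" where
  "lincomb J c y = (\<Sum>j<J. y j *\<^sub>R c j)"

lemma lincomb_extend:
  assumes "J \<le> J'" "\<And>j. j \<ge> J \<Longrightarrow> c j = 0"
  shows "lincomb J c y = lincomb J' c y"
  unfolding lincomb_def using assms by (intro sum.mono_neutral_left) auto

lemma lincomb_diff: "lincomb J c y - lincomb J c' y = lincomb J (\<lambda>j. c j - c' j) y"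
  by (simp add: lincomb_def scaleR_diff_right sum_subtractf)

lemma norm_lincomb_diff_le: "norm (lincomb J c y - lincomb J c y') \<le> (\<Sum>j<J. norm (c j)) * (\<Sum>j<J. \<bar>y j - y' j\<bar>)"
proof -
  have "lincomb J c y - lincomb J c y' = (\<Sum>j<J. (y j - y' j) *\<^sub>R c j)"
    by (simp add: lincomb_def scaleR_diff_left sum_subtractf)
  also have "norm \<dots> \<le> (\<Sum>j<J. \<bar>y j - y' j\<bar> * norm (c j))" by (intro sum_norm_le) simp
  also have "\<dots> \<le> (\<Sum>j<J. \<bar>y j - y' j\<bar> * (\<Sum>j<J. norm (c j)))"
    by (intro sum_mono mult_left_mono member_le_sum) auto
  also have "\<dots> = (\<Sum>j<J. norm (c j)) * (\<Sum>j<J. \<bar>y j - y' j\<bar>)"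
    unfolding sum_distrib_right[symmetric] by (rule mult.commute)
  finally show ?thesis .
qed

lemma measurable_lincomb [measurable (raw)]:
  fixes c :: "nat \<Rightarrow> 'b::{banach,second_countable_topology}"
  assumes "\<And>j. (\<lambda>\<omega>. Y \<omega> j) \<in> borel_measurable M"
  shows "(\<lambda>\<omega>. lincomb J c (Y \<omega>)) \<in> borel_measurable M"
  unfolding lincomb_def using assms by (intro borel_measurable_sum borel_measurable_scaleR) auto

lemma integrable_norm_lincomb_power2:
  fixes c :: "nat \<Rightarrow> 'b::{banach,second_countable_topology}"
  assumes "\<And>j. (\<lambda>\<omega>. Y \<omega> j) \<in> borel_measurable M" "\<And>j. integrable M (\<lambda>\<omega>. (Y \<omega> j)\<^sup>2)"
  shows "integrable M (\<lambda>\<omega>. (norm (lincomb J c (Y \<omega>)))\<^sup>2)"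
  unfolding lincomb_def using assms
  by (intro integrable_norm_sum_power2 borel_measurable_scaleR) (auto simp: power_mult_distrib)

section \<open>The limits of the finite-rank approximations\<close>

locale pow_clt_system = pow_clt +
  fixes e :: "nat \<Rightarrow> ('a \<Rightarrow> 'b) \<Rightarrow> real"
  assumes e_meas [measurable]: "\<And>j. e j \<in> borel_measurable \<mu>"
    and e_bdd: "\<And>j. \<exists>B. \<forall>x. \<bar>e j x\<bar> \<le> B"
    and e_mean: "\<And>j. (\<integral>x. e j x \<partial>\<mu>) = 0"
    and e_ortho: "\<And>i j. i \<noteq> j \<Longrightarrow> (\<integral>x. e i x * e j x \<partial>\<mu>) = 0"
    and e_dense: "\<And>s \<epsilon>. s \<in> S \<Longrightarrow> \<epsilon> > 0 \<Longrightarrow>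
      \<exists>\<phi>. finite_rank e \<phi> \<and> (\<integral>x. (norm (x s - mean_vec s - \<phi> x))\<^sup>2 \<partial>\<mu>) \<le> \<epsilon>"
begin

lemma e_mult_integrable: "integrable \<mu> (\<lambda>x. e i x * e j x)"
proof -
  obtain B where B: "\<And>x. \<bar>e i x\<bar> \<le> B" using e_bdd by blast
  obtain B' where B': "\<And>x. \<bar>e j x\<bar> \<le> B'" using e_bdd by blast
  show ?thesis
  proof (rule \<mu>.integrable_const_bound[where B = "B * B'"])
    show "AE x in \<mu>. norm (e i x * e j x) \<le> B * B'"
      using B B' by (auto simp: abs_mult intro!: mult_mono intro: order_trans[OF abs_ge_zero])
  qed simp
qed

lemma e_sq_integrable: "integrable \<mu> (\<lambda>x. (e j x)\<^sup>2)"
  using e_mult_integrable[of j j] by (simp add: power2_eq_square)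

lemma e_integrable: "integrable \<mu> (e j)"
  by (rule \<mu>.square_integrable_imp_integrable[OF e_meas e_sq_integrable])

definition var :: "nat \<Rightarrow> real" where "var j = (\<integral>x. (e j x)\<^sup>2 \<partial>\<mu>)"

text \<open>Coordinates of the limit: under \<open>gauss_seq\<close> these are independent centered
  normals with the variances of the \<open>e j\<close>, possibly \<open>0\<close>.\<close>

definition gcoord :: "(nat \<Rightarrow> real) \<Rightarrow> nat \<Rightarrow> real" where "gcoord \<omega> j = sqrt (var j) * \<omega> j"

definition ecoord :: "nat \<Rightarrow> 'c \<Rightarrow> nat \<Rightarrow> real" where
  "ecoord n \<omega> j = (\<Sum>k<n. e j (Vs (Suc k) \<omega>)) / sqrt n"

lemma var_nonneg: "var j \<ge> 0" by (simp add: var_def)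

lemma gcoord_measurable [measurable]: "(\<lambda>\<omega>. gcoord \<omega> j) \<in> borel_measurable gauss_seq"
  unfolding gcoord_def by measurable

lemma gcoord_sq: "integrable gauss_seq (\<lambda>\<omega>. (gcoord \<omega> j)\<^sup>2)" "(\<integral>\<omega>. (gcoord \<omega> j)\<^sup>2 \<partial>gauss_seq) = var j"
  unfolding gcoord_def power_mult_distrib by (simp_all add: gauss_seq_moment2 var_nonneg)

lemma ecoord_measurable [measurable]: "(\<lambda>\<omega>. ecoord n \<omega> j) \<in> borel_measurable N"
  unfolding ecoord_def using measurable_transfer[OF e_meas] by measurable

text \<open>An inequality rather than an equality because of \<open>n = 0\<close>, where division by
  \<open>sqrt 0\<close> gives \<open>0\<close>.\<close>

lemma ecoord_sq:
  "integrable N (\<lambda>\<omega>. (ecoord n \<omega> j)\<^sup>2)" "(\<integral>\<omega>. (ecoord n \<omega> j)\<^sup>2 \<partial>N) \<le> var j"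
proof -
  have [measurable]: "(\<lambda>\<omega>. e j (Vs (Suc k) \<omega>)) \<in> borel_measurable N" for k
    by (rule measurable_transfer) simp
  have int: "integrable N (\<lambda>\<omega>. (e j (Vs (Suc k) \<omega>))\<^sup>2)" for k
    using e_sq_integrable integral_transfer(2)[of "\<lambda>x. (e j x)\<^sup>2" "Suc k"] by simp
  have "integrable N (\<lambda>\<omega>. (\<Sum>k<n. e j (Vs (Suc k) \<omega>))\<^sup>2)"
    using integrable_norm_sum_power2[of "{..<n}" "\<lambda>k \<omega>. e j (Vs (Suc k) \<omega>)" N] int by simp
  then show "integrable N (\<lambda>\<omega>. (ecoord n \<omega> j)\<^sup>2)" by (simp add: ecoord_def power_divide)
  have "(\<integral>\<omega>. (\<Sum>k<n. e j (Vs (Suc k) \<omega>))\<^sup>2 \<partial>N) = (\<Sum>k<n. \<integral>\<omega>. (e j (Vs (Suc k) \<omega>))\<^sup>2 \<partial>N)"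
    by (rule N.expectation_power2_sum_indep[OF indep_transfer[OF e_meas] _ int])
       (simp add: integral_transfer(1)[OF e_meas] e_mean)
  also have "\<dots> = n * var j"
    using integral_transfer(1)[of "\<lambda>x. (e j x)\<^sup>2"] by (simp add: var_def)
  finally show "(\<integral>\<omega>. (ecoord n \<omega> j)\<^sup>2 \<partial>N) \<le> var j"
    by (cases "n = 0") (auto simp: ecoord_def power_divide var_nonneg)
qed

text \<open>The Cramer-Wold reduction: a linear combination of the \<open>e j\<close> is a single
  real function \<open>\<psi>\<close>, and orthogonality leaves only diagonal terms in its variance,
  which is what independent Gaussian coordinates produce.\<close>

lemma ecoord_char:
  "(\<lambda>n. \<integral>\<omega>. iexp (\<Sum>j<J. t j * ecoord n \<omega> j) \<partial>N) \<longlonglongrightarrow> (\<integral>\<omega>. iexp (\<Sum>j<J. t j * gcoord \<omega> j) \<partial>gauss_seq)"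
proof -
  define \<psi> where "\<psi> x = (\<Sum>j<J. t j * e j x)" for x
  have [measurable]: "\<psi> \<in> borel_measurable \<mu>" unfolding \<psi>_def by measurable
  have sq_eq: "(\<psi> x)\<^sup>2 = (\<Sum>i<J. \<Sum>j<J. (t i * t j) * (e i x * e j x))" for x
    unfolding \<psi>_def power2_eq_square sum_product by (intro sum.cong refl) (simp add: algebra_simps)
  have sq: "integrable \<mu> (\<lambda>x. (\<psi> x)\<^sup>2)" unfolding sq_eq using e_mult_integrable by simp
  have "(\<integral>x. (\<psi> x)\<^sup>2 \<partial>\<mu>) = (\<Sum>i<J. \<Sum>j<J. (t i * t j) * (\<integral>x. e i x * e j x \<partial>\<mu>))"
    unfolding sq_eq using e_mult_integrable by simp
  also have "\<dots> = (\<Sum>i<J. \<Sum>j<J. if j = i then (t i)\<^sup>2 * var i else 0)"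
    by (intro sum.cong refl) (auto simp: e_ortho var_def power2_eq_square)
  also have "\<dots> = (\<Sum>i<J. (t i)\<^sup>2 * var i)" by simp
  finally have v: "(\<integral>x. (\<psi> x)\<^sup>2 \<partial>\<mu>) = (\<Sum>i<J. (t i)\<^sup>2 * var i)" .
  have mean: "(\<integral>x. \<psi> x \<partial>\<mu>) = 0" unfolding \<psi>_def using e_integrable by (simp add: e_mean)
  \<comment> \<open>The frequencies \<open>t j\<close> are already part of \<open>\<psi>\<close>,
    hence the argument \<open>1\<close>.\<close>
  have "(\<lambda>n. \<integral>\<omega>. iexp (1 * ((\<Sum>k<n. \<psi> (Vs (Suc k) \<omega>)) / sqrt n)) \<partial>N)
    \<longlonglongrightarrow> complex_of_real (exp (- (1\<^sup>2 * (\<Sum>i<J. (t i)\<^sup>2 * var i)) / 2))"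
  proof (rule N.central_limit_char)
    show "distr N borel (\<lambda>\<omega>. \<psi> (Vs (Suc k) \<omega>)) = distr \<mu> borel \<psi>" for k by (rule distr_transfer) simp
  qed (use sq v mean integral_transfer[of \<psi>] integral_transfer[of "\<lambda>x. (\<psi> x)\<^sup>2"] in \<open>auto intro: indep_transfer\<close>)
  also have "(\<lambda>n. \<integral>\<omega>. iexp (1 * ((\<Sum>k<n. \<psi> (Vs (Suc k) \<omega>)) / sqrt n)) \<partial>N)
    = (\<lambda>n. \<integral>\<omega>. iexp (\<Sum>j<J. t j * ecoord n \<omega> j) \<partial>N)"
  proof -
    have "(\<Sum>k<n. \<psi> (Vs (Suc k) \<omega>)) / sqrt n = (\<Sum>j<J. t j * ecoord n \<omega> j)" for n \<omega>
      unfolding \<psi>_def ecoord_def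
      by (subst sum.swap) (simp add: sum_divide_distrib sum_distrib_left)
    then show ?thesis by simp
  qed
  also have "complex_of_real (exp (- (1\<^sup>2 * (\<Sum>i<J. (t i)\<^sup>2 * var i)) / 2))
    = (\<integral>\<omega>. iexp (\<Sum>j<J. t j * gcoord \<omega> j) \<partial>gauss_seq)"
    using gauss_seq_char[where J = J and c = "\<lambda>j. t j * sqrt (var j)"]
    by (simp add: gcoord_def mult.assoc power_mult_distrib var_nonneg)
  finally show ?thesis .
qed

lemma ecoord_tendsto:
  assumes "lipschitz_coords J L H" "L \<ge> 0" "\<And>x. \<bar>H x\<bar> \<le> B"
  shows "(\<lambda>n. \<integral>\<omega>. H (ecoord n \<omega>) \<partial>N) \<longlonglongrightarrow> (\<integral>\<omega>. H (gcoord \<omega>) \<partial>gauss_seq)"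
proof (rule lipschitz_coords_tendsto[OF N.prob_space_axioms gauss.prob_space_axioms assms])
  have "var j \<le> (\<Sum>j<J. var j)" if "j < J" for j
    using that by (intro member_le_sum) (auto simp: var_nonneg)
  then show "\<And>n j. j < J \<Longrightarrow> (\<integral>\<omega>. (ecoord n \<omega> j)\<^sup>2 \<partial>N) \<le> (\<Sum>j<J. var j)"
    "\<And>j. j < J \<Longrightarrow> (\<integral>\<omega>. (gcoord \<omega> j)\<^sup>2 \<partial>gauss_seq) \<le> (\<Sum>j<J. var j)"
    using order_trans[OF ecoord_sq(2)] by (auto simp: gcoord_sq)
qed (rule ecoord_measurable gcoord_measurable ecoord_sq gcoord_sq ecoord_char)+

lemma lincomb_e_sq_integrable:
  fixes c :: "nat \<Rightarrow> 'b"
  shows "integrable \<mu> (\<lambda>x. (norm (lincomb J c (\<lambda>j. e j x)))\<^sup>2)"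
  by (rule integrable_norm_lincomb_power2) (auto intro: e_sq_integrable)

lemma lincomb_e_mean:
  fixes c :: "nat \<Rightarrow> 'b"
  shows "(\<integral>x. lincomb J c (\<lambda>j. e j x) \<partial>\<mu>) = 0"
  unfolding lincomb_def using e_integrable by (simp add: e_mean)

lemma lincomb_ecoord:
  "lincomb J c (ecoord n \<omega>) = (1 / sqrt n) *\<^sub>R (\<Sum>k<n. lincomb J c (\<lambda>j. e j (Vs (Suc k) \<omega>)))"
  unfolding lincomb_def ecoord_def
  by (subst sum.swap) (simp add: scaleR_sum_right scaleR_sum_left[symmetric] divide_inverse mult.commute)

text \<open>The type 2 inequality passes to the limit of the normalized sums of \<open>lincomb J c e\<close>.\<close>

lemma lincomb_gcoord_bound:
  fixes c :: "nat \<Rightarrow> 'b"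
  shows "integrable gauss_seq (\<lambda>\<omega>. norm (lincomb J c (gcoord \<omega>)))"
  "(\<integral>\<omega>. norm (lincomb J c (gcoord \<omega>)) \<partial>gauss_seq) \<le> sqrt (4 * C * (\<integral>x. (norm (lincomb J c (\<lambda>j. e j x)))\<^sup>2 \<partial>\<mu>))"
proof -
  let ?b = "sqrt (4 * C * (\<integral>x. (norm (lincomb J c (\<lambda>j. e j x)))\<^sup>2 \<partial>\<mu>))"
  have sq_int: "integrable gauss_seq (\<lambda>\<omega>. (norm (lincomb J c (gcoord \<omega>)))\<^sup>2)"
    by (rule integrable_norm_lincomb_power2) (auto intro: gcoord_sq)
  show int: "integrable gauss_seq (\<lambda>\<omega>. norm (lincomb J c (gcoord \<omega>)))"
    by (rule integrable_norm, rule gauss.square_integrable_norm_imp_integrable[OF _ sq_int]) measurable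
  \<comment> \<open>Truncation makes the test function bounded, as the convergence theorem requires;
    it is removed afterwards by dominated convergence in \<open>i\<close>.\<close>
  have trunc: "(\<integral>\<omega>. min (norm (lincomb J c (gcoord \<omega>))) (real i) \<partial>gauss_seq) \<le> ?b" for i :: nat
  proof (rule LIMSEQ_le_const2)
    show "(\<lambda>n. \<integral>\<omega>. min (norm (lincomb J c (ecoord n \<omega>))) (real i) \<partial>N)
      \<longlonglongrightarrow> (\<integral>\<omega>. min (norm (lincomb J c (gcoord \<omega>))) (real i) \<partial>gauss_seq)"
    proof (rule ecoord_tendsto[where B = "real i"])
      show "lipschitz_coords J (\<Sum>j<J. norm (c j)) (\<lambda>y. min (norm (lincomb J c y)) (real i))"
        unfolding lipschitz_coords_def
      proof (intro allI)
        fix x y :: "nat \<Rightarrow> real"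
        have "\<bar>min (norm (lincomb J c x)) (real i) - min (norm (lincomb J c y)) (real i)\<bar>
          \<le> \<bar>norm (lincomb J c x) - norm (lincomb J c y)\<bar>" by linarith
        also have "\<dots> \<le> norm (lincomb J c x - lincomb J c y)" by (rule norm_triangle_ineq3)
        also note norm_lincomb_diff_le
        finally show "\<bar>min (norm (lincomb J c x)) (real i) - min (norm (lincomb J c y)) (real i)\<bar>
          \<le> (\<Sum>j<J. norm (c j)) * (\<Sum>j<J. \<bar>x j - y j\<bar>)" .
      qed
    qed (auto intro: sum_nonneg)
    have "(\<integral>\<omega>. min (norm (lincomb J c (ecoord n \<omega>))) (real i) \<partial>N) \<le> ?b" for n
    proof -
      note t2 = type_2_bound[of "\<lambda>x. lincomb J c (\<lambda>j. e j x)" n, OF _ lincomb_e_sq_integrable lincomb_e_mean]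
      have i: "integrable N (\<lambda>\<omega>. norm (lincomb J c (ecoord n \<omega>)))"
        unfolding lincomb_ecoord by (rule t2(2)) measurable
      have "(\<integral>\<omega>. min (norm (lincomb J c (ecoord n \<omega>))) (real i) \<partial>N) \<le> (\<integral>\<omega>. norm (lincomb J c (ecoord n \<omega>)) \<partial>N)"
      proof (rule integral_mono)
        show "integrable N (\<lambda>\<omega>. min (norm (lincomb J c (ecoord n \<omega>))) (real i))"
          by (rule N.integrable_const_bound[where B = "real i"]) auto
      qed (use i in auto)
      also have "\<dots> \<le> ?b" unfolding lincomb_ecoord by (rule t2(1)) measurable
      finally show ?thesis .
    qed
    then show "\<exists>n0. \<forall>n\<ge>n0. (\<integral>\<omega>. min (norm (lincomb J c (ecoord n \<omega>))) (real i) \<partial>N) \<le> ?b" by blast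
  qed
  show "(\<integral>\<omega>. norm (lincomb J c (gcoord \<omega>)) \<partial>gauss_seq) \<le> ?b"
  proof (rule LIMSEQ_le_const2)
    show "(\<lambda>i. \<integral>\<omega>. min (norm (lincomb J c (gcoord \<omega>))) (real i) \<partial>gauss_seq)
      \<longlonglongrightarrow> (\<integral>\<omega>. norm (lincomb J c (gcoord \<omega>)) \<partial>gauss_seq)"
    proof (rule integral_dominated_convergence[OF _ _ int])
      show "AE \<omega> in gauss_seq. (\<lambda>i. min (norm (lincomb J c (gcoord \<omega>))) (real i)) \<longlonglongrightarrow> norm (lincomb J c (gcoord \<omega>))"
      proof (rule AE_I2)
        fix \<omega>
        have "\<forall>\<^sub>F i in sequentially. min (norm (lincomb J c (gcoord \<omega>))) (real i) = norm (lincomb J c (gcoord \<omega>))"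
          using eventually_ge_at_top[of "nat \<lceil>norm (lincomb J c (gcoord \<omega>))\<rceil>"]
          by eventually_elim linarith
        then show "(\<lambda>i. min (norm (lincomb J c (gcoord \<omega>))) (real i)) \<longlonglongrightarrow> norm (lincomb J c (gcoord \<omega>))"
          by (rule tendsto_eventually)
      qed
    qed auto
  qed (use trunc in blast)
qed

text \<open>The rate \<open>(1 / 16) ^ k\<close> for squares makes the distances themselves
  geometric with ratio \<open>1 / 4\<close>, hence summable. Trailing zeros permit one length
  \<open>J k\<close> for all coordinates, namely the sum of the individual lengths.\<close>

lemma lincomb_approx:
  obtains J c where
    "\<And>k s j. s \<in> S \<Longrightarrow> j \<ge> J k \<Longrightarrow> c k s j = 0"
    "\<And>k s. s \<in> S \<Longrightarrow> (\<integral>x. (norm (x s - mean_vec s - lincomb (J k) (c k s) (\<lambda>j. e j x)))\<^sup>2 \<partial>\<mu>) \<le> (1 / 16) ^ k"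
proof -
  define approx where "approx s k p \<longleftrightarrow> (\<forall>j\<ge>fst p. snd p j = 0) \<and>
      (\<forall>J\<ge>fst p. (\<integral>x. (norm (x s - mean_vec s - lincomb J (snd p) (\<lambda>j. e j x)))\<^sup>2 \<partial>\<mu>) \<le> (1 / 16) ^ k)" for s k p
  have "\<exists>p. approx s k p" if s: "s \<in> S" for s k
  proof -
    obtain \<phi> where \<phi>: "finite_rank e \<phi>" "(\<integral>x. (norm (x s - mean_vec s - \<phi> x))\<^sup>2 \<partial>\<mu>) \<le> (1 / 16) ^ k"
      using e_dense[OF s, of "(1 / 16) ^ k"] by auto
    obtain J0 c where c: "\<forall>j\<ge>J0. c j = 0" "\<forall>x\<in>pow_space S. \<forall>J\<ge>J0. \<phi> x = (\<Sum>j<J. e j x *\<^sub>R c j)"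
      using \<phi>(1) unfolding finite_rank_def by (elim exE conjE)
    have "(\<integral>x. (norm (x s - mean_vec s - lincomb J c (\<lambda>j. e j x)))\<^sup>2 \<partial>\<mu>) \<le> (1 / 16) ^ k" if "J \<ge> J0" for J
    proof -
      have "(\<integral>x. (norm (x s - mean_vec s - lincomb J c (\<lambda>j. e j x)))\<^sup>2 \<partial>\<mu>)
        = (\<integral>x. (norm (x s - mean_vec s - \<phi> x))\<^sup>2 \<partial>\<mu>)"
        using c(2)[rule_format, OF _ that] by (intro Bochner_Integration.integral_cong) (auto simp: lincomb_def)
      with \<phi>(2) show ?thesis by simp
    qed
    with c(1) have "approx s k (J0, c)" by (simp add: approx_def)
    then show ?thesis ..
  qed
  note ex = this
  define p where "p s k = (SOME p. approx s k p)" for s k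
  have p: "approx s k (p s k)" if "s \<in> S" for s k
    unfolding p_def by (rule someI_ex[OF ex[OF that]])
  define J0 c where "J0 s k = fst (p s k)" and "c s k = snd (p s k)" for s k
  have c: "c s k j = 0" if "s \<in> S" "j \<ge> J0 s k" for s k j
    using p[OF that(1)] that(2) by (simp add: approx_def J0_def c_def)
  have J0: "(\<integral>x. (norm (x s - mean_vec s - lincomb J (c s k) (\<lambda>j. e j x)))\<^sup>2 \<partial>\<mu>) \<le> (1 / 16) ^ k"
    if "s \<in> S" "J \<ge> J0 s k" for s k J
    using p[OF that(1)] that(2) by (simp add: approx_def J0_def c_def)
  have le: "J0 s k \<le> (\<Sum>s\<in>S. J0 s k)" if "s \<in> S" for s k
    using fin that by (intro member_le_sum) auto
  show ?thesis
    by (rule that[of "\<lambda>k. \<Sum>s\<in>S. J0 s k" "\<lambda>k s. c s k"])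
       (rule c J0; use le order_trans in blast)+
qed

end

section \<open>The Gaussian limit\<close>

context pow_clt begin

lemma measurable_normalized_sum [measurable]: "normalized_sum S Vs m n \<in> measurable N (pow_borel S)"
  unfolding normalized_sum_def[abs_def]
proof (rule measurable_pow_borel_restrict[OF fin])
  fix s assume "s \<in> S"
  then have [measurable]: "(\<lambda>\<omega>. Vs k \<omega> s) \<in> borel_measurable N" for k
    by (rule measurable_pow_borel_component[OF fin measurable_Vs])
  show "(\<lambda>\<omega>. sqrt (real n) *\<^sub>R ((1 / real n) *\<^sub>R (\<Sum>k = 1..n. Vs k \<omega> s) - m s)) \<in> borel_measurable N"
    by measurable
qed

text \<open>Moves the mean into the sum, so that centered summands appear, and the range from
  \<open>1..n\<close> to \<open>k < n\<close>. For \<open>n = 0\<close> both scaling factors are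
  \<open>0\<close>.\<close>

lemma normalized_sum_component:
  assumes "s \<in> S"
  shows "normalized_sum S Vs m n \<omega> s = (1 / sqrt n) *\<^sub>R (\<Sum>k<n. Vs (Suc k) \<omega> s - m s)"
proof (cases "n = 0")
  case False
  have "sqrt n * (1 / n) = 1 / sqrt n" using False by (simp add: real_div_sqrt field_simps)
  moreover have "sqrt n = (1 / sqrt n) * n" using False by (simp add: real_div_sqrt field_simps)
  ultimately have "sqrt n *\<^sub>R ((1 / n) *\<^sub>R (\<Sum>k<n. Vs (Suc k) \<omega> s) - m s)
    = (1 / sqrt n) *\<^sub>R (\<Sum>k<n. Vs (Suc k) \<omega> s) - ((1 / sqrt n) * n) *\<^sub>R m s"
    by (simp only: scaleR_diff_right scaleR_scaleR)
  also have "\<dots> = (1 / sqrt n) *\<^sub>R ((\<Sum>k<n. Vs (Suc k) \<omega> s) - n *\<^sub>R m s)"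
    by (simp only: scaleR_diff_right scaleR_scaleR)
  also have "\<dots> = (1 / sqrt n) *\<^sub>R (\<Sum>k<n. Vs (Suc k) \<omega> s - m s)"
    by (simp add: sum_subtractf scaleR_conv_of_real sum_constant_scaleR)
  finally show ?thesis
    using assms by (simp add: normalized_sum_def sum.atLeast1_atMost_eq)
qed (use assms in \<open>simp add: normalized_sum_def\<close>)

end

context pow_clt_system begin

text \<open>An exchange of limits: for each rank \<open>k\<close> the limit in \<open>n\<close> is
  Gaussian, and the error of replacing the full sum by rank \<open>k\<close> is bounded uniformly in
  \<open>n\<close>.\<close>

lemma lipschitz_limit:
  obtains G where "G \<in> measurable gauss_seq (pow_borel S)"
    "\<And>h L B. lipschitz_pow S L h \<Longrightarrow> L \<ge> 0 \<Longrightarrow> (\<And>x. x \<in> pow_space S \<Longrightarrow> \<bar>h x\<bar> \<le> B) \<Longrightarrow>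
      (\<lambda>n. \<integral>\<omega>. h (normalized_sum S Vs (restrict mean_vec S) n \<omega>) \<partial>N) \<longlonglongrightarrow> (\<integral>\<omega>. h (G \<omega>) \<partial>gauss_seq)"
proof -
  obtain J c where c0: "\<And>k s j. s \<in> S \<Longrightarrow> j \<ge> J k \<Longrightarrow> c k s j = 0"
    and c: "\<And>k s. s \<in> S \<Longrightarrow> (\<integral>x. (norm (x s - mean_vec s - lincomb (J k) (c k s) (\<lambda>j. e j x)))\<^sup>2 \<partial>\<mu>) \<le> (1 / 16) ^ k"
    by (rule lincomb_approx, rule that)
  define F where "F k s x = lincomb (J k) (c k s) (\<lambda>j. e j x)" for k s x
  define \<phi> where "\<phi> k s x = x s - mean_vec s - F k s x" for k s x
  define Gk where "Gk k s \<omega> = lincomb (J k) (c k s) (gcoord \<omega>)" for k s \<omega>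
  have F_meas [measurable]: "F k s \<in> borel_measurable \<mu>" for k s unfolding F_def by measurable
  have Gk_meas [measurable]: "Gk k s \<in> borel_measurable gauss_seq" for k s unfolding Gk_def by measurable
  have \<phi>_meas [measurable]: "\<phi> k s \<in> borel_measurable \<mu>" if "s \<in> S" for k s
    using that unfolding \<phi>_def by measurable
  have F_sq: "integrable \<mu> (\<lambda>x. (norm (F k s x))\<^sup>2)" for k s
    unfolding F_def by (rule lincomb_e_sq_integrable)
  have \<phi>_sq: "integrable \<mu> (\<lambda>x. (norm (\<phi> k s x))\<^sup>2)" if s: "s \<in> S" for k s
  proof -
    have "integrable \<mu> (\<lambda>x. (norm (x s + (- mean_vec s)))\<^sup>2)"
      by (rule integrable_norm_add_power2) (use s in \<open>auto intro: sq\<close>)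
    then have "integrable \<mu> (\<lambda>x. (norm ((x s + (- mean_vec s)) + (- F k s x)))\<^sup>2)"
      by (rule integrable_norm_add_power2[rotated 2]) (use s F_sq in auto)
    then show ?thesis by (simp add: \<phi>_def)
  qed
  have \<phi>_mean: "(\<integral>x. \<phi> k s x \<partial>\<mu>) = 0" if s: "s \<in> S" for k s
  proof -
    have "integrable \<mu> (F k s)" by (rule \<mu>.square_integrable_norm_imp_integrable[OF F_meas F_sq])
    then show ?thesis
      unfolding \<phi>_def using integrable_coord[OF s] lincomb_e_mean[of "J k" "c k s"]
      by (simp add: mean_vec_def F_def[abs_def])
  qed
  have c': "(\<integral>x. (norm (\<phi> k s x))\<^sup>2 \<partial>\<mu>) \<le> (1 / 16) ^ k" if "s \<in> S" for k s
    using c[OF that] by (simp add: \<phi>_def F_def)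
  have sqrt16: "sqrt ((1 / 16) ^ k) = (1 / 4) ^ k" for k
    by (simp add: real_sqrt_power real_sqrt_divide)
  have incr: "integrable gauss_seq (\<lambda>\<omega>. norm (Gk (Suc k) s \<omega> - Gk k s \<omega>))"
      "(\<integral>\<omega>. norm (Gk (Suc k) s \<omega> - Gk k s \<omega>) \<partial>gauss_seq) \<le> 4 * sqrt C * (1 / 4) ^ k" if s: "s \<in> S" for k s
  proof -
    \<comment> \<open>On a common length the difference of two successive approximations is again a
      single combination, to which the Gaussian bound applies.\<close>
    define J' where "J' = max (J k) (J (Suc k))"
    define d where "d j = c (Suc k) s j - c k s j" for j
    have ext: "lincomb (J (Suc k)) (c (Suc k) s) y - lincomb (J k) (c k s) y = lincomb J' d y" for y
      unfolding d_def lincomb_diff[symmetric]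
      using lincomb_extend[of "J k" J' "c k s" y] lincomb_extend[of "J (Suc k)" J' "c (Suc k) s" y] c0[OF s]
      by (simp add: J'_def)
    have "(\<integral>x. (norm (lincomb J' d (\<lambda>j. e j x)))\<^sup>2 \<partial>\<mu>) = (\<integral>x. (norm (\<phi> k s x - \<phi> (Suc k) s x))\<^sup>2 \<partial>\<mu>)"
      unfolding ext[symmetric] by (simp add: \<phi>_def F_def)
    also have "\<dots> \<le> (\<integral>x. 2 * (norm (\<phi> k s x))\<^sup>2 + 2 * (norm (\<phi> (Suc k) s x))\<^sup>2 \<partial>\<mu>)"
    proof (rule integral_mono)
      have "integrable \<mu> (\<lambda>x. (norm (\<phi> k s x + (- \<phi> (Suc k) s x)))\<^sup>2)"
        by (rule integrable_norm_add_power2) (use s \<phi>_sq in auto)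
      then show "integrable \<mu> (\<lambda>x. (norm (\<phi> k s x - \<phi> (Suc k) s x))\<^sup>2)" by simp
    qed (use \<phi>_sq[OF s] in \<open>auto intro: norm_diff_power2_le\<close>)
    also have "\<dots> = 2 * (\<integral>x. (norm (\<phi> k s x))\<^sup>2 \<partial>\<mu>) + 2 * (\<integral>x. (norm (\<phi> (Suc k) s x))\<^sup>2 \<partial>\<mu>)"
      using \<phi>_sq[OF s] by simp
    also have "\<dots> \<le> 2 * (1 / 16) ^ k + 2 * (1 / 16) ^ Suc k"
      using c'[OF s, of k] c'[OF s, of "Suc k"] by linarith
    also have "\<dots> \<le> 4 * (1 / 16) ^ k" by simp
    finally have le: "(\<integral>x. (norm (lincomb J' d (\<lambda>j. e j x)))\<^sup>2 \<partial>\<mu>) \<le> 4 * (1 / 16) ^ k" .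
    show "integrable gauss_seq (\<lambda>\<omega>. norm (Gk (Suc k) s \<omega> - Gk k s \<omega>))"
      unfolding Gk_def ext by (rule lincomb_gcoord_bound)
    have "(\<integral>\<omega>. norm (Gk (Suc k) s \<omega> - Gk k s \<omega>) \<partial>gauss_seq)
      \<le> sqrt (4 * C * (\<integral>x. (norm (lincomb J' d (\<lambda>j. e j x)))\<^sup>2 \<partial>\<mu>))"
      unfolding Gk_def ext by (rule lincomb_gcoord_bound)
    \<comment> \<open>One factor \<open>4\<close> comes from the type 2 inequality, the other from
      the distance of two approximations; together they give \<open>4 * sqrt C\<close>.\<close>
    also have "\<dots> \<le> sqrt (4 * C * (4 * (1 / 16) ^ k))"
      using le C_nonneg by (intro real_sqrt_le_mono mult_left_mono) auto
    also have "\<dots> = 4 * sqrt C * (1 / 4) ^ k"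
      unfolding real_sqrt_mult sqrt16 by simp
    finally show "(\<integral>\<omega>. norm (Gk (Suc k) s \<omega> - Gk k s \<omega>) \<partial>gauss_seq) \<le> 4 * sqrt C * (1 / 4) ^ k" .
  qed
  \<comment> \<open>Where the sequence diverges, \<open>lim\<close> takes a default value;
    measurability is unaffected and the exceptional set turns out to be null.\<close>
  define G where "G \<omega> = (\<lambda>s\<in>S. lim (\<lambda>k. Gk k s \<omega>))" for \<omega>
  have G_meas: "G \<in> measurable gauss_seq (pow_borel S)"
    unfolding G_def by (rule measurable_pow_borel_restrict[OF fin]) measurable
  have "AE \<omega> in gauss_seq. \<forall>s\<in>S. convergent (\<lambda>k. Gk k s \<omega>)"
  proof (rule AE_finite_allI[OF fin])
    fix s assume s: "s \<in> S"
    show "AE \<omega> in gauss_seq. convergent (\<lambda>k. Gk k s \<omega>)"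
      by (rule AE_convergent_of_summable_increments[where u = "\<lambda>k. Gk k s"
            and a = "\<lambda>k. 4 * sqrt C * (1 / 4) ^ k", OF Gk_meas incr[OF s]])
         (intro summable_mult summable_geometric, simp)
  qed
  then have conv: "AE \<omega> in gauss_seq. \<forall>s\<in>S. (\<lambda>k. Gk k s \<omega>) \<longlonglongrightarrow> G \<omega> s"
    by eventually_elim (simp add: G_def convergent_LIMSEQ_iff)
  show ?thesis
  proof (rule that[OF G_meas])
    fix h :: "('a \<Rightarrow> 'b) \<Rightarrow> real" and L B
    assume h: "lipschitz_pow S L h" and L: "L \<ge> 0" and B: "\<And>x. x \<in> pow_space S \<Longrightarrow> \<bar>h x\<bar> \<le> B"
    define Z where "Z n = normalized_sum S Vs (restrict mean_vec S) n" for n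
    define Zk where "Zk k n \<omega> = (\<lambda>s\<in>S. lincomb (J k) (c k s) (ecoord n \<omega>))" for k n \<omega>
    have Z_meas: "Z n \<in> measurable N (pow_borel S)" for n unfolding Z_def by (rule measurable_normalized_sum)
    have Zk_meas: "Zk k n \<in> measurable N (pow_borel S)" for k n
      unfolding Zk_def by (rule measurable_pow_borel_restrict[OF fin]) measurable
    have Gk_meas': "(\<lambda>\<omega>. \<lambda>s\<in>S. Gk k s \<omega>) \<in> measurable gauss_seq (pow_borel S)" for k
      by (rule measurable_pow_borel_restrict[OF fin]) measurable
    have h_meas: "h \<in> borel_measurable (pow_borel S)"
      by (rule continuous_map_measurable_pow_borel[OF fin lipschitz_pow_continuous[OF fin h]])
    note hm = measurable_compose[OF _ h_meas]
    \<comment> \<open>The remainders \<open>\<phi> k s\<close> are centered, so type 2 controls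
      their normalized sums independently of \<open>n\<close>.\<close>
    have bound: "\<bar>(\<integral>\<omega>. h (Z n \<omega>) \<partial>N) - (\<integral>\<omega>. h (Zk k n \<omega>) \<partial>N)\<bar> \<le> L * (card S * (2 * sqrt C * (1 / 4) ^ k))" for n k
    proof -
      have sp: "Z n \<omega> \<in> pow_space S" "Zk k n \<omega> \<in> pow_space S" for \<omega>
        by (simp_all add: Z_def Zk_def normalized_sum_def)
      have int: "integrable N (\<lambda>\<omega>. h (Z n \<omega>))" "integrable N (\<lambda>\<omega>. h (Zk k n \<omega>))"
        using B[OF sp(1)] B[OF sp(2)] hm[OF Z_meas] hm[OF Zk_meas]
        by (auto intro!: N.integrable_const_bound[where B = B])
      have comp: "Z n \<omega> s - Zk k n \<omega> s = (1 / sqrt n) *\<^sub>R (\<Sum>i<n. \<phi> k s (Vs (Suc i) \<omega>))" if "s \<in> S" for s \<omega>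
        using that by (simp add: Z_def Zk_def normalized_sum_component lincomb_ecoord \<phi>_def F_def
            sum_subtractf scaleR_diff_right)
      have t2: "integrable N (\<lambda>\<omega>. norm (Z n \<omega> s - Zk k n \<omega> s))"
        "(\<integral>\<omega>. norm (Z n \<omega> s - Zk k n \<omega> s) \<partial>N) \<le> 2 * sqrt C * (1 / 4) ^ k" if s: "s \<in> S" for s
      proof -
        note t = type_2_bound[OF \<phi>_meas[OF s] \<phi>_sq[OF s] \<phi>_mean[OF s], of n k]
        show "integrable N (\<lambda>\<omega>. norm (Z n \<omega> s - Zk k n \<omega> s))"
          unfolding comp[OF s] by (rule t(2))
        have "(\<integral>\<omega>. norm (Z n \<omega> s - Zk k n \<omega> s) \<partial>N) \<le> sqrt (4 * C * (\<integral>x. (norm (\<phi> k s x))\<^sup>2 \<partial>\<mu>))"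
          unfolding comp[OF s] by (rule t(1))
        also have "\<dots> \<le> sqrt (4 * C * (1 / 16) ^ k)"
          using c'[OF s] C_nonneg by (intro real_sqrt_le_mono mult_left_mono) auto
        also have "\<dots> = 2 * sqrt C * (1 / 4) ^ k"
          unfolding real_sqrt_mult sqrt16 by simp
        finally show "(\<integral>\<omega>. norm (Z n \<omega> s - Zk k n \<omega> s) \<partial>N) \<le> 2 * sqrt C * (1 / 4) ^ k" .
      qed
      have "\<bar>(\<integral>\<omega>. h (Z n \<omega>) \<partial>N) - (\<integral>\<omega>. h (Zk k n \<omega>) \<partial>N)\<bar> = \<bar>\<integral>\<omega>. h (Z n \<omega>) - h (Zk k n \<omega>) \<partial>N\<bar>"
        using int by simp
      also have "\<dots> \<le> (\<integral>\<omega>. \<bar>h (Z n \<omega>) - h (Zk k n \<omega>)\<bar> \<partial>N)"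
        using integral_norm_bound[of N "\<lambda>\<omega>. h (Z n \<omega>) - h (Zk k n \<omega>)"] by simp
      also have "\<dots> \<le> (\<integral>\<omega>. L * (\<Sum>s\<in>S. norm (Z n \<omega> s - Zk k n \<omega> s)) \<partial>N)"
      proof (rule integral_mono)
        show "\<bar>h (Z n \<omega>) - h (Zk k n \<omega>)\<bar> \<le> L * (\<Sum>s\<in>S. norm (Z n \<omega> s - Zk k n \<omega> s))" for \<omega>
          using h sp unfolding lipschitz_pow_def pow_dist_alt by blast
        show "integrable N (\<lambda>\<omega>. L * (\<Sum>s\<in>S. norm (Z n \<omega> s - Zk k n \<omega> s)))"
          by (intro integrable_mult_right Bochner_Integration.integrable_sum t2)
      qed (use int in auto)
      also have "\<dots> = L * (\<Sum>s\<in>S. \<integral>\<omega>. norm (Z n \<omega> s - Zk k n \<omega> s) \<partial>N)"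
        using t2(1) by (subst integral_mult_right_zero, subst Bochner_Integration.integral_sum) auto
      also have "\<dots> \<le> L * (\<Sum>s\<in>S. 2 * sqrt C * (1 / 4) ^ k)"
        by (intro mult_left_mono[OF _ L] sum_mono t2)
      finally show ?thesis by simp
    qed
    have fd: "(\<lambda>n. \<integral>\<omega>. h (Zk k n \<omega>) \<partial>N) \<longlonglongrightarrow> (\<integral>\<omega>. h (\<lambda>s\<in>S. Gk k s \<omega>) \<partial>gauss_seq)" for k
    proof -
      have "(\<lambda>n. \<integral>\<omega>. h (\<lambda>s\<in>S. lincomb (J k) (c k s) (ecoord n \<omega>)) \<partial>N)
        \<longlonglongrightarrow> (\<integral>\<omega>. h (\<lambda>s\<in>S. lincomb (J k) (c k s) (gcoord \<omega>)) \<partial>gauss_seq)"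
      proof (rule ecoord_tendsto[where B = B])
        show "lipschitz_coords (J k) (L * (\<Sum>s\<in>S. \<Sum>j<J k. norm (c k s j)))
          (\<lambda>y. h (\<lambda>s\<in>S. lincomb (J k) (c k s) y))"
          unfolding lipschitz_coords_def
        proof (intro allI)
          fix y y' :: "nat \<Rightarrow> real"
          have "\<bar>h (\<lambda>s\<in>S. lincomb (J k) (c k s) y) - h (\<lambda>s\<in>S. lincomb (J k) (c k s) y')\<bar>
            \<le> L * pow_dist S (\<lambda>s\<in>S. lincomb (J k) (c k s) y) (\<lambda>s\<in>S. lincomb (J k) (c k s) y')"
            using h unfolding lipschitz_pow_def by simp
          also have "\<dots> \<le> L * (\<Sum>s\<in>S. (\<Sum>j<J k. norm (c k s j)) * (\<Sum>j<J k. \<bar>y j - y' j\<bar>))"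
            unfolding pow_dist_alt using norm_lincomb_diff_le by (intro mult_left_mono[OF _ L] sum_mono) simp
          finally show "\<bar>h (\<lambda>s\<in>S. lincomb (J k) (c k s) y) - h (\<lambda>s\<in>S. lincomb (J k) (c k s) y')\<bar>
            \<le> L * (\<Sum>s\<in>S. \<Sum>j<J k. norm (c k s j)) * (\<Sum>j<J k. \<bar>y j - y' j\<bar>)"
            unfolding sum_distrib_right[symmetric] mult.assoc .
        qed
        show "\<bar>h (\<lambda>s\<in>S. lincomb (J k) (c k s) y)\<bar> \<le> B" for y
          by (rule B[OF restrict_in_pow_space])
      qed (use L in \<open>auto intro!: mult_nonneg_nonneg sum_nonneg\<close>)
      then show ?thesis by (simp only: Zk_def Gk_def)
    qed
    have lim_k: "(\<lambda>k. \<integral>\<omega>. h (\<lambda>s\<in>S. Gk k s \<omega>) \<partial>gauss_seq) \<longlonglongrightarrow> (\<integral>\<omega>. h (G \<omega>) \<partial>gauss_seq)"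
    proof (rule integral_dominated_convergence[where w = "\<lambda>_. B"])
      show "AE \<omega> in gauss_seq. (\<lambda>k. h (\<lambda>s\<in>S. Gk k s \<omega>)) \<longlonglongrightarrow> h (G \<omega>)"
        using conv
      proof eventually_elim
        case (elim \<omega>)
        have "(\<lambda>k. L * pow_dist S (\<lambda>s\<in>S. Gk k s \<omega>) (G \<omega>)) \<longlonglongrightarrow> L * (\<Sum>s\<in>S. norm (G \<omega> s - G \<omega> s))"
          unfolding pow_dist_alt using elim by (intro tendsto_intros) auto
        then have "(\<lambda>k. L * pow_dist S (\<lambda>s\<in>S. Gk k s \<omega>) (G \<omega>)) \<longlonglongrightarrow> 0" by simp
        then have "(\<lambda>k. h (\<lambda>s\<in>S. Gk k s \<omega>) - h (G \<omega>)) \<longlonglongrightarrow> 0"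
        proof (rule Lim_null_comparison[rotated])
          have "G \<omega> \<in> pow_space S" by (simp add: G_def)
          then show "\<forall>\<^sub>F k in sequentially. norm (h (\<lambda>s\<in>S. Gk k s \<omega>) - h (G \<omega>))
              \<le> L * pow_dist S (\<lambda>s\<in>S. Gk k s \<omega>) (G \<omega>)"
            using h by (auto simp: lipschitz_pow_def)
        qed
        then show ?case by (simp add: LIM_zero_iff)
      qed
      show "AE \<omega> in gauss_seq. norm (h (\<lambda>s\<in>S. Gk k s \<omega>)) \<le> B" for k
        using B[OF restrict_in_pow_space] by simp
      show "(\<lambda>\<omega>. h (G \<omega>)) \<in> borel_measurable gauss_seq" by (rule hm[OF G_meas])
      show "(\<lambda>\<omega>. h (\<lambda>s\<in>S. Gk k s \<omega>)) \<in> borel_measurable gauss_seq" for k by (rule hm[OF Gk_meas'])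
    qed simp
    have "(\<lambda>n. \<integral>\<omega>. h (Z n \<omega>) \<partial>N) \<longlonglongrightarrow> (\<integral>\<omega>. h (G \<omega>) \<partial>gauss_seq)"
    proof (rule LIMSEQ_I)
      fix r :: real assume r: "r > 0"
      \<comment> \<open>The rank \<open>k\<close> is fixed first, so that the approximation errors
        on both sides are below \<open>r / 3\<close>; only then is \<open>n\<close> taken
        large.\<close>
      have "(\<lambda>k. L * (card S * (2 * sqrt C * (1 / 4) ^ k))) \<longlonglongrightarrow> L * (card S * (2 * sqrt C * 0))"
        by (intro tendsto_intros LIMSEQ_power_zero) simp
      then have "\<forall>\<^sub>F k in sequentially. L * (card S * (2 * sqrt C * (1 / 4) ^ k)) < r / 3"
        using r by (intro order_tendstoD(2)) auto
      moreover have "\<forall>\<^sub>F k in sequentially. dist (\<integral>\<omega>. h (\<lambda>s\<in>S. Gk k s \<omega>) \<partial>gauss_seq) (\<integral>\<omega>. h (G \<omega>) \<partial>gauss_seq) < r / 3"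
        using r by (intro tendstoD[OF lim_k]) simp
      ultimately have "\<forall>\<^sub>F k in sequentially. L * (card S * (2 * sqrt C * (1 / 4) ^ k)) < r / 3 \<and>
        dist (\<integral>\<omega>. h (\<lambda>s\<in>S. Gk k s \<omega>) \<partial>gauss_seq) (\<integral>\<omega>. h (G \<omega>) \<partial>gauss_seq) < r / 3"
        by (rule eventually_conj)
      then obtain k where k: "L * (card S * (2 * sqrt C * (1 / 4) ^ k)) < r / 3"
        "dist (\<integral>\<omega>. h (\<lambda>s\<in>S. Gk k s \<omega>) \<partial>gauss_seq) (\<integral>\<omega>. h (G \<omega>) \<partial>gauss_seq) < r / 3"
        using eventually_happens'[OF sequentially_bot] by blast
      have "r / 3 > 0" using r by simp
      from LIMSEQ_D[OF fd this, of k] obtain n0 where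
        n0: "\<And>n. n \<ge> n0 \<Longrightarrow> norm ((\<integral>\<omega>. h (Zk k n \<omega>) \<partial>N) - (\<integral>\<omega>. h (\<lambda>s\<in>S. Gk k s \<omega>) \<partial>gauss_seq)) < r / 3"
        by blast
      have "norm ((\<integral>\<omega>. h (Z n \<omega>) \<partial>N) - (\<integral>\<omega>. h (G \<omega>) \<partial>gauss_seq)) < r" if "n \<ge> n0" for n
        using bound[of n k] k n0[OF that] unfolding dist_real_def real_norm_def by linarith
      then show "\<exists>n0. \<forall>n\<ge>n0. norm ((\<integral>\<omega>. h (Z n \<omega>) \<partial>N) - (\<integral>\<omega>. h (G \<omega>) \<partial>gauss_seq)) < r" by blast
    qed
    then show "(\<lambda>n. \<integral>\<omega>. h (normalized_sum S Vs (restrict mean_vec S) n \<omega>) \<partial>N)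
      \<longlonglongrightarrow> (\<integral>\<omega>. h (G \<omega>) \<partial>gauss_seq)" by (simp only: Z_def)
  qed
qed

end

section \<open>From Lipschitz to continuous test functions\<close>

text \<open>The Pasch-Hausdorff envelope: for bounded \<open>h\<close> and \<open>k \<ge> 0\<close>
  it is the largest \<open>k\<close>-Lipschitz function below \<open>h\<close>.\<close>

definition inf_conv :: "'s set \<Rightarrow> real \<Rightarrow> (('s \<Rightarrow> 'b::banach) \<Rightarrow> real) \<Rightarrow> ('s \<Rightarrow> 'b) \<Rightarrow> real" where
  "inf_conv S k h x = (INF y\<in>pow_space S. h y + k * pow_dist S x y)"

lemma inf_conv_properties:
  fixes h :: "('s \<Rightarrow> 'b::banach) \<Rightarrow> real"
  assumes fin: "finite S" and B: "\<And>x. x \<in> pow_space S \<Longrightarrow> \<bar>h x\<bar> \<le> B" and k: "k \<ge> 0"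
  shows "x \<in> pow_space S \<Longrightarrow> inf_conv S k h x \<le> h x"
    and "x \<in> pow_space S \<Longrightarrow> \<bar>inf_conv S k h x\<bar> \<le> B"
    and "lipschitz_pow S k (inf_conv S k h)"
proof -
  interpret Metric_space "pow_space S" "pow_dist S :: ('s \<Rightarrow> 'b) \<Rightarrow> _" by (rule Metric_space_pow[OF fin])
  have bdd: "bdd_below ((\<lambda>y. h y + k * pow_dist S x y) ` pow_space S)" for x
  proof (rule bdd_belowI2)
    fix y :: "'s \<Rightarrow> 'b" assume "y \<in> pow_space S"
    then show "- B \<le> h y + k * pow_dist S x y"
      using B[of y] mult_nonneg_nonneg[OF k nonneg[of x y]] by linarith
  qed
  have lower: "inf_conv S k h x \<le> h y + k * pow_dist S x y" if "y \<in> pow_space S" for x y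
    unfolding inf_conv_def by (rule cINF_lower[OF bdd that])
  have greatest: "m \<le> inf_conv S k h x" if "\<And>y. y \<in> pow_space S \<Longrightarrow> m \<le> h y + k * pow_dist S x y" for m x
    unfolding inf_conv_def by (rule cINF_greatest[OF pow_space_nonempty that])
  show le: "inf_conv S k h x \<le> h x" if "x \<in> pow_space S" for x
    using lower[OF that, of x] mdist_zero[OF that] by simp
  show "\<bar>inf_conv S k h x\<bar> \<le> B" if x: "x \<in> pow_space S" for x
  proof -
    have "- B \<le> inf_conv S k h x"
    proof (rule greatest)
      fix y :: "'s \<Rightarrow> 'b" assume "y \<in> pow_space S"
      then show "- B \<le> h y + k * pow_dist S x y"
        using B[of y] mult_nonneg_nonneg[OF k nonneg[of x y]] by linarith
    qed
    then show ?thesis using le[OF x] B[OF x] by linarith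
  qed
  have half: "inf_conv S k h x - k * pow_dist S x z \<le> inf_conv S k h z"
    if "x \<in> pow_space S" "z \<in> pow_space S" for x z
  proof (rule greatest)
    fix y :: "'s \<Rightarrow> 'b" assume y: "y \<in> pow_space S"
    have "k * pow_dist S x y \<le> k * pow_dist S x z + k * pow_dist S z y"
      using mult_left_mono[OF triangle[OF that y] k] by (simp add: distrib_left)
    then show "inf_conv S k h x - k * pow_dist S x z \<le> h y + k * pow_dist S z y"
      using lower[OF y, of x] by linarith
  qed
  show "lipschitz_pow S k (inf_conv S k h)"
    unfolding lipschitz_pow_def
  proof (intro ballI)
    fix x z :: "'s \<Rightarrow> 'b" assume "x \<in> pow_space S" "z \<in> pow_space S"
    then show "\<bar>inf_conv S k h x - inf_conv S k h z\<bar> \<le> k * pow_dist S x z"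
      using half[of x z] half[of z x] commute[of x z] by auto
  qed
qed

text \<open>Near \<open>x\<close> continuity bounds \<open>h y\<close> from below; at distance
  \<open>d\<close> or more the penalty of at least \<open>k * d \<ge> 2 * B\<close> outweighs the
  oscillation of \<open>h\<close>.\<close>

lemma inf_conv_tendsto:
  fixes h :: "('s \<Rightarrow> 'b::banach) \<Rightarrow> real"
  assumes fin: "finite S" and B: "\<And>x. x \<in> pow_space S \<Longrightarrow> \<bar>h x\<bar> \<le> B"
    and cont: "continuous_map (pow_topology S) euclideanreal h" and x: "x \<in> pow_space S"
  shows "(\<lambda>k. inf_conv S (real k) h x) \<longlonglongrightarrow> h x"
proof (rule LIMSEQ_I)
  fix r :: real assume r: "r > 0"
  then obtain d where d: "d > 0" "\<And>y. y \<in> pow_space S \<Longrightarrow> pow_dist S x y < d \<Longrightarrow> \<bar>h y - h x\<bar> < r / 2"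
    using cont x unfolding continuous_map_pow_iff[OF fin] by (meson half_gt_zero)
  have "\<bar>inf_conv S (real k) h x - h x\<bar> < r" if k: "k \<ge> nat \<lceil>2 * B / d\<rceil>" for k
  proof -
    have kd: "2 * B \<le> real k * d" using k d(1) by (simp add: nat_le_iff ceiling_le_iff field_simps)
    have "h x - r / 2 \<le> inf_conv S (real k) h x"
      unfolding inf_conv_def
    proof (rule cINF_greatest[OF pow_space_nonempty])
      fix y :: "'s \<Rightarrow> 'b" assume y: "y \<in> pow_space S"
      have dist: "pow_dist S x y \<ge> 0" by (simp add: pow_dist_def)
      show "h x - r / 2 \<le> h y + real k * pow_dist S x y"
      proof (cases "pow_dist S x y < d")
        case True
        have "0 \<le> real k * pow_dist S x y" using dist by simp
        then show ?thesis using d(2)[OF y True] by linarith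
      next
        case False
        then have "real k * d \<le> real k * pow_dist S x y" by (intro mult_left_mono) auto
        then show ?thesis using kd B[OF y] B[OF x] r by linarith
      qed
    qed
    then show ?thesis using inf_conv_properties(1)[of S h B "real k" x, OF fin B _ x] r by simp
  qed
  then show "\<exists>k0. \<forall>k\<ge>k0. norm (inf_conv S (real k) h x - h x) < r"
    unfolding real_norm_def by blast
qed

text \<open>As in the portmanteau theorem, Lipschitz minorants give a lower bound on the limit
  inferior; used for \<open>h\<close> and for \<open>- h\<close> it gives convergence.\<close>

lemma converges_in_distributionI_lipschitz:
  fixes Z :: "nat \<Rightarrow> 'u \<Rightarrow> 's \<Rightarrow> 'b::banach" and G :: "'q \<Rightarrow> 's \<Rightarrow> 'b"
  assumes fin: "finite S" and "prob_space N" "prob_space Q"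
    and Z: "\<And>n. Z n \<in> measurable N (pow_borel S)" and G: "G \<in> measurable Q (pow_borel S)"
    and lip: "\<And>h L B. lipschitz_pow S L h \<Longrightarrow> L \<ge> 0 \<Longrightarrow> (\<And>x. x \<in> pow_space S \<Longrightarrow> \<bar>h x\<bar> \<le> B) \<Longrightarrow>
      (\<lambda>n. \<integral>\<omega>. h (Z n \<omega>) \<partial>N) \<longlonglongrightarrow> (\<integral>\<omega>. h (G \<omega>) \<partial>Q)"
  shows "converges_in_distribution S N Z Q G"
  unfolding converges_in_distribution_def
proof safe
  interpret N: prob_space N by fact
  interpret Q: prob_space Q by fact
  have Zsp: "Z n \<omega> \<in> pow_space S" if "\<omega> \<in> space N" for n \<omega>
    using measurable_space[OF Z that] fin by simp
  have Gsp: "G \<omega> \<in> pow_space S" if "\<omega> \<in> space Q" for \<omega>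
    using measurable_space[OF G that] fin by simp
  have below: "\<forall>\<^sub>F n in sequentially. (\<integral>\<omega>. h (G \<omega>) \<partial>Q) - r < (\<integral>\<omega>. h (Z n \<omega>) \<partial>N)"
    if cont: "continuous_map (pow_topology S) euclideanreal h"
      and B: "\<And>x. x \<in> pow_space S \<Longrightarrow> \<bar>h x\<bar> \<le> B" and r: "r > 0" for h B and r :: real
  proof -
    have props: "x \<in> pow_space S \<Longrightarrow> inf_conv S (real k) h x \<le> h x"
      "x \<in> pow_space S \<Longrightarrow> \<bar>inf_conv S (real k) h x\<bar> \<le> B"
      "lipschitz_pow S (real k) (inf_conv S (real k) h)" for x and k :: nat
      using inf_conv_properties(1,2)[of S h B "real k" x] inf_conv_properties(3)[of S h B "real k"] fin B
      by simp_all
    have h_meas: "h \<in> borel_measurable (pow_borel S)"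
      by (rule continuous_map_measurable_pow_borel[OF fin cont])
    have hk_meas: "inf_conv S (real k) h \<in> borel_measurable (pow_borel S)" for k :: nat
      by (rule continuous_map_measurable_pow_borel[OF fin lipschitz_pow_continuous[OF fin props(3)]])
    have "(\<lambda>k. \<integral>\<omega>. inf_conv S (real k) h (G \<omega>) \<partial>Q) \<longlonglongrightarrow> (\<integral>\<omega>. h (G \<omega>) \<partial>Q)"
    proof (rule integral_dominated_convergence[where w = "\<lambda>_. B"])
      show "AE \<omega> in Q. (\<lambda>k. inf_conv S (real k) h (G \<omega>)) \<longlonglongrightarrow> h (G \<omega>)"
        by (rule AE_I2) (rule inf_conv_tendsto[OF fin B cont Gsp])
      show "AE \<omega> in Q. norm (inf_conv S (real k) h (G \<omega>)) \<le> B" for k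
        using props(2)[of _ k] Gsp by auto
    qed (auto intro: measurable_compose[OF G] h_meas hk_meas)
    then have "\<forall>\<^sub>F k in sequentially. (\<integral>\<omega>. h (G \<omega>) \<partial>Q) - r < (\<integral>\<omega>. inf_conv S (real k) h (G \<omega>) \<partial>Q)"
      using r by (intro order_tendstoD(1)) auto
    then obtain k :: nat where k: "(\<integral>\<omega>. h (G \<omega>) \<partial>Q) - r < (\<integral>\<omega>. inf_conv S (real k) h (G \<omega>) \<partial>Q)"
      using eventually_happens'[OF sequentially_bot] by blast
    have "(\<lambda>n. \<integral>\<omega>. inf_conv S (real k) h (Z n \<omega>) \<partial>N) \<longlonglongrightarrow> (\<integral>\<omega>. inf_conv S (real k) h (G \<omega>) \<partial>Q)"
      by (rule lip[OF props(3) _ props(2)]) simp_all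
    then have "\<forall>\<^sub>F n in sequentially. (\<integral>\<omega>. h (G \<omega>) \<partial>Q) - r < (\<integral>\<omega>. inf_conv S (real k) h (Z n \<omega>) \<partial>N)"
      using k by (rule order_tendstoD(1))
    then show ?thesis
    proof eventually_elim
      case (elim n)
      have "(\<integral>\<omega>. inf_conv S (real k) h (Z n \<omega>) \<partial>N) \<le> (\<integral>\<omega>. h (Z n \<omega>) \<partial>N)"
      proof (rule integral_mono)
        show "integrable N (\<lambda>\<omega>. inf_conv S (real k) h (Z n \<omega>))"
          using props(2)[of _ k] Zsp
          by (intro N.integrable_const_bound[where B = B] measurable_compose[OF Z hk_meas]) auto
        show "integrable N (\<lambda>\<omega>. h (Z n \<omega>))"
          using B Zsp by (intro N.integrable_const_bound[where B = B] measurable_compose[OF Z h_meas]) auto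
        show "inf_conv S (real k) h (Z n \<omega>) \<le> h (Z n \<omega>)" if "\<omega> \<in> space N" for \<omega>
          by (rule props(1)[OF Zsp[OF that]])
      qed
      with elim show ?case by simp
    qed
  qed
  fix h :: "('s \<Rightarrow> 'b) \<Rightarrow> real"
  assume cont: "continuous_map (pow_topology S) euclideanreal h" and bdd: "bounded (h ` pow_space S)"
  then obtain B where B: "\<And>x. x \<in> pow_space S \<Longrightarrow> \<bar>h x\<bar> \<le> B" unfolding bounded_iff by auto
  have cont': "continuous_map (pow_topology S) euclideanreal (\<lambda>x. - h x)"
    using cont by (rule continuous_map_minus)
  show "(\<lambda>n. \<integral>\<omega>. h (Z n \<omega>) \<partial>N) \<longlonglongrightarrow> (\<integral>\<omega>. h (G \<omega>) \<partial>Q)"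
  proof (rule tendstoI)
    fix r :: real assume r: "r > 0"
    have "\<forall>\<^sub>F n in sequentially. (\<integral>\<omega>. - h (G \<omega>) \<partial>Q) - r < (\<integral>\<omega>. - h (Z n \<omega>) \<partial>N)"
      by (rule below[OF cont' _ r, of B]) (simp add: B)
    moreover have "\<forall>\<^sub>F n in sequentially. (\<integral>\<omega>. h (G \<omega>) \<partial>Q) - r < (\<integral>\<omega>. h (Z n \<omega>) \<partial>N)"
      by (rule below[OF cont _ r, of B]) (simp add: B)
    ultimately show "\<forall>\<^sub>F n in sequentially. dist (\<integral>\<omega>. h (Z n \<omega>) \<partial>N) (\<integral>\<omega>. h (G \<omega>) \<partial>Q) < r"
      by eventually_elim (simp add: dist_real_def abs_less_iff)
  qed
qed

text \<open>Scale \<open>0\<close> yields the point mass that \<open>gaussian_law\<close>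
  admits.\<close>

lemma gaussian_law_scaled:
  assumes "a \<ge> 0"
  shows "gaussian_law (distr std_normal_distribution borel (\<lambda>x. a * x))"
proof -
  have ps: "prob_space std_normal_distribution" by (rule prob_space_normal_density) simp
  show ?thesis
  proof (cases "a = 0")
    case True
    then have "distr std_normal_distribution borel (\<lambda>x. a * x) = return borel 0"
      using prob_space.emeasure_space_1[OF ps] by (intro measure_eqI) (auto simp: emeasure_distr)
    then show ?thesis unfolding gaussian_law_def by blast
  next
    case False
    have "distributed std_normal_distribution lborel (\<lambda>x. x) std_normal_density"
      unfolding distributed_def by (auto intro: distr_id2)
    from prob_space.normal_density_affine[OF ps this, of a 0] assms False
    have "distributed std_normal_distribution lborel (\<lambda>x. a * x) (normal_density 0 a)" by simp
    then have "distr std_normal_distribution lborel (\<lambda>x. a * x) = density lborel (normal_density 0 a)"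
      by (rule distributed_distr_eq_density)
    moreover have "distr std_normal_distribution lborel (\<lambda>x. a * x) = distr std_normal_distribution borel (\<lambda>x. a * x)"
      by (rule distr_cong) auto
    ultimately show ?thesis
      unfolding gaussian_law_def using assms False by (metis order_le_less)
  qed
qed

section \<open>Functionals of the normalized sums\<close>

context pow_clt begin

lemma pow_dual_mean:
  assumes f: "f \<in> pow_dual S"
  shows "integrable \<mu> f" "(\<integral>x. f x \<partial>\<mu>) = f (restrict mean_vec S)"
proof -
  have id: "(\<lambda>x. x) \<in> measurable \<mu> (pow_borel S)"
    using measurable_ident_sets[OF sets_\<mu>] by simp
  note int = pow_dual_integral[OF fin id integrable_coord f]
  show "integrable \<mu> f" using int(1) by simp
  have "(\<lambda>s\<in>S. \<integral>x. x s \<partial>\<mu>) = restrict mean_vec S" by (auto simp: mean_vec_def)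
  with int(2) show "(\<integral>x. f x \<partial>\<mu>) = f (restrict mean_vec S)" by simp
qed

definition centered :: "(('s \<Rightarrow> 'b) \<Rightarrow> real) \<Rightarrow> ('s \<Rightarrow> 'b) \<Rightarrow> real" where
  "centered f x = f x - f (restrict mean_vec S)"

lemma centered_measurable: "f \<in> pow_dual S \<Longrightarrow> centered f \<in> borel_measurable \<mu>"
  unfolding centered_def[abs_def]
  using pow_dual_mean(1)[of f] by (auto intro: borel_measurable_integrable)

lemma centered_mean: "f \<in> pow_dual S \<Longrightarrow> (\<integral>x. centered f x \<partial>\<mu>) = 0"
  unfolding centered_def using pow_dual_mean by simp

lemma centered_square_integrable:
  assumes f: "f \<in> pow_dual S"
  shows "integrable \<mu> (\<lambda>x. (centered f x)\<^sup>2)"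
proof -
  obtain g where g: "\<And>s. s \<in> S \<Longrightarrow> bounded_linear (g s)"
    "\<And>x. x \<in> pow_space S \<Longrightarrow> f x = (\<Sum>s\<in>S. g s (x s))"
    by (rule pow_dual_coordinates[OF fin f], rule that)
  have meas: "(\<lambda>x. g s (x s)) \<in> borel_measurable \<mu>" if "s \<in> S" for s
    using integrable_bounded_linear[OF g(1)[OF that] integrable_coord[OF that]] by simp
  have int: "integrable \<mu> (\<lambda>x. (norm (g s (x s)))\<^sup>2)" if s: "s \<in> S" for s
  proof -
    obtain K where K: "\<And>b. norm (g s b) \<le> norm b * K" using bounded_linear.bounded[OF g(1)[OF s]] by blast
    show ?thesis
    proof (rule Bochner_Integration.integrable_bound)
      show "integrable \<mu> (\<lambda>x. K\<^sup>2 * (norm (x s))\<^sup>2)" using sq[OF s] by simp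
      show "(\<lambda>x. (norm (g s (x s)))\<^sup>2) \<in> borel_measurable \<mu>" using meas[OF s] by simp
      have "(norm (g s b))\<^sup>2 \<le> K\<^sup>2 * (norm b)\<^sup>2" for b
        using power_mono[OF K[of b], of 2] by (simp add: power_mult_distrib mult.commute)
      then show "AE x in \<mu>. norm ((norm (g s (x s)))\<^sup>2) \<le> norm (K\<^sup>2 * (norm (x s))\<^sup>2)" by simp
    qed
  qed
  have "integrable \<mu> (\<lambda>x. (norm ((\<Sum>s\<in>S. g s (x s)) + (- f (restrict mean_vec S))))\<^sup>2)"
    using integrable_norm_sum_power2[OF meas int]
    by (rule integrable_norm_add_power2[rotated 2]) (use meas in auto)
  then show ?thesis
    by (subst Bochner_Integration.integrable_cong[OF refl]) (auto simp: centered_def g(2))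
qed

text \<open>Turns a functional of the vector-valued sum into a normalized sum of independent real
  copies of \<open>centered f\<close>, the setting of the real central limit theorem.\<close>

lemma pow_dual_normalized_sum:
  assumes f: "f \<in> pow_dual S"
  shows "\<omega> \<in> space N \<Longrightarrow>
    f (normalized_sum S Vs (restrict mean_vec S) n \<omega>) = (\<Sum>k<n. centered f (Vs (Suc k) \<omega>)) / sqrt n"
proof -
  assume \<omega>: "\<omega> \<in> space N"
  obtain g where g: "\<And>s. s \<in> S \<Longrightarrow> bounded_linear (g s)"
    "\<And>x. x \<in> pow_space S \<Longrightarrow> f x = (\<Sum>s\<in>S. g s (x s))"
    by (rule pow_dual_coordinates[OF fin f], rule that)
  have lin: "linear (g s)" if "s \<in> S" for s using bounded_linear.linear[OF g(1)[OF that]] .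
  have V: "Vs k \<omega> \<in> pow_space S" for k using measurable_space[OF measurable_Vs \<omega>] fin by simp
  have "f (normalized_sum S Vs (restrict mean_vec S) n \<omega>)
    = (\<Sum>s\<in>S. g s ((1 / sqrt n) *\<^sub>R (\<Sum>k<n. Vs (Suc k) \<omega> s - mean_vec s)))"
    by (subst g(2)) (auto simp: normalized_sum_component intro!: sum.cong, simp add: normalized_sum_def)
  also have "\<dots> = (\<Sum>s\<in>S. (1 / sqrt n) * (\<Sum>k<n. g s (Vs (Suc k) \<omega> s) - g s (mean_vec s)))"
    using lin by (intro sum.cong refl) (simp add: linear_scale linear_sum linear_diff sum_divide_distrib diff_divide_distrib)
  also have "\<dots> = (1 / sqrt n) * (\<Sum>k<n. \<Sum>s\<in>S. g s (Vs (Suc k) \<omega> s) - g s (mean_vec s))"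
    unfolding sum_distrib_left[symmetric] by (subst sum.swap) simp
  also have "\<dots> = (1 / sqrt n) * (\<Sum>k<n. centered f (Vs (Suc k) \<omega>))"
    using V by (simp add: centered_def g(2) sum_subtractf)
  finally show ?thesis by simp
qed

end

section \<open>The law of the limit\<close>

text \<open>Test functions for convergence in distribution are real, so complex exponentials have to
  be split into cosine and sine.\<close>

lemma (in prob_space) expectation_iexp:
  fixes X :: "'a \<Rightarrow> real"
  assumes [measurable]: "X \<in> borel_measurable M"
  shows "expectation (\<lambda>x. iexp (X x)) = complex_of_real (expectation (\<lambda>x. cos (X x))) + \<i> * complex_of_real (expectation (\<lambda>x. sin (X x)))"
proof -
  have "integrable M (\<lambda>x. cos (X x))" "integrable M (\<lambda>x. sin (X x))"
    by (auto intro!: integrable_const_bound[where B = 1])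
  then have "expectation (\<lambda>x. complex_of_real (cos (X x)) + \<i> * complex_of_real (sin (X x)))
    = complex_of_real (expectation (\<lambda>x. cos (X x))) + \<i> * complex_of_real (expectation (\<lambda>x. sin (X x)))"
    by simp
  then show ?thesis by (simp add: cis_conv_exp[symmetric] cis.ctr complex_eq_iff exp_Euler cos_of_real sin_of_real)
qed

text \<open>Stated for the image of the standard normal under scaling, instead of for a normal
  density, so that \<open>a = 0\<close> is included.\<close>

lemma std_normal_scaled_moments:
  fixes a :: real
  defines "D \<equiv> distr std_normal_distribution borel (\<lambda>x. a * x)"
  shows "integrable D (\<lambda>x. x)" "(\<integral>x. x \<partial>D) = 0" "integrable D (\<lambda>x. x\<^sup>2)" "(\<integral>x. x\<^sup>2 \<partial>D) = a\<^sup>2"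
proof -
  have i1: "integrable std_normal_distribution (\<lambda>x. x)"
    using integrable_std_normal_distribution_moment[of 1] by simp
  have m1: "(\<integral>x. x \<partial>std_normal_distribution) = 0"
    using integral_std_normal_distribution_moment_odd[of 1] by simp
  have m2: "(\<integral>x. x\<^sup>2 \<partial>std_normal_distribution) = 1"
    using std_normal_distribution_even_moments(1)[of 1] by simp
  have i2: "integrable std_normal_distribution (\<lambda>x. x\<^sup>2)"
    by (rule integrable_std_normal_distribution_moment)
  have meas: "(\<lambda>x. a * x) \<in> measurable std_normal_distribution borel" by simp
  have "integrable std_normal_distribution (\<lambda>x. a * x)" by (rule integrable_mult_right[OF i1])
  then show "integrable D (\<lambda>x. x)" unfolding D_def by (subst integrable_distr_eq[OF meas]) simp_all
  have "(\<integral>x. x \<partial>D) = (\<integral>x. a * x \<partial>std_normal_distribution)"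
    unfolding D_def by (rule integral_distr[OF meas]) simp
  also have "\<dots> = 0" unfolding integral_mult_right_zero m1 by (rule mult_zero_right)
  finally show "(\<integral>x. x \<partial>D) = 0" .
  have "integrable std_normal_distribution (\<lambda>x. (a * x)\<^sup>2)"
    unfolding power_mult_distrib by (rule integrable_mult_right[OF i2])
  then show "integrable D (\<lambda>x. x\<^sup>2)" unfolding D_def by (subst integrable_distr_eq[OF meas]) simp_all
  have "(\<integral>x. x\<^sup>2 \<partial>D) = (\<integral>x. (a * x)\<^sup>2 \<partial>std_normal_distribution)"
    unfolding D_def by (rule integral_distr[OF meas]) simp
  also have "\<dots> = a\<^sup>2" unfolding power_mult_distrib integral_mult_right_zero m2 by (rule mult_1_right)
  finally show "(\<integral>x. x\<^sup>2 \<partial>D) = a\<^sup>2" .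
qed

lemma pow_dual_zero:
  assumes "f \<in> pow_dual S" shows "f (\<lambda>s\<in>S. 0) = 0"
proof -
  have "f (\<lambda>s\<in>S. c *\<^sub>R x s) = c * f x" if "x \<in> pow_space S" for c x
    using assms that by (auto simp: pow_dual_def)
  from this[of "\<lambda>s\<in>S. 0" 0] show ?thesis by (simp cong: restrict_cong)
qed

context pow_clt begin

text \<open>The characteristic functions of \<open>f\<close> applied to the normalized sums converge
  in two ways: by \<open>conv\<close>, with cosine and sine as test functions, and by the real
  central limit theorem. The two limits must agree. The construction of \<open>G\<close> does not
  enter, so the result can be used again for the law of \<open>G\<close>.\<close>

lemma limit_distribution:
  fixes G :: "'q \<Rightarrow> 's \<Rightarrow> 'b"
  assumes Q: "prob_space Q" and G: "G \<in> measurable Q (pow_borel S)"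
    and conv: "converges_in_distribution S N (normalized_sum S Vs (restrict mean_vec S)) Q G"
    and f: "f \<in> pow_dual S"
  shows "distr Q borel (\<lambda>\<omega>. f (G \<omega>))
    = distr std_normal_distribution borel (\<lambda>x. sqrt (\<integral>x. (centered f x)\<^sup>2 \<partial>\<mu>) * x)"
proof (rule Levy_uniqueness)
  interpret Q: prob_space Q by fact
  define v where "v = (\<integral>x. (centered f x)\<^sup>2 \<partial>\<mu>)"
  have v: "v \<ge> 0" by (simp add: v_def)
  have f_cont: "continuous_map (pow_topology S) euclideanreal f" using f by (simp add: pow_dual_def)
  have f_meas: "f \<in> borel_measurable (pow_borel S)" by (rule continuous_map_measurable_pow_borel[OF fin f_cont])
  have fG [measurable]: "(\<lambda>\<omega>. f (G \<omega>)) \<in> borel_measurable Q" by (rule measurable_compose[OF G f_meas])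
  let ?Z = "normalized_sum S Vs (restrict mean_vec S)"
  have fZ [measurable]: "(\<lambda>\<omega>. f (?Z n \<omega>)) \<in> borel_measurable N" for n
    by (rule measurable_compose[OF measurable_normalized_sum f_meas])
  show "real_distribution (distr Q borel (\<lambda>\<omega>. f (G \<omega>)))"
    by (rule Q.real_distribution_distr[OF fG])
  show "real_distribution (distr std_normal_distribution borel (\<lambda>x. sqrt (\<integral>x. (centered f x)\<^sup>2 \<partial>\<mu>) * x))"
    by (rule prob_space.real_distribution_distr[OF prob_space_normal_density]) simp_all
  show "char (distr Q borel (\<lambda>\<omega>. f (G \<omega>)))
    = char (distr std_normal_distribution borel (\<lambda>x. sqrt (\<integral>x. (centered f x)\<^sup>2 \<partial>\<mu>) * x))"
  proof
    fix t
    have test: "(\<lambda>n. \<integral>\<omega>. u (t * f (?Z n \<omega>)) \<partial>N) \<longlonglongrightarrow> (\<integral>\<omega>. u (t * f (G \<omega>)) \<partial>Q)"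
      if "continuous_on UNIV u" "\<And>x. \<bar>u x\<bar> \<le> 1" for u :: "real \<Rightarrow> real"
    proof -
      have "continuous_map (pow_topology S) euclideanreal (u \<circ> (\<lambda>x. t * f x))"
        by (rule continuous_map_compose[OF continuous_map_real_mult_left[OF f_cont]]) (simp add: that)
      moreover have "bounded ((u \<circ> (\<lambda>x. t * f x)) ` pow_space S)"
        using that(2) by (auto simp: bounded_iff intro!: exI[of _ 1])
      ultimately show ?thesis
        using conv unfolding converges_in_distribution_def by (auto simp: comp_def)
    qed
    have "(\<lambda>n. \<integral>\<omega>. iexp (t * f (?Z n \<omega>)) \<partial>N) \<longlonglongrightarrow> (\<integral>\<omega>. iexp (t * f (G \<omega>)) \<partial>Q)"
    proof -
      have "(\<lambda>\<omega>. t * f (?Z n \<omega>)) \<in> borel_measurable N" for n by measurable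
      note N_iexp = N.expectation_iexp[OF this]
      have "(\<lambda>\<omega>. t * f (G \<omega>)) \<in> borel_measurable Q" by measurable
      note Q_iexp = Q.expectation_iexp[OF this]
      have "continuous_on UNIV (cos :: real \<Rightarrow> real)" "continuous_on UNIV (sin :: real \<Rightarrow> real)"
        by (intro continuous_intros)+
      then show ?thesis
        unfolding N_iexp Q_iexp by (intro tendsto_intros test) auto
    qed
    moreover have "(\<lambda>n. \<integral>\<omega>. iexp (t * f (?Z n \<omega>)) \<partial>N) \<longlonglongrightarrow> complex_of_real (exp (- (t\<^sup>2 * v) / 2))"
    proof -
      have "(\<lambda>n. \<integral>\<omega>. iexp (t * ((\<Sum>k<n. centered f (Vs (Suc k) \<omega>)) / sqrt n)) \<partial>N)
        \<longlonglongrightarrow> complex_of_real (exp (- (t\<^sup>2 * v) / 2))"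
      proof (rule N.central_limit_char)
        note cm [measurable] = centered_measurable[OF f]
        show "N.indep_vars (\<lambda>_. borel) (\<lambda>k \<omega>. centered f (Vs (Suc k) \<omega>)) UNIV" by (rule indep_transfer[OF cm])
        show "distr N borel (\<lambda>\<omega>. centered f (Vs (Suc k) \<omega>)) = distr \<mu> borel (centered f)" for k
          by (rule distr_transfer[OF cm])
        show "(\<integral>\<omega>. centered f (Vs (Suc k) \<omega>) \<partial>N) = 0" for k
          by (simp add: integral_transfer(1)[OF cm] centered_mean[OF f])
        show "integrable N (\<lambda>\<omega>. (centered f (Vs (Suc k) \<omega>))\<^sup>2)" for k
          using integral_transfer(2)[of "\<lambda>x. (centered f x)\<^sup>2" "Suc k"] centered_square_integrable[OF f] by simp
        show "(\<integral>\<omega>. (centered f (Vs (Suc k) \<omega>))\<^sup>2 \<partial>N) = v" for k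
          using integral_transfer(1)[of "\<lambda>x. (centered f x)\<^sup>2" "Suc k"] by (simp add: v_def)
      qed
      moreover have "(\<integral>\<omega>. iexp (t * ((\<Sum>k<n. centered f (Vs (Suc k) \<omega>)) / sqrt n)) \<partial>N) = (\<integral>\<omega>. iexp (t * f (?Z n \<omega>)) \<partial>N)" for n
        by (intro Bochner_Integration.integral_cong refl) (simp only: pow_dual_normalized_sum[OF f])
      ultimately show ?thesis by simp
    qed
    ultimately have "(\<integral>\<omega>. iexp (t * f (G \<omega>)) \<partial>Q) = complex_of_real (exp (- (t\<^sup>2 * v) / 2))"
      by (rule LIMSEQ_unique)
    moreover have "char (distr Q borel (\<lambda>\<omega>. f (G \<omega>))) t = (\<integral>\<omega>. iexp (t * f (G \<omega>)) \<partial>Q)"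
      by (simp add: char_def integral_distr)
    moreover have "char (distr std_normal_distribution borel (\<lambda>x. sqrt v * x)) t
      = char std_normal_distribution (t * sqrt v)"
      by (simp add: char_def integral_distr mult.assoc)
    ultimately show "char (distr Q borel (\<lambda>\<omega>. f (G \<omega>))) t
      = char (distr std_normal_distribution borel (\<lambda>x. sqrt (\<integral>x. (centered f x)\<^sup>2 \<partial>\<mu>) * x)) t"
      unfolding v_def[symmetric] by (simp add: char_std_normal_distribution power_mult_distrib v)
  qed
qed

lemma limit_moments:
  fixes G :: "'q \<Rightarrow> 's \<Rightarrow> 'b"
  assumes Q: "prob_space Q" and G: "G \<in> measurable Q (pow_borel S)"
    and conv: "converges_in_distribution S N (normalized_sum S Vs (restrict mean_vec S)) Q G"
    and f: "f \<in> pow_dual S"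
  shows "integrable Q (\<lambda>\<omega>. f (G \<omega>))" "(\<integral>\<omega>. f (G \<omega>) \<partial>Q) = 0"
    "integrable Q (\<lambda>\<omega>. (f (G \<omega>))\<^sup>2)" "(\<integral>\<omega>. (f (G \<omega>))\<^sup>2 \<partial>Q) = (\<integral>x. (centered f x)\<^sup>2 \<partial>\<mu>)"
proof -
  have "f \<in> borel_measurable (pow_borel S)"
    using f by (intro continuous_map_measurable_pow_borel[OF fin]) (simp add: pow_dual_def)
  then have [measurable]: "(\<lambda>\<omega>. f (G \<omega>)) \<in> borel_measurable Q" by (rule measurable_compose[OF G])
  note moments = std_normal_scaled_moments[of "sqrt (\<integral>x. (centered f x)\<^sup>2 \<partial>\<mu>)",
      folded limit_distribution[OF assms]]
  show "integrable Q (\<lambda>\<omega>. f (G \<omega>))" "(\<integral>\<omega>. f (G \<omega>) \<partial>Q) = 0"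
    using moments(1,2) by (simp_all add: integrable_distr_eq integral_distr)
  show "integrable Q (\<lambda>\<omega>. (f (G \<omega>))\<^sup>2)" "(\<integral>\<omega>. (f (G \<omega>))\<^sup>2 \<partial>Q) = (\<integral>x. (centered f x)\<^sup>2 \<partial>\<mu>)"
    using moments(3,4) by (simp_all add: integrable_distr_eq integral_distr)
qed

lemma limit_covariance:
  fixes G :: "'q \<Rightarrow> 's \<Rightarrow> 'b"
  assumes Q: "prob_space Q" and G: "G \<in> measurable Q (pow_borel S)"
    and conv: "converges_in_distribution S N (normalized_sum S Vs (restrict mean_vec S)) Q G"
    and f: "f \<in> pow_dual S" and g: "g \<in> pow_dual S"
  shows "(\<integral>\<omega>. f (G \<omega>) * g (G \<omega>) \<partial>Q) = (\<integral>x. centered f x * centered g x \<partial>\<mu>)"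
proof -
  note mom = limit_moments[OF Q G conv]
  have fg: "(\<lambda>x. f x + g x) \<in> pow_dual S" by (rule pow_dual_add[OF fin f g])
  have polar: "a * b = ((a + b)\<^sup>2 - a\<^sup>2 - b\<^sup>2) / 2" for a b :: real by (simp add: power2_sum)
  have c: "centered (\<lambda>x. f x + g x) x = centered f x + centered g x" for x by (simp add: centered_def)
  have "(\<integral>\<omega>. f (G \<omega>) * g (G \<omega>) \<partial>Q)
    = ((\<integral>\<omega>. (f (G \<omega>) + g (G \<omega>))\<^sup>2 \<partial>Q) - (\<integral>\<omega>. (f (G \<omega>))\<^sup>2 \<partial>Q) - (\<integral>\<omega>. (g (G \<omega>))\<^sup>2 \<partial>Q)) / 2"
    unfolding polar[of "f _"] using mom(3)[OF f] mom(3)[OF g] mom(3)[OF fg] by simp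
  also have "\<dots> = ((\<integral>x. (centered f x + centered g x)\<^sup>2 \<partial>\<mu>)
      - (\<integral>x. (centered f x)\<^sup>2 \<partial>\<mu>) - (\<integral>x. (centered g x)\<^sup>2 \<partial>\<mu>)) / 2"
    using mom(4)[OF f] mom(4)[OF g] mom(4)[OF fg] by (simp add: c)
  also have "\<dots> = (\<integral>x. centered f x * centered g x \<partial>\<mu>)"
    unfolding polar[of "centered f _"]
    using centered_square_integrable[OF f] centered_square_integrable[OF g] centered_square_integrable[OF fg]
    by (simp add: c)
  finally show ?thesis .
qed

lemma gaussian_limit_exists:
  obtains G where "G \<in> measurable gauss_seq (pow_borel S)"
    "converges_in_distribution S N (normalized_sum S Vs (restrict mean_vec S)) gauss_seq G"
proof (rule orthogonal_system)
  fix e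
  assume e: "\<And>j. e j \<in> borel_measurable \<mu>" "\<And>j. \<exists>B. \<forall>x. \<bar>e j x\<bar> \<le> B" "\<And>j. (\<integral>x. e j x \<partial>\<mu>) = 0"
    "\<And>i j. i \<noteq> j \<Longrightarrow> (\<integral>x. e i x * e j x \<partial>\<mu>) = 0"
    "\<And>s \<epsilon>. s \<in> S \<Longrightarrow> \<epsilon> > 0 \<Longrightarrow> \<exists>\<phi>. finite_rank e \<phi> \<and> (\<integral>x. (norm (x s - mean_vec s - \<phi> x))\<^sup>2 \<partial>\<mu>) \<le> \<epsilon>"
  interpret pow_clt_system \<mu> N S Vs C e
    by unfold_locales (fact e)+
  show thesis
  proof (rule lipschitz_limit)
    fix G
    assume G: "G \<in> measurable gauss_seq (pow_borel S)"
      and lip: "\<And>h L B. lipschitz_pow S L h \<Longrightarrow> L \<ge> 0 \<Longrightarrow> (\<And>x. x \<in> pow_space S \<Longrightarrow> \<bar>h x\<bar> \<le> B) \<Longrightarrow>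
      (\<lambda>n. \<integral>\<omega>. h (normalized_sum S Vs (restrict mean_vec S) n \<omega>) \<partial>N) \<longlonglongrightarrow> (\<integral>\<omega>. h (G \<omega>) \<partial>gauss_seq)"
    show thesis
      by (rule that[OF G], rule converges_in_distributionI_lipschitz[OF fin N.prob_space_axioms
            gauss.prob_space_axioms measurable_normalized_sum G lip])
  qed
qed

theorem clt_of_law:
  fixes V :: "'w \<Rightarrow> 's \<Rightarrow> 'b"
  assumes "prob_space M" and V: "V \<in> measurable M (pow_borel S)" and law: "distr M (pow_borel S) V = \<mu>"
  shows "clt_gaussian_limit S M V N Vs"
proof -
  interpret M: prob_space M by fact
  have tr: "(\<integral>\<omega>. \<phi> (V \<omega>) \<partial>M) = (\<integral>x. \<phi> x \<partial>\<mu>)" "integrable M (\<lambda>\<omega>. \<phi> (V \<omega>)) \<longleftrightarrow> integrable \<mu> \<phi>"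
    if "\<phi> \<in> borel_measurable \<mu>" for \<phi> :: "('s \<Rightarrow> 'b) \<Rightarrow> 'c::{banach,second_countable_topology}"
    using integral_distr[OF V, of \<phi>] integrable_distr_eq[OF V, of \<phi>] that by (auto simp: law measurable_\<mu>_iff)
  have "pettis_integral S M V = (\<lambda>s\<in>S. \<integral>\<omega>. V \<omega> s \<partial>M)"
    using tr(2)[OF measurable_coord] integrable_coord by (intro pettis_integral_Bochner[OF fin V]) auto
  also have "\<dots> = restrict mean_vec S"
    using tr(1)[OF measurable_coord] by (auto simp: mean_vec_def)
  finally have pettis: "pettis_integral S M V = restrict mean_vec S" .
  have "clt_gaussian_limit S M V N Vs"
    if G: "G \<in> measurable gauss_seq (pow_borel S)"
      and conv0: "converges_in_distribution S N (normalized_sum S Vs (restrict mean_vec S)) gauss_seq G" for G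
  proof -
    \<comment> \<open>\<open>clt_gaussian_limit\<close> asks for a measure on the function type
      itself, so \<open>G\<close> is replaced by the identity under its law.\<close>
    define Q where "Q = distr gauss_seq (pow_borel S) G"
    have Q: "prob_space Q" unfolding Q_def by (rule gauss.prob_space_distr[OF G])
    have id: "(\<lambda>x. x) \<in> measurable Q (pow_borel S)" by (simp add: Q_def)
    have conv: "converges_in_distribution S N (normalized_sum S Vs (restrict mean_vec S)) Q (\<lambda>x. x)"
      unfolding converges_in_distribution_def
    proof safe
      fix h :: "('s \<Rightarrow> 'b) \<Rightarrow> real"
      assume h: "continuous_map (pow_topology S) euclideanreal h" "bounded (h ` pow_space S)"
      have "(\<integral>x. h x \<partial>Q) = (\<integral>\<omega>. h (G \<omega>) \<partial>gauss_seq)"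
        unfolding Q_def by (rule integral_distr[OF G continuous_map_measurable_pow_borel[OF fin h(1)]])
      then show "(\<lambda>n. \<integral>\<omega>. h (normalized_sum S Vs (restrict mean_vec S) n \<omega>) \<partial>N) \<longlonglongrightarrow> (\<integral>x. h x \<partial>Q)"
        using conv0 h by (simp add: converges_in_distribution_def)
    qed
    have "gaussian_rv S Q (\<lambda>x. x)"
      unfolding gaussian_rv_def
    proof (intro conjI ballI id)
      fix f :: "('s \<Rightarrow> 'b) \<Rightarrow> real" assume f: "f \<in> pow_dual S"
      show "gaussian_law (distr Q borel (\<lambda>x. f x))"
        unfolding limit_distribution[OF Q id conv f] by (rule gaussian_law_scaled) simp
    qed
    moreover have "same_covariance_structure S M V Q (\<lambda>x. x)"
      unfolding same_covariance_structure_def has_pettis_integral_def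
    proof (intro conjI ballI)
      fix f :: "('s \<Rightarrow> 'b) \<Rightarrow> real" assume f: "f \<in> pow_dual S"
      show "integrable Q (\<lambda>x. f x)" by (rule limit_moments(1)[OF Q id conv f])
      show "f (\<lambda>s\<in>S. 0) = (\<integral>x. f x \<partial>Q)"
        using limit_moments(2)[OF Q id conv f] pow_dual_zero[OF f] by simp
    next
      fix f g :: "('s \<Rightarrow> 'b) \<Rightarrow> real" assume fg: "f \<in> pow_dual S" "g \<in> pow_dual S"
      have m: "(\<integral>\<omega>. f (V \<omega>) \<partial>M) = f (restrict mean_vec S)" if "f \<in> pow_dual S" for f
        using tr(1)[OF borel_measurable_integrable[OF pow_dual_mean(1)[OF that]]] pow_dual_mean(2)[OF that] by simp
      have "(\<integral>x. f x * g x \<partial>Q) = (\<integral>x. centered f x * centered g x \<partial>\<mu>)"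
        by (rule limit_covariance[OF Q id conv fg])
      also have "\<dots> = (\<integral>\<omega>. centered f (V \<omega>) * centered g (V \<omega>) \<partial>M)"
        using centered_measurable fg by (subst tr(1)) auto
      also have "\<dots> = real_covariance M (\<lambda>\<omega>. f (V \<omega>)) (\<lambda>\<omega>. g (V \<omega>))"
        by (simp add: real_covariance_def m fg centered_def)
      finally show "(\<integral>x. f x * g x \<partial>Q) = real_covariance M (\<lambda>\<omega>. f (V \<omega>)) (\<lambda>\<omega>. g (V \<omega>))" .
    qed simp
    ultimately show ?thesis
      unfolding clt_gaussian_limit_def pettis using Q conv by blast
  qed
  then show ?thesis using gaussian_limit_exists by blast
qed

end

theorem type_2_clt:
  fixes V :: "'w \<Rightarrow> 's \<Rightarrow> 'b::{banach,second_countable_topology}"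
  assumes fin: "finite S" and "prob_space M" "prob_space N" and V: "V \<in> measurable M (pow_borel S)"
    and "type_2 TYPE('b)" and copies: "independent_copies S M V N Vs"
    and sq: "integrable M (\<lambda>\<omega>. (pow_norm S (V \<omega>))\<^sup>2)"
  shows "clt_gaussian_limit S M V N Vs"
proof -
  interpret M: prob_space M by fact
  interpret N: prob_space N by fact
  obtain C where C: "type_2_const C TYPE('b)" using assms(5) by (rule type_2_imp_const)
  define \<mu> where "\<mu> = distr M (pow_borel S) V"
  interpret pow_clt \<mu> N S Vs C
  proof (intro pow_clt.intro pow_clt_axioms.intro fin C)
    show "prob_space \<mu>" unfolding \<mu>_def by (rule M.prob_space_distr[OF V])
    show "prob_space N" by fact
    show "sets \<mu> = sets (pow_borel S)" by (simp add: \<mu>_def)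
    show "N.indep_vars (\<lambda>_. pow_borel S) Vs UNIV" "\<And>k. distr N (pow_borel S) (Vs k) = \<mu>"
      using copies by (auto simp: independent_copies_def \<mu>_def)
    fix s assume s: "s \<in> S"
    have coord: "(\<lambda>x :: 's \<Rightarrow> 'b. x s) \<in> borel_measurable (pow_borel S)"
      by (rule measurable_pow_borel_component[OF fin _ s]) simp
    have [measurable]: "(\<lambda>\<omega>. V \<omega> s) \<in> borel_measurable M" by (rule measurable_compose[OF V coord])
    have "integrable M (\<lambda>\<omega>. (norm (V \<omega> s))\<^sup>2)"
    proof (rule Bochner_Integration.integrable_bound[OF sq])
      have "(norm (V \<omega> s))\<^sup>2 \<le> (pow_norm S (V \<omega>))\<^sup>2" for \<omega>
        by (intro power_mono norm_le_pow_norm fin s) simp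
      then show "AE \<omega> in M. norm ((norm (V \<omega> s))\<^sup>2) \<le> norm ((pow_norm S (V \<omega>))\<^sup>2)" by simp
    qed measurable
    then show "integrable \<mu> (\<lambda>x. (norm (x s))\<^sup>2)"
      unfolding \<mu>_def using coord by (subst integrable_distr_eq[OF V]) auto
  qed
  show ?thesis by (rule clt_of_law[OF assms(2) V]) (simp add: \<mu>_def)
qed

section \<open>Finiteness of the set of voxels\<close>

text \<open>An infinite bounded set has an accumulation point, near which two distinct points of
  \<open>T\<close> are closer than \<open>s\<close>.\<close>

lemma finite_if_separated_bounded:
  fixes T :: "'a::heine_borel set"
  assumes "bounded T" "s > 0" and sep: "\<And>t t'. t \<in> T \<Longrightarrow> t' \<in> T \<Longrightarrow> dist t t' < s \<Longrightarrow> t = t'"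
  shows "finite T"
proof (rule ccontr)
  assume "infinite T"
  then obtain x where x: "x islimpt T" using bounded_infinite_imp_islimpt assms(1) by blast
  obtain y where y: "y \<in> T" "y \<noteq> x" "dist y x < s / 2"
    using x assms(2) unfolding islimpt_approachable by (meson half_gt_zero)
  have "0 < dist y x" using y by simp
  \<comment> \<open>Being closer to \<open>x\<close> than \<open>y\<close> is, \<open>z\<close>
    differs from \<open>y\<close>.\<close>
  then obtain z where z: "z \<in> T" "z \<noteq> x" "dist z x < dist y x"
    using x unfolding islimpt_approachable by blast
  have "dist y z < s" using dist_triangle2[of y z x] y z by linarith
  then show False using sep[OF y(1) z(1)] z(3) by simp
qed

lemma mem_translated_cube:
  "y \<in> (\<lambda>x. t + x) ` half_open_cube s \<longleftrightarrow> (\<forall>i. t $ i \<le> y $ i \<and> y $ i < t $ i + s)"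
proof -
  have "y \<in> (\<lambda>x. t + x) ` half_open_cube s \<longleftrightarrow> y - t \<in> half_open_cube s"
    by (auto simp: image_iff intro!: bexI[of _ "y - t"])
  also have "\<dots> \<longleftrightarrow> (\<forall>i. t $ i \<le> y $ i \<and> y $ i < t $ i + s)"
    by (auto simp: half_open_cube_def algebra_simps)
  finally show ?thesis .
qed

text \<open>Cubes are counted by their lower corners. The corners of cubes that meet the realization
  are bounded, and two corners closer than \<open>s\<close> belong to overlapping, hence equal,
  cubes of the partition.\<close>

lemma finite_voxels:
  fixes v :: "'v \<Rightarrow> real^'d"
  assumes K: "finite_simplicial_complex K" and s: "s > 0" and P: "cube_partition s P"
  shows "finite (voxels K v P)"
proof -
  define T where "T = {t. (\<lambda>x. t + x) ` half_open_cube s \<in> voxels K v P}"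
  obtain U where U: "finite U" "K \<subseteq> Pow U"
    using K unfolding finite_simplicial_complex_def by (elim exE conjE)
  have "finite K" by (rule finite_subset[OF U(2)]) (simp add: U(1))
  moreover have "bounded (realization v \<sigma>)" if "\<sigma> \<in> K" for \<sigma>
  proof -
    have "\<sigma> \<subseteq> U" using U(2) that by auto
    then have "finite (v ` \<sigma>)" using finite_subset[OF _ U(1)] by simp
    then show ?thesis unfolding realization_def by (intro bounded_convex_hull finite_imp_bounded)
  qed
  ultimately have "bounded (\<Union>\<sigma>\<in>K. realization v \<sigma>)" by (intro bounded_UN) auto
  then obtain R where R: "\<And>y. y \<in> (\<Union>\<sigma>\<in>K. realization v \<sigma>) \<Longrightarrow> norm y \<le> R" unfolding bounded_iff by blast
  have "finite T"
  proof (rule finite_if_separated_bounded[OF _ s])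
    show "bounded T"
      unfolding bounded_iff
    proof (intro exI ballI)
      fix t assume "t \<in> T"
      then obtain y where y: "y \<in> (\<lambda>x. t + x) ` half_open_cube s" "y \<in> (\<Union>\<sigma>\<in>K. realization v \<sigma>)"
        unfolding T_def voxels_def by blast
      have "norm (y - t) \<le> (\<Sum>i\<in>UNIV. \<bar>(y - t) $ i\<bar>)" by (rule norm_le_l1_cart)
      also have "\<dots> \<le> (\<Sum>i\<in>(UNIV::'d set). s)"
      proof (rule sum_mono)
        fix i
        have "t $ i \<le> y $ i \<and> y $ i < t $ i + s" using y(1) unfolding mem_translated_cube by blast
        then show "\<bar>(y - t) $ i\<bar> \<le> s" by simp
      qed
      finally have "norm (y - t) \<le> CARD('d) * s" by simp
      then show "norm t \<le> R + CARD('d) * s"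
        using R[OF y(2)] norm_triangle_ineq4[of y "y - t"] by simp
    qed
    fix t t' assume t: "t \<in> T" "t' \<in> T" and d: "dist t t' < s"
    let ?c = "(\<lambda>x. t + x) ` half_open_cube s" and ?c' = "(\<lambda>x. t' + x) ` half_open_cube s"
    \<comment> \<open>The componentwise maximum of the corners lies in both cubes, since the corners
      differ by less than \<open>s\<close> in each coordinate.\<close>
    define m :: "real^'d" where "m = (\<chi> i. max (t $ i) (t' $ i))"
    have "\<bar>t $ i - t' $ i\<bar> < s" for i
      using component_le_norm_cart[of "t - t'" i] d by (simp add: dist_norm)
    then have m: "m \<in> ?c" "m \<in> ?c'"
      using s unfolding mem_translated_cube m_def by (auto simp: abs_less_iff less_max_iff_disj algebra_simps)
    have P': "disjoint P" "?c \<in> P" "?c' \<in> P"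
      using t P by (auto simp: T_def voxels_def cube_partition_def partition_on_def)
    have eq: "?c = ?c'"
    proof (rule ccontr)
      assume "?c \<noteq> ?c'"
      then have "?c \<inter> ?c' = {}" by (rule disjointD[OF P'])
      moreover have "m \<in> ?c \<inter> ?c'" using m by (rule IntI)
      ultimately show False by (simp only: empty_iff)
    qed
    \<comment> \<open>Half-open cubes contain their lower corner, so equality of the cubes bounds
      the corners by each other in each coordinate.\<close>
    have "t \<in> ?c" "t' \<in> ?c'" unfolding mem_translated_cube using s by auto
    then have "t \<in> ?c'" "t' \<in> ?c" by (simp_all only: eq)
    then have "t $ i = t' $ i" for i unfolding mem_translated_cube by (simp add: order_antisym)
    then show "t = t'" by (simp add: vec_eq_iff)
  qed
  moreover have "voxels K v P \<subseteq> (\<lambda>t. (\<lambda>x. t + x) ` half_open_cube s) ` T"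
  proof
    fix c assume c: "c \<in> voxels K v P"
    then have "c \<in> P" by (simp add: voxels_def)
    then have "\<exists>t. c = (\<lambda>x. t + x) ` half_open_cube s"
      using P unfolding cube_partition_def by (elim conjE bspec)
    then obtain t where "c = (\<lambda>x. t + x) ` half_open_cube s" ..
    with c show "c \<in> (\<lambda>t. (\<lambda>x. t + x) ` half_open_cube s) ` T" by (auto simp: T_def)
  qed
  ultimately show ?thesis by (rule finite_subset[OF _ finite_imageI, rotated])
qed

section \<open>The central limit theorem\<close>

theorem theorem5p5:
  fixes K :: "'v set set" and v :: "'v \<Rightarrow> real^'d"
    and Alg :: "'v algorithm" and ext :: "'v set rel" and kind :: label_kind
    and A :: "(real^'m) set" and \<psi> :: "real^'m \<Rightarrow> 'v set \<Rightarrow> real"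
    and s :: real and P :: "(real^'d) set set"
    and F :: "diagram \<Rightarrow> 'b::{banach, second_countable_topology}"
    and Fhat :: "'v labeled_diagram \<Rightarrow> 'v chain \<Rightarrow> 'b"
    and M :: "'w measure" and X :: "'w \<Rightarrow> real^'m" and N :: "'u measure"
    and \<eta>S :: "real^'m \<Rightarrow> 'v chain \<Rightarrow> 'b"
    and \<eta>K :: "real^'m \<Rightarrow> 'v set \<Rightarrow> 'b"
    and \<eta>C :: "real^'m \<Rightarrow> (real^'d) set \<Rightarrow> 'b"
  assumes "finite_simplicial_complex K"
    and "persistence_algorithm Alg"
    and "linear_extension K ext"
    and "\<psi> \<in> A \<rightarrow> weights K"
    and "s > 0" and "cube_partition s P"
    and "labeled_decomposition K (labeled_diagrams K Alg ext kind) F Fhat"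
    and "\<eta>S = Fhat \<circ> alpha_hat K Alg ext kind A \<psi>"
    and "\<eta>K = simplex_distribution K Fhat \<circ> alpha_hat K Alg ext kind A \<psi>"
    and "\<eta>C = voxel_distribution K v P Fhat \<circ> alpha_hat K Alg ext kind A \<psi>"
    and "\<eta>S \<in> measurable borel (pow_borel (chain_space K))"
    and "\<eta>K \<in> measurable borel (pow_borel K)"
    and "\<eta>C \<in> measurable borel (pow_borel (voxels K v P))"
    and "prob_space M" and "X \<in> measurable M borel"
    and "prob_space N"
    and "type_2 TYPE('b)"
  shows
   "(\<forall>Vs. independent_copies (chain_space K) M (\<eta>S \<circ> X) N Vs \<and>
        integrable M (\<lambda>\<omega>. pow_norm (chain_space K) ((\<eta>S \<circ> X) \<omega>)) \<and>
        integrable M (\<lambda>\<omega>. (pow_norm (chain_space K) ((\<eta>S \<circ> X) \<omega>))\<^sup>2) \<longrightarrow>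
        clt_gaussian_limit (chain_space K) M (\<eta>S \<circ> X) N Vs) \<and>
    (\<forall>Vs. independent_copies K M (\<eta>K \<circ> X) N Vs \<and>
        integrable M (\<lambda>\<omega>. pow_norm K ((\<eta>K \<circ> X) \<omega>)) \<and>
        integrable M (\<lambda>\<omega>. (pow_norm K ((\<eta>K \<circ> X) \<omega>))\<^sup>2) \<longrightarrow>
        clt_gaussian_limit K M (\<eta>K \<circ> X) N Vs) \<and>
    (\<forall>Vs. independent_copies (voxels K v P) M (\<eta>C \<circ> X) N Vs \<and>
        integrable M (\<lambda>\<omega>. pow_norm (voxels K v P) ((\<eta>C \<circ> X) \<omega>)) \<and>
        integrable M (\<lambda>\<omega>. (pow_norm (voxels K v P) ((\<eta>C \<circ> X) \<omega>))\<^sup>2) \<longrightarrow>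
        clt_gaussian_limit (voxels K v P) M (\<eta>C \<circ> X) N Vs)"
proof -
  \<comment> \<open>The three cases differ in the index set; each of these is finite, the voxels
    because the realization is bounded.\<close>
  obtain U where U: "finite U" "K \<subseteq> Pow U"
    using assms(1) unfolding finite_simplicial_complex_def by (elim exE conjE)
  have fin: "finite K" by (rule finite_subset[OF U(2)]) (simp add: U(1))
  then have fin_chain: "finite (chain_space K)" by (simp add: chain_space_def)
  have fin_vox: "finite (voxels K v P)" by (rule finite_voxels[OF assms(1,5,6)])
  note X = assms(15)
  show ?thesis
    using type_2_clt[OF fin_chain assms(14,16) measurable_comp[OF X assms(11)] assms(17)]
      type_2_clt[OF fin assms(14,16) measurable_comp[OF X assms(12)] assms(17)]
      type_2_clt[OF fin_vox assms(14,16) measurable_comp[OF X assms(13)] assms(17)]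
    by blast
qed

end
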